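(* Let $$\rho : \mathrm{SL}(2,\mathbb{C}) \to \mathrm{GL}(V), \qquad \sigma : \mathrm{SL}(2,\mathbb{C}) \to \mathrm{GL}(W)$$ be algebraic representations with multiplicity maps $\mathsf{m}_\rho, \mathsf{m}_\sigma : \mathbb{N}_{>0} \to \mathbb{N}$. Suppose that the following two conditions hold: (i') For all $\alpha \in [0,\infty)$, $$\sum_{d \in \mathbb{N}_{>0}} \mathsf{m}_\rho(d)\, \frac{\sinh(\alpha d)}{\sinh(\alpha)} \;<\; \sum_{d \in \mathbb{N}_{>0}} \mathsf{m}_\sigma(d)\, \frac{\sinh(\alpha d)}{\sinh(\alpha)}.$$ (ii') $\max \{ d \in \mathbb{N}_{>0} \mid \mathsf{m}_\rho(d) > 0 \} \;<\; \max \{ d \in \mathbb{N}_{>0} \mid \mathsf{m}_\sigma(d) > 0 \}.$ Then the following hold: (a) (Catalytic) There is a nonzero representation $\eta$ such that $\rho \otimes \eta \hookrightarrow \sigma \otimes \eta$. (b) (Asymptotic) If $\sigma$ is generic, then there is $n_0 \in \mathbb{N}$ such that $\rho^{\otimes n} \hookrightarrow \sigma^{\otimes n}$ for all $n \ge n_0$. Conversely, if $\rho \otimes \eta \hookrightarrow \sigma \otimes \eta$ for some nonzero representation $\eta$, or $\rho^{\otimes n} \hookrightarrow \sigma^{\otimes n}$ for some integer $n \ge 1$, then the inequalities in (i') (for all $\alpha \in [0,\infty)$) and the inequality in (ii') hold with $<$ replaced by $\le$.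
   Context: All representations are finite-dimensional complex algebraic representations of $\mathrm{SL}(2,\mathbb{C})$. The notation $\rho \hookrightarrow \sigma$ means that $\rho$ is isomorphic to a subrepresentation of $\sigma$. The multiplicity map $\mathsf{m}_\rho : \mathbb{N}_{>0} \to \mathbb{N}$ of a representation $\rho$ assigns to each $d > 0$ the multiplicity in $\rho$ of the irreducible representation of dimension $d$; it has finite support. For $\alpha = 0$, the expression $\sinh(\alpha d)/\sinh(\alpha)$ is understood as its limit $d$ as $\alpha \to 0$. The maximum of the empty set (occurring for the zero representation) is taken to be $-\infty$. A representation is called generic if it contains both the trivial representation and the standard representation (on $\mathbb{C}^2$) as subrepresentations. *)

theory Defs
  imports
    Complex_Main
    "HOL-Library.Extended_Real"
    "Jordan_Normal_Form.Determinant"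
    "Jordan_Normal_Form.VS_Connect"
begin

definition SL2 :: "complex mat monoid" where
  "SL2 = \<lparr>carrier = {g \<in> carrier_mat 2 2. det g = 1}, mult = (*), one = 1\<^sub>m 2\<rparr>"

definition GL :: "nat \<Rightarrow> complex mat monoid" where
  "GL n = units_of (ring_mat TYPE(complex) n ())"

text \<open>The regular functions on \<open>SL(2,\<complex>)\<close>: the complex algebra of functions generated by the four
  matrix entries.  Only the values of such a function on the carrier of \<open>SL2\<close> are relevant.\<close>

inductive regular_fun :: "(complex mat \<Rightarrow> complex) \<Rightarrow> bool" where
  const: "regular_fun (\<lambda>g. c)"
| entry: "i < 2 \<Longrightarrow> j < 2 \<Longrightarrow> regular_fun (\<lambda>g. g $$ (i, j))"
| add: "regular_fun p \<Longrightarrow> regular_fun q \<Longrightarrow> regular_fun (\<lambda>g. p g + q g)"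
| mult: "regular_fun p \<Longrightarrow> regular_fun q \<Longrightarrow> regular_fun (\<lambda>g. p g * q g)"

text \<open>A representation on a finite-dimensional space \<open>V\<close> is given, in a basis of \<open>V\<close>, by a
  homomorphism into \<open>GL n\<close> with \<open>n = dim V\<close>; the case \<open>n = 0\<close> is allowed.  A representation is a
  function on all matrices, of which only the restriction to the carrier of \<open>SL2\<close> matters, and its
  dimension is read off from the size of the image of the identity.\<close>

type_synonym rep = "complex mat \<Rightarrow> complex mat"

definition rep_dim :: "rep \<Rightarrow> nat" where
  "rep_dim \<rho> = dim_row (\<rho> (1\<^sub>m 2))"

text \<open>The inverse determinant of \<open>\<rho> g\<close> need not be required to be regular separately, since it is
  the determinant of \<open>\<rho>\<close> at the inverse of \<open>g\<close>.\<close>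

definition alg_rep :: "rep \<Rightarrow> bool" where
  "alg_rep \<rho> \<longleftrightarrow>
     \<rho> \<in> hom SL2 (GL (rep_dim \<rho>)) \<and>
     (\<forall>i < rep_dim \<rho>. \<forall>j < rep_dim \<rho>. \<exists>p. regular_fun p \<and>
        (\<forall>g \<in> carrier SL2. \<rho> g $$ (i, j) = p g))"

definition equivariant :: "rep \<Rightarrow> rep \<Rightarrow> complex mat \<Rightarrow> bool" where
  "equivariant \<rho> \<sigma> T \<longleftrightarrow>
     T \<in> carrier_mat (rep_dim \<sigma>) (rep_dim \<rho>) \<and> (\<forall>g \<in> carrier SL2. T * \<rho> g = \<sigma> g * T)"

definition rep_iso :: "rep \<Rightarrow> rep \<Rightarrow> bool" where
  "rep_iso \<rho> \<sigma> \<longleftrightarrow>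
     (\<exists>T. equivariant \<rho> \<sigma> T \<and>
        bij_betw ((*\<^sub>v) T) (carrier_vec (rep_dim \<rho>)) (carrier_vec (rep_dim \<sigma>)))"

definition invariant_subspace :: "rep \<Rightarrow> complex vec set \<Rightarrow> bool" where
  "invariant_subspace \<rho> W \<longleftrightarrow>
     VectorSpace.subspace class_ring W (module_vec TYPE(complex) (rep_dim \<rho>)) \<and>
     (\<forall>g \<in> carrier SL2. \<forall>w \<in> W. \<rho> g *\<^sub>v w \<in> W)"

text \<open>\<open>\<rho> \<hookrightarrow> \<sigma>\<close>: the representation \<open>\<rho>\<close> is isomorphic to the restriction of \<open>\<sigma>\<close> to some invariant
  subspace \<open>W\<close>.\<close>

definition embeds :: "rep \<Rightarrow> rep \<Rightarrow> bool" where
  "embeds \<rho> \<sigma> \<longleftrightarrow>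
     (\<exists>W T. invariant_subspace \<sigma> W \<and> equivariant \<rho> \<sigma> T \<and>
        bij_betw ((*\<^sub>v) T) (carrier_vec (rep_dim \<rho>)) W)"

definition irreducible_rep :: "rep \<Rightarrow> bool" where
  "irreducible_rep \<rho> \<longleftrightarrow>
     rep_dim \<rho> > 0 \<and>
     (\<forall>W. invariant_subspace \<rho> W \<longrightarrow> W = {0\<^sub>v (rep_dim \<rho>)} \<or> W = carrier_vec (rep_dim \<rho>))"

definition trivial_rep :: rep where
  "trivial_rep = (\<lambda>g. 1\<^sub>m 1)"

definition standard_rep :: rep where
  "standard_rep = (\<lambda>g. g)"

definition direct_sum :: "rep list \<Rightarrow> rep" where
  "direct_sum \<tau>s = (\<lambda>g. diag_block_mat (map (\<lambda>\<tau>. \<tau> g) \<tau>s))"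

text \<open>Kronecker product: the matrix of the tensor product of two linear maps with respect to the
  product basis in lexicographic order.\<close>

definition kronecker :: "complex mat \<Rightarrow> complex mat \<Rightarrow> complex mat" where
  "kronecker A B =
     mat (dim_row A * dim_row B) (dim_col A * dim_col B)
       (\<lambda>(i, j). A $$ (i div dim_row B, j div dim_col B) * B $$ (i mod dim_row B, j mod dim_col B))"

definition rep_tensor :: "rep \<Rightarrow> rep \<Rightarrow> rep" where
  "rep_tensor \<rho> \<sigma> = (\<lambda>g. kronecker (\<rho> g) (\<sigma> g))"

fun rep_tensor_pow :: "rep \<Rightarrow> nat \<Rightarrow> rep" where
  "rep_tensor_pow \<rho> 0 = trivial_rep"
| "rep_tensor_pow \<rho> (Suc n) = rep_tensor \<rho> (rep_tensor_pow \<rho> n)"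

definition generic_rep :: "rep \<Rightarrow> bool" where
  "generic_rep \<rho> \<longleftrightarrow> embeds trivial_rep \<rho> \<and> embeds standard_rep \<rho>"

text \<open>The multiplicity of the irreducible representation of dimension \<open>d\<close>: the number of its copies
  in a decomposition of \<open>\<rho>\<close> into irreducible representations.  Irreducible algebraic representations
  of \<open>SL(2,\<complex>)\<close> are determined up to isomorphism by their dimension, so these copies are the summands
  of dimension \<open>d\<close>.  A decomposition exists and the count does not depend on it, by complete
  reducibility and the Krull-Schmidt theorem.\<close>

definition mult_map :: "rep \<Rightarrow> nat \<Rightarrow> nat" where
  "mult_map \<rho> d =
     (THE k. \<exists>\<tau>s. (\<forall>\<tau> \<in> set \<tau>s. alg_rep \<tau> \<and> irreducible_rep \<tau>) \<and>
        rep_iso \<rho> (direct_sum \<tau>s) \<and>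
        k = length (filter (\<lambda>\<tau>. rep_dim \<tau> = d) \<tau>s))"

definition mult_supp :: "rep \<Rightarrow> nat set" where
  "mult_supp \<rho> = {d. d > 0 \<and> mult_map \<rho> d > 0}"

definition sinh_quotient :: "real \<Rightarrow> nat \<Rightarrow> real" where
  "sinh_quotient \<alpha> d = (if \<alpha> = 0 then real d else sinh (\<alpha> * real d) / sinh \<alpha>)"

text \<open>The sum over all \<open>d > 0\<close> is written as the sum over the finite support.\<close>

definition sinh_sum :: "rep \<Rightarrow> real \<Rightarrow> real" where
  "sinh_sum \<rho> \<alpha> = (\<Sum>d \<in> mult_supp \<rho>. real (mult_map \<rho> d) * sinh_quotient \<alpha> d)"

definition max_dim :: "rep \<Rightarrow> ereal" where
  "max_dim \<rho> = (if mult_supp \<rho> = {} then - \<infinity> else ereal (real (Max (mult_supp \<rho>))))"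

end

theory Submission
  imports Defs "HOL-Computational_Algebra.Fundamental_Theorem_Algebra"
begin

text \<open>The character of a representation of \<open>SL(2,\<complex>)\<close> at the diagonal matrix with entries \<open>t\<close> and \<open>1/t\<close> is
a polynomial in \<open>u = t + 1/t\<close>.  The irreducible representation of dimension \<open>d\<close> contributes the
polynomial \<open>chi d\<close>, and these polynomials form a basis.  Writing \<open>R\<close> and \<open>S\<close> for the polynomials of
\<open>\<rho>\<close> and \<open>\<sigma>\<close>, an embedding of \<open>\<rho>\<close> into \<open>\<sigma>\<close> exists if and only if \<open>S - R\<close> lies in the cone of
nonnegative combinations of the \<open>chi d\<close>; tensor products become products, and with \<open>u = 2 cosh \<alpha>\<close> the
two hypotheses say that \<open>R < S\<close> on \<open>[2,\<infinity>)\<close> and that \<open>R\<close> vanishes or has smaller degree than \<open>S\<close>.  The theorem is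
thereby reduced to a statement about real polynomials.

\<^bold>\<open>Polynomials.\<close>  Elements of the cone are nonnegative on \<open>[2,\<infinity>)\<close>, which gives the converse direction.
For the catalytic part a polynomial \<open>F > 0\<close> on \<open>[2,\<infinity>)\<close> has to be multiplied into the cone by a nonzero
element of the cone (\<open>catalyst\<close>).  This is multiplicative in \<open>F\<close>, so it is enough to treat a factor \<open>u - r\<close>
with \<open>r < 2\<close> and an irreducible quadratic factor.  In both cases a recurrence with solution
\<open>sin (d \<theta>)\<close>, stopped at its first sign change, supplies the multiplier.  Strict positivity and rounding make the
multiplier integral (\<open>natural_catalyst\<close>).  For the asymptotic part (\<open>asymptotic_cone\<close>) a power of \<open>S\<close> is
compared with the same power of \<open>R\<close> times a spare factor \<open>2 (1 + u)\<close>; the powers of this factor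
eventually outgrow the catalyst, which is bounded by a multiple of a power of the generic polynomial \<open>S\<close>.

\<^bold>\<open>Representations.\<close>  Complete reducibility is obtained at the level of the group.  Let \<open>v\<close> be a vector
of maximal weight \<open>m\<close> for the diagonal torus, and \<open>w\<close> a linear form of the same weight with \<open>w v = 1\<close>.
The orbit of \<open>v\<close> is \<open>a\<^sup>m v\<^sub>0 + a\<^bsup>m-1\<^esup> c v\<^sub>1 + \<dots> + c\<^sup>m v\<^sub>m\<close>, where \<open>(a, c)\<close> is the first column of
the group element, so that the \<open>v\<^sub>k\<close> span a copy of the \<open>m\<close>-th symmetric power of \<open>\<complex>\<^sup>2\<close>.  Likewise the
orbit of \<open>w\<close> gives a map onto this symmetric power, and the pairing \<open>(1 + t s)\<^sup>m\<close> of the two orbits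
shows that together they split off a direct summand (\<open>highest_weight_summand\<close>).  Iteration gives
\<open>complete_reducibility\<close>.  An injective equivariant map preserves highest weight vectors, and counting
these compares multiplicities (\<open>embeds_iff_mult_map_le\<close>).\<close>

section \<open>The basis of irreducible characters\<close>

text \<open>The character of the irreducible representation of dimension \<open>n\<close> in the variable \<open>u = t + 1/t\<close>, that is,
\<open>(t\<^sup>n - t\<^bsup>-n\<^esup>) / (t - t\<^bsup>-1\<^esup>)\<close>: the Chebyshev polynomial of the second kind \<open>U\<^bsub>n-1\<^esub>(u/2)\<close>.\<close>

fun chi :: "nat \<Rightarrow> real poly" where
  "chi 0 = 0"
| "chi (Suc 0) = 1"
| "chi (Suc (Suc n)) = [:0, 1:] * chi (Suc n) - chi n"

text \<open>The coordinates of a polynomial in the basis \<open>chi 1, chi 2, \<dots>\<close> are computed by Horner's scheme, because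
multiplication by \<open>u\<close> sends \<open>chi d\<close> to \<open>chi (d - 1) + chi (d + 1)\<close>.  Index \<open>0\<close> is kept at \<open>0\<close>, in accordance
with \<open>chi 0 = 0\<close>.\<close>

definition chi_coeff_step :: "real \<Rightarrow> (nat \<Rightarrow> real) \<Rightarrow> nat \<Rightarrow> real" where
  "chi_coeff_step a c d = (if d = 0 then 0 else (if d = 1 then a else 0) + c (d - 1) + c (d + 1))"

definition chi_coeff :: "real poly \<Rightarrow> nat \<Rightarrow> real" where
  "chi_coeff p = fold_coeffs chi_coeff_step p (\<lambda>_. 0)"

lemma chi_coeff_0 [simp]: "chi_coeff 0 = (\<lambda>_. 0)"
  by (simp add: chi_coeff_def)

lemma chi_coeff_pCons: "chi_coeff (pCons a p) = chi_coeff_step a (chi_coeff p)"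
proof (cases "p = 0 \<and> a = 0")
  case True
  then show ?thesis by (auto simp: chi_coeff_step_def fun_eq_iff)
next
  case False
  then show ?thesis by (auto simp: chi_coeff_def)
qed

lemma chi_coeff_index_0 [simp]: "chi_coeff p 0 = 0"
  by (cases p) (simp add: chi_coeff_pCons chi_coeff_step_def)

lemma chi_coeff_add: "chi_coeff (p + q) d = chi_coeff p d + chi_coeff q d"
proof (induction p q arbitrary: d rule: poly_induct2)
  case 0 then show ?case by simp
next
  case (pCons a p b q)
  then show ?case by (simp add: chi_coeff_pCons chi_coeff_step_def)
qed

lemma chi_coeff_smult: "chi_coeff (Polynomial.smult c p) d = c * chi_coeff p d"
  by (induction p arbitrary: d) (simp_all add: chi_coeff_pCons chi_coeff_step_def algebra_simps)

lemma chi_coeff_diff: "chi_coeff (p - q) d = chi_coeff p d - chi_coeff q d"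
proof -
  have "p - q = p + Polynomial.smult (- 1) q" by simp
  then show ?thesis by (metis chi_coeff_add chi_coeff_smult mult_minus1 uminus_add_conv_diff add.commute)
qed

lemma chi_coeff_sum: "chi_coeff (\<Sum>i\<in>I. f i) d = (\<Sum>i\<in>I. chi_coeff (f i) d)"
  by (induction I rule: infinite_finite_induct) (simp_all add: chi_coeff_add)

lemma chi_coeff_X_mult: "chi_coeff ([:0, 1:] * p) d = (if d = 0 then 0 else chi_coeff p (d - 1) + chi_coeff p (d + 1))"
  by (auto simp add: chi_coeff_pCons chi_coeff_step_def)

lemma chi_coeff_1: "chi_coeff 1 d = (if d = 1 then 1 else 0)"
  by (simp add: one_pCons chi_coeff_pCons chi_coeff_step_def)

lemma chi_coeff_chi: "chi_coeff (chi n) d = (if d = n \<and> 0 < d then 1 else 0)"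
proof (induction n arbitrary: d rule: chi.induct)
  case 1
  then show ?case by auto
next
  case 2
  then show ?case by (simp add: chi_coeff_1)
next
  case (3 n)
  show ?case
    unfolding chi.simps chi_coeff_diff chi_coeff_X_mult 3 by auto
qed

lemma chi_coeff_beyond_degree: "Suc (degree p) < d \<Longrightarrow> chi_coeff p d = 0"
proof (induction p arbitrary: d)
  case 0
  then show ?case by simp
next
  case (pCons a p)
  show ?case
  proof (cases "p = 0")
    case True
    then show ?thesis using pCons.prems by (simp add: chi_coeff_pCons chi_coeff_step_def)
  next
    case False
    then show ?thesis using pCons by (simp add: chi_coeff_pCons chi_coeff_step_def)
  qed
qed

text \<open>The polynomial \<open>chi (n + 1)\<close> is monic of degree \<open>n\<close>, so the last coordinate is the leading coefficient.
Hence a polynomial is determined by its coordinates.\<close>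

lemma chi_coeff_top: "chi_coeff p (Suc (degree p)) = lead_coeff p"
proof (induction p)
  case 0
  then show ?case by simp
next
  case (pCons a p)
  then show ?case
    by (cases "p = 0") (simp_all add: chi_coeff_pCons chi_coeff_step_def chi_coeff_beyond_degree)
qed

lemma chi_coeff_eqD: assumes "\<And>d. chi_coeff p d = chi_coeff q d" shows "p = q"
proof -
  have "lead_coeff (p - q) = 0"
    using assms chi_coeff_top[of "p - q"] by (simp add: chi_coeff_diff)
  then have "p - q = 0" by (simp only: leading_coeff_0_iff)
  then show ?thesis by simp
qed

lemma chi_coeff_combination:
  "chi_coeff (\<Sum>d\<in>{1..N}. Polynomial.smult (c d) (chi d)) d = (if 1 \<le> d \<and> d \<le> N then c d else 0)"
proof -
  have "chi_coeff (\<Sum>d\<in>{1..N}. Polynomial.smult (c d) (chi d)) d = (\<Sum>e\<in>{1..N}. if e = d then c d else 0)"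
    unfolding chi_coeff_sum chi_coeff_smult chi_coeff_chi by (intro sum.cong) auto
  then show ?thesis by simp
qed

lemma chi_expansion:
  assumes "degree p < N"
  shows "p = (\<Sum>d\<in>{1..N}. Polynomial.smult (chi_coeff p d) (chi d))"
proof (rule chi_coeff_eqD)
  fix d show "chi_coeff p d = chi_coeff (\<Sum>d\<in>{1..N}. Polynomial.smult (chi_coeff p d) (chi d)) d"
    unfolding chi_coeff_combination using assms by (cases "d = 0") (auto simp: chi_coeff_beyond_degree)
qed

text \<open>The differences \<open>S - R\<close> in this set are those for which every irreducible representation is at least as
frequent in \<open>S\<close> as in \<open>R\<close>.  Real coordinates are allowed, so that the cone can be studied by factoring
polynomials.\<close>

definition cone :: "real poly set" where
  "cone = {p. \<forall>d. 0 \<le> chi_coeff p d}"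

text \<open>The Clebsch-Gordan rule in telescoped form: raising both dimensions by one adds the Cartan component
to the tensor product.\<close>

lemma chi_mult_Suc: "chi (Suc a) * chi (Suc b) = chi a * chi b + chi (Suc (a + b))"
proof (induction a arbitrary: b rule: chi.induct)
  case 1
  then show ?case by simp
next
  case 2
  then show ?case by simp
next
  case (3 n)
  have "chi (Suc (Suc (Suc n))) * chi (Suc b)
      = [:0, 1:] * (chi (Suc (Suc n)) * chi (Suc b)) - chi (Suc n) * chi (Suc b)"
    unfolding chi.simps(3)[of "Suc n"] by (simp only: left_diff_distrib mult.assoc)
  also have "\<dots> = [:0, 1:] * (chi (Suc n) * chi b + chi (Suc (Suc n + b)))
      - (chi n * chi b + chi (Suc (n + b)))"
    unfolding 3 ..
  also have "\<dots> = chi (Suc (Suc n)) * chi b + chi (Suc (Suc (Suc n) + b))"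
    unfolding add_Suc chi.simps(3) by (simp only: left_diff_distrib right_diff_distrib distrib_left mult.assoc)
  finally show ?case .
qed

lemma cone_0 [simp]: "0 \<in> cone" and cone_1 [simp]: "1 \<in> cone"
  by (auto simp: cone_def chi_coeff_1)

lemma cone_chi [simp]: "chi d \<in> cone"
  by (auto simp: cone_def chi_coeff_chi)

lemma cone_add: "p \<in> cone \<Longrightarrow> q \<in> cone \<Longrightarrow> p + q \<in> cone"
  by (auto simp: cone_def chi_coeff_add)

lemma cone_smult: "p \<in> cone \<Longrightarrow> 0 \<le> c \<Longrightarrow> Polynomial.smult c p \<in> cone"
  by (auto simp: cone_def chi_coeff_smult)

lemma cone_sum: "(\<And>i. i \<in> I \<Longrightarrow> f i \<in> cone) \<Longrightarrow> (\<Sum>i\<in>I. f i) \<in> cone"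
  by (auto simp: cone_def chi_coeff_sum intro: sum_nonneg)

lemma chi_mult_cone: "chi a * chi b \<in> cone"
proof (induction a arbitrary: b)
  case 0
  then show ?case by simp
next
  case (Suc a)
  then show ?case by (cases b) (auto simp: chi_mult_Suc intro: cone_add)
qed

lemma cone_mult: assumes "p \<in> cone" "q \<in> cone" shows "p * q \<in> cone"
proof -
  have "p * q = (\<Sum>d\<in>{1..Suc (degree p)}. Polynomial.smult (chi_coeff p d) (chi d))
      * (\<Sum>d\<in>{1..Suc (degree q)}. Polynomial.smult (chi_coeff q d) (chi d))"
    using chi_expansion[of p "Suc (degree p)"] chi_expansion[of q "Suc (degree q)"] by simp
  also have "\<dots> \<in> cone"
    unfolding sum_product mult_smult_left mult_smult_right using assms
    by (intro cone_sum cone_smult chi_mult_cone) (auto simp: cone_def)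
  finally show ?thesis .
qed

lemma cone_power: "p \<in> cone \<Longrightarrow> p ^ n \<in> cone"
  by (induction n) (auto intro: cone_mult)

text \<open>The powers of \<open>u\<close> are characters of tensor powers of the standard representation.\<close>

lemma cone_nonneg_coeffs: "(\<And>i. 0 \<le> coeff p i) \<Longrightarrow> p \<in> cone"
proof (induction p)
  case 0
  then show ?case by simp
next
  case (pCons a p)
  have "0 \<le> coeff p i" for i using pCons.prems[of "Suc i"] by simp
  then have "p \<in> cone" by (rule pCons.IH)
  moreover have "0 \<le> a" using pCons.prems[of 0] by simp
  ultimately show ?case by (auto simp: cone_def chi_coeff_pCons chi_coeff_step_def)
qed

section \<open>Multiplying positive polynomials into the cone\<close>

text \<open>The sequence \<open>sin (d \<theta>)\<close> solves \<open>x\<^bsub>d-1\<^esub> + x\<^bsub>d+1\<^esub> = 2 cos \<theta> x\<^sub>d\<close>.  It is cut off at its last nonnegative value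
before the first sign change, so that the defect of the recurrence at the cut is nonnegative.\<close>

lemma sine_cutoff:
  fixes \<theta> :: real
  assumes "0 < \<theta>" "\<theta> < pi"
  obtains n :: nat where "1 \<le> n" "\<And>d. d \<le> n \<Longrightarrow> 0 \<le> sin (real d * \<theta>)"
    "sin (real (Suc n) * \<theta>) \<le> 0"
proof -
  define n where "n = nat \<lfloor>pi / \<theta>\<rfloor>"
  have 1: "1 \<le> pi / \<theta>" using assms by simp
  have fl: "real n \<le> pi / \<theta>" "pi / \<theta> < real n + 1" 
    using 1 unfolding n_def by linarith+
  have n1: "1 \<le> n" using fl(2) 1 by linarith
  have le: "real n * \<theta> \<le> pi" and gt: "pi < (real n + 1) * \<theta>"
    using fl assms(1) by (simp_all add: field_simps)
  show ?thesis
  proof (rule that[OF n1])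
    fix d assume "d \<le> n"
    then have "real d * \<theta> \<le> real n * \<theta>" using assms(1) by simp
    then have "real d * \<theta> \<le> pi" using le by linarith
    then show "0 \<le> sin (real d * \<theta>)" using assms(1) by (intro sin_ge_zero) auto
  next
    have "(real n + 1) * \<theta> < 2 * pi" using le assms(2) by (simp add: algebra_simps)
    then have "sin (real n * \<theta> + \<theta> - pi) \<ge> 0" using gt by (intro sin_ge_zero) (auto simp: algebra_simps)
    then show "sin (real (Suc n) * \<theta>) \<le> 0" by (simp add: sin_diff algebra_simps)
  qed
qed

lemma sin_recurrence:
  "sin (real d * \<theta>) + sin (real (Suc (Suc d)) * \<theta>) = 2 * cos \<theta> * sin (real (Suc d) * \<theta>)"
proof -
  have "real d * \<theta> = real (Suc d) * \<theta> - \<theta>" "real (Suc (Suc d)) * \<theta> = real (Suc d) * \<theta> + \<theta>"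
    by (simp_all add: algebra_simps)
  moreover have "sin (x - \<theta>) + sin (x + \<theta>) = 2 * cos \<theta> * sin x" for x
    by (simp add: sin_diff sin_add)
  ultimately show ?thesis by metis
qed

text \<open>For \<open>0 < r < 2\<close> put \<open>r = 2 cos \<theta>\<close>.  The product of \<open>u - r\<close> with the sum of \<open>sin (d \<theta>) chi d\<close> over \<open>d \<le> n\<close>
collapses to the boundary terms \<open>- sin ((n + 1) \<theta>) chi n + sin (n \<theta>) chi (n + 1)\<close>, and both signs are right.\<close>

lemma linear_catalyst:
  assumes "r < 2"
  shows "\<exists>G \<in> cone. G \<noteq> 0 \<and> [:- r, 1:] * G \<in> cone"
proof (cases "r \<le> 0")
  case True
  then have "[:- r, 1:] * 1 \<in> cone" by (intro cone_nonneg_coeffs) (auto simp: coeff_pCons split: nat.split)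
  then show ?thesis using cone_1 one_neq_zero by blast
next
  case False
  define \<theta> where "\<theta> = arccos (r / 2)"
  have c: "cos \<theta> = r / 2" unfolding \<theta>_def using assms False by (intro cos_arccos) auto
  have "0 < \<theta>" "\<theta> < pi" unfolding \<theta>_def using assms False arccos_lt_bounded[of "r/2"] by auto
  then obtain n where n: "1 \<le> n" "\<And>d. d \<le> n \<Longrightarrow> 0 \<le> sin (real d * \<theta>)"
    "sin (real (Suc n) * \<theta>) \<le> 0" by (rule sine_cutoff) blast
  define G where "G = (\<Sum>d\<in>{1..n}. Polynomial.smult (sin (real d * \<theta>)) (chi d))"
  have ccG: "chi_coeff G d = (if d \<le> n then sin (real d * \<theta>) else 0)" for d
    unfolding G_def chi_coeff_combination by (cases "d = 0") auto
  have "0 < sin \<theta>" using \<open>0 < \<theta>\<close> \<open>\<theta> < pi\<close> by (rule sin_gt_zero)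
  then have "chi_coeff G 1 \<noteq> 0" using n(1) by (simp add: ccG)
  then have "G \<noteq> 0" by auto
  moreover have "G \<in> cone" unfolding cone_def using n(2) by (auto simp: ccG)
  moreover have "[:- r, 1:] * G \<in> cone"
    unfolding cone_def
  proof safe
    fix d
    have e: "[:- r, 1:] * G = [:0, 1:] * G - Polynomial.smult r G" by simp
    show "0 \<le> chi_coeff ([:- r, 1:] * G) d"
    proof (cases d)
      case 0
      then show ?thesis by simp
    next
      case (Suc k)
      have 1: "chi_coeff ([:- r, 1:] * G) d = chi_coeff G k + chi_coeff G (Suc (Suc k)) - r * chi_coeff G (Suc k)"
        unfolding e chi_coeff_diff chi_coeff_smult chi_coeff_X_mult Suc by simp
      have 2: "sin (real k * \<theta>) + sin (real (Suc (Suc k)) * \<theta>) - r * sin (real (Suc k) * \<theta>) = 0"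
        unfolding sin_recurrence c by simp
      consider "Suc (Suc k) \<le> n" | "Suc k = n" | "k = n" | "n < k" by linarith
      then show ?thesis
      proof cases
        case 1
        then show ?thesis unfolding \<open>chi_coeff ([:- r, 1:] * G) d = _\<close> ccG using 2 by simp
      next
        case c: 2
        have "chi_coeff ([:- r, 1:] * G) d = - sin (real (Suc n) * \<theta>)"
          unfolding 1 ccG using 2 c by simp
        then show ?thesis using n(3) by simp
      next
        case 3
        then show ?thesis unfolding 1 ccG using n(2)[of n] by simp
      next
        case 4
        then show ?thesis unfolding 1 ccG by simp
      qed
    qed
  qed
  ultimately show ?thesis by blast
qed

text \<open>The same truncation with powers of \<open>x = u / r\<close> in place of the \<open>chi d\<close>: up to a factor the numbers
\<open>sin ((k + 1) \<theta>)\<close> are the coefficients of the power series of \<open>1 / (1 - 2 cos \<theta> x + x\<^sup>2)\<close>, whose denominator is the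
given quadratic polynomial divided by \<open>r\<^sup>2\<close>.\<close>

lemma quadratic_catalyst:
  assumes "\<bar>a\<bar> < r"
  shows "\<exists>G \<in> cone. G \<noteq> 0 \<and> [:r\<^sup>2, - 2 * a, 1:] * G \<in> cone"
proof -
  define \<theta> where "\<theta> = arccos (a / r)"
  have r: "0 < r" using assms by linarith
  have ar: "- 1 < a / r" "a / r < 1" using assms r by (auto simp: field_simps abs_if split: if_splits)
  have c: "cos \<theta> = a / r" unfolding \<theta>_def using ar by (intro cos_arccos) auto
  have "0 < \<theta>" "\<theta> < pi" unfolding \<theta>_def using ar arccos_lt_bounded[of "a/r"] by auto
  then obtain n where n: "1 \<le> n" "\<And>d. d \<le> n \<Longrightarrow> 0 \<le> sin (real d * \<theta>)"
    "sin (real (Suc n) * \<theta>) \<le> 0" by (rule sine_cutoff) blast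
  define s where "s k = sin (real k * \<theta>)" for k
  have rec: "s k + s (Suc (Suc k)) = 2 * (a / r) * s (Suc k)" for k
    unfolding s_def sin_recurrence c ..
  have s: "\<And>d. d \<le> n \<Longrightarrow> 0 \<le> s d" "s (Suc n) \<le> 0" "s 0 = 0" using n by (auto simp: s_def)
  define G where "G = (\<Sum>k<n. monom (s (Suc k) / r ^ k) k)"
  have cG: "coeff G k = (if k < n then s (Suc k) / r ^ k else 0)" for k
  proof -
    have "coeff G k = (\<Sum>i<n. if i = k then s (Suc k) / r ^ k else 0)"
      unfolding G_def coeff_sum coeff_monom by (intro sum.cong) auto
    then show ?thesis by simp
  qed
  have "0 < s 1" unfolding s_def using \<open>0 < \<theta>\<close> \<open>\<theta> < pi\<close> by (simp add: sin_gt_zero)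
  then have "coeff G 0 \<noteq> 0" using n(1) by (simp add: cG)
  then have "G \<noteq> 0" by auto
  moreover have "G \<in> cone" using s r by (intro cone_nonneg_coeffs) (simp add: cG)
  moreover have "[:r\<^sup>2, - 2 * a, 1:] * G \<in> cone"
  proof (rule cone_nonneg_coeffs)
    fix k
    consider "k = 0" | "k = 1" | j where "k = Suc (Suc j)" by (metis One_nat_def not0_implies_Suc)
    then show "0 \<le> coeff ([:r\<^sup>2, - 2 * a, 1:] * G) k"
    proof cases
      case 1
      then show ?thesis using n(1) s r \<open>0 < s 1\<close> by (simp add: cG)
    next
      case 2
      have "coeff ([:r\<^sup>2, - 2 * a, 1:] * G) k = r\<^sup>2 * coeff G 1 - 2 * a * coeff G 0"
        using 2 by (simp add: coeff_pCons)
      also have "\<dots> \<ge> 0"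
      proof (cases "n = 1")
        case True
        have "2 * (a / r) * s 1 \<le> 0" using rec[of 0] s(2,3) True by simp
        then have "r * (2 * (a / r) * s 1) \<le> 0" using r by (simp only: mult_le_0_iff) simp
        then show ?thesis using True r by (simp add: cG)
      next
        case False
        then have "r\<^sup>2 * coeff G 1 - 2 * a * coeff G 0 = r * (s 2 - 2 * (a / r) * s 1)"
          using n(1) r by (simp add: cG field_simps power2_eq_square numeral_2_eq_2)
        then show ?thesis using rec[of 0] s(3) by (simp add: numeral_2_eq_2)
      qed
      finally show ?thesis .
    next
      case (3 j)
      have e: "coeff ([:r\<^sup>2, - 2 * a, 1:] * G) k
          = coeff G j - 2 * a * coeff G (Suc j) + r\<^sup>2 * coeff G (Suc (Suc j))"
        using 3 by (simp add: coeff_pCons)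
      have t: "(s (Suc j) - 2 * (a / r) * s (Suc (Suc j)) + s (Suc (Suc (Suc j)))) / r ^ j = 0"
        using rec[of "Suc j"] by simp
      consider "Suc (Suc j) < n" | "Suc (Suc j) = n" | "Suc j = n" | "n \<le> j" by linarith
      then show ?thesis
      proof cases
        case 1
        then show ?thesis unfolding e using t r by (simp add: cG field_simps power2_eq_square)
      next
        case 2
        have "coeff G j - 2 * a * coeff G (Suc j) + r\<^sup>2 * coeff G (Suc (Suc j)) =
          (s (Suc j) - 2 * (a / r) * s (Suc (Suc j))) / r ^ j"
          using 2 r by (simp add: cG field_simps)
        also have "s (Suc j) - 2 * (a / r) * s (Suc (Suc j)) = - s (Suc n)"
          using rec[of "Suc j"] 2 by simp
        finally show ?thesis unfolding e using s(2) r by (simp add: divide_nonpos_pos)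
      next
        case 3
        then show ?thesis unfolding e using s r by (simp add: cG)
      next
        case 4
        then show ?thesis unfolding e by (simp add: cG)
      qed
    qed
  qed
  ultimately show ?thesis by blast
qed

lemma map_poly_of_real_mult:
  "map_poly complex_of_real (p * q) = map_poly of_real p * map_poly of_real q"
  by (simp add: poly_eq_iff coeff_map_poly coeff_mult)

lemma map_poly_of_real_add:
  "map_poly complex_of_real (p + q) = map_poly of_real p + map_poly of_real q"
  by (simp add: poly_eq_iff coeff_map_poly)

lemma poly_map_poly_of_real:
  "poly (map_poly complex_of_real p) (of_real x) = of_real (poly p x)"
  by (induction p) (simp_all add: map_poly_pCons)

lemma real_poly_complex_root_factor:
  fixes F :: "real poly" and w :: complex
  assumes "poly (map_poly of_real F) w = 0" "Im w \<noteq> 0"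
  shows "[:(cmod w)\<^sup>2, - 2 * Re w, 1:] dvd F"
proof -
  define Q where "Q = [:(cmod w)\<^sup>2, - 2 * Re w, 1:]"
  define R where "R = F mod Q"
  have Q0: "Q \<noteq> 0" "degree Q = 2" by (auto simp: Q_def)
  have hom: "poly (map_poly of_real (p * q)) w = poly (map_poly of_real p) w * poly (map_poly of_real q) w"
    "poly (map_poly of_real (p + q)) w = poly (map_poly of_real p) w + poly (map_poly of_real q) w"
    for p q :: "real poly"
    by (simp_all flip: poly_mult poly_add add: map_poly_of_real_mult map_poly_of_real_add)
  have "degree R < 2" unfolding R_def using degree_mod_less'[of Q F] Q0 by (cases "F mod Q = 0") auto
  have Qw: "poly (map_poly of_real Q) w = 0"
    unfolding Q_def by (simp add: map_poly_pCons complex_eq_iff cmod_def power2_eq_square algebra_simps)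
  have "F = F div Q * Q + R" unfolding R_def by simp
  then have "poly (map_poly of_real F) w = poly (map_poly of_real (F div Q * Q + R)) w" by simp
  then have Rw: "poly (map_poly of_real R) w = 0" using assms(1) Qw by (simp add: hom)
  obtain b c where R: "R = [:b, c:]"
    using \<open>degree R < 2\<close> by (metis degree_pCons_eq_if less_2_cases_iff pCons_cases degree_eq_zeroE nat.inject One_nat_def Suc_inject degree_pCons_0 zero_neq_one pCons_0_0)
  have "c = 0" using Rw assms(2) by (auto simp: R complex_eq_iff map_poly_pCons)
  then have "R = 0" using Rw by (auto simp: R complex_eq_iff map_poly_pCons)
  then show ?thesis unfolding R_def Q_def by (simp add: mod_eq_0_iff_dvd)
qed

text \<open>The polynomial is peeled off root by root.  A real root is less than \<open>2\<close>, and a pair of conjugate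
roots gives a quadratic factor that is positive everywhere, so the quotient is again positive on
\<open>[2,\<infinity>)\<close> and induction on the degree applies.\<close>

lemma catalyst:
  assumes "\<And>u. 2 \<le> u \<Longrightarrow> 0 < poly F u"
  shows "\<exists>G \<in> cone. G \<noteq> 0 \<and> F * G \<in> cone"
  using assms
proof (induction "degree F" arbitrary: F rule: less_induct)
  case less
  show ?case
  proof (cases "degree F = 0")
    case True
    then obtain c where "F = [:c:]" by (metis degree_eq_zeroE)
    then show ?thesis using less.prems[of 2] by (intro bexI[of _ 1]) (auto intro!: cone_nonneg_coeffs simp: coeff_pCons split: nat.split)
  next
    case False
    have "\<exists>w. poly (map_poly complex_of_real F) w = 0"
    proof (rule fundamental_theorem_of_algebra_alt, rule notI, elim exE conjE)
      fix a l assume "map_poly complex_of_real F = pCons a l" "l = 0"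
      then have "degree (map_poly complex_of_real F) = 0" by simp
      then show False using False by (simp add: degree_map_poly)
    qed
    then obtain w where w: "poly (map_poly complex_of_real F) w = 0" by blast
    have step: ?thesis if "Q dvd F" "0 < degree Q" "\<And>u. 2 \<le> u \<Longrightarrow> 0 < poly Q u"
      and ex: "\<exists>G \<in> cone. G \<noteq> 0 \<and> Q * G \<in> cone" for Q
    proof -
      obtain H where H: "F = Q * H" using \<open>Q dvd F\<close> by blast
      have pos: "0 < poly H u" if "2 \<le> u" for u
        using less.prems[OF that] \<open>\<And>u. 2 \<le> u \<Longrightarrow> 0 < poly Q u\<close>[OF that] by (simp add: H zero_less_mult_iff)
      then have "H \<noteq> 0" using pos[of 2] by (metis less_irrefl order_refl poly_0)
      then have "degree H < degree F" using \<open>0 < degree Q\<close> unfolding H by (subst degree_mult_eq) auto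
      then obtain G where G: "G \<in> cone" "G \<noteq> 0" "H * G \<in> cone" using less.hyps pos by blast
      obtain G' where G': "G' \<in> cone" "G' \<noteq> 0" "Q * G' \<in> cone" using ex by blast
      have "F * (G' * G) = (Q * G') * (H * G)" by (simp add: H algebra_simps)
      then have "F * (G' * G) \<in> cone" using G G' by (simp only: cone_mult)
      then show ?thesis using G G' by (intro bexI[of _ "G' * G"]) (auto intro: cone_mult)
    qed
    show ?thesis
    proof (cases "Im w = 0")
      case True
      define r where "r = Re w"
      have "w = of_real r" using True by (simp add: r_def complex_eq_iff)
      then have "poly F r = 0" using w by (simp add: poly_map_poly_of_real)
      then have dvd: "[:- r, 1:] dvd F" by (simp add: poly_eq_0_iff_dvd)
      have "r < 2" using less.prems[of r] \<open>poly F r = 0\<close> by (cases "r < 2") auto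
      then show ?thesis using linear_catalyst by (intro step[OF dvd]) auto
    next
      case False
      have "\<bar>Re w\<bar> < cmod w" using False abs_Re_le_cmod[of w]
        by (metis abs_le_zero_iff cmod_eq_Re linorder_not_less nless_le norm_complex_def real_sqrt_abs abs_Re_le_cmod cmod_power2 power2_abs add_cancel_left_right add_cancel_right_right zero_eq_power2)
      moreover have "0 < poly [:(cmod w)\<^sup>2, - 2 * Re w, 1:] u" for u
      proof -
        have "poly [:(cmod w)\<^sup>2, - 2 * Re w, 1:] u = (u - Re w)\<^sup>2 + (Im w)\<^sup>2"
          unfolding cmod_power2 by (simp add: power2_eq_square algebra_simps)
        then show ?thesis using False by (simp add: sum_power2_gt_zero_iff add_nonneg_pos)
      qed
      ultimately show ?thesis
        by (intro step[OF real_poly_complex_root_factor[OF w False]] quadratic_catalyst) auto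
    qed
  qed
qed

section \<open>Catalysts with natural coordinates\<close>

abbreviation one_plus_u :: "real poly" where "one_plus_u \<equiv> [:1, 1:]"

lemma chi_coeff_one_plus_u_mult:
  "chi_coeff (one_plus_u * p) d = chi_coeff p d + (if d = 0 then 0 else chi_coeff p (d - 1) + chi_coeff p (d + 1))"
proof -
  have "one_plus_u * p = p + [:0, 1:] * p" by simp
  then show ?thesis by (simp only: chi_coeff_add chi_coeff_X_mult)
qed

lemma one_plus_u_cone [simp]: "one_plus_u \<in> cone"
  by (intro cone_nonneg_coeffs) (auto simp: coeff_pCons split: nat.split)

text \<open>Multiplication by \<open>1 + u\<close> adds to every coordinate its two neighbours.  Positivity of the top coordinate
therefore spreads by one step in both directions with every factor.\<close>

lemma spread:
  assumes "p \<in> cone" "p \<noteq> 0" "1 \<le> d" "Suc (degree p) \<le> d + k" "d \<le> Suc (degree p) + k"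
  shows "0 < chi_coeff (one_plus_u ^ k * p) d"
  using assms(3-5)
proof (induction k arbitrary: d)
  case 0
  then have "d = Suc (degree p)" by simp
  moreover have "0 \<le> chi_coeff p (Suc (degree p))" using assms(1) by (simp add: cone_def)
  ultimately show ?case using assms(2) by (simp add: chi_coeff_top order_less_le)
next
  case (Suc k)
  have "one_plus_u ^ k * p \<in> cone" using assms(1) by (intro cone_mult cone_power) auto
  then have nn: "0 \<le> chi_coeff (one_plus_u ^ k * p) i" for i by (simp add: cone_def)
  have e: "chi_coeff (one_plus_u ^ Suc k * p) d = chi_coeff (one_plus_u ^ k * p) d
      + (chi_coeff (one_plus_u ^ k * p) (d - 1) + chi_coeff (one_plus_u ^ k * p) (d + 1))"
    using Suc.prems(1) unfolding power_Suc mult.assoc chi_coeff_one_plus_u_mult by simp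
  consider "Suc (degree p) \<le> d + k \<and> d \<le> Suc (degree p) + k"
    | "d = Suc (degree p) + Suc k" | "Suc (degree p) = d + Suc k"
    using Suc.prems by linarith
  then show ?case
  proof cases
    case 1
    then show ?thesis using Suc.IH[of d] Suc.prems(1) nn[of "d - 1"] nn[of "d + 1"] unfolding e by linarith
  next
    case 2
    then show ?thesis using Suc.IH[of "d - 1"] nn[of d] nn[of "d + 1"] unfolding e by auto
  next
    case 3
    then show ?thesis using Suc.IH[of "d + 1"] nn[of d] nn[of "d - 1"] unfolding e by auto
  qed
qed

lemma degree_chi_Suc: "degree (chi (Suc n)) \<le> n"
proof (induction n rule: less_induct)
  case (less n)
  consider "n = 0" | "n = 1" | k where "n = Suc (Suc k)" by (metis One_nat_def not0_implies_Suc)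
  then show ?case
  proof cases
    case (3 k)
    have "degree ([:0, 1:] * chi (Suc (Suc k))) \<le> Suc (Suc k)"
      using less[of "Suc k"] degree_mult_le[of "[:0, 1:]" "chi (Suc (Suc k))"] 3 by auto
    moreover have "degree (chi (Suc k)) \<le> Suc (Suc k)" using less[of k] 3 by simp
    ultimately show ?thesis unfolding 3 chi.simps(3)[of "Suc k"] by (rule degree_diff_le)
  qed auto
qed

text \<open>Multiplying a real catalyst by a high power of \<open>1 + u\<close> makes all relevant coordinates of it and of its
product with \<open>F\<close> strictly positive.  This survives small perturbations, hence also the rounding of a large
multiple to natural coordinates.\<close>

lemma natural_catalyst:
  assumes "\<And>u. 2 \<le> u \<Longrightarrow> 0 < poly F u"
  obtains N and k :: "nat \<Rightarrow> nat"
  where "1 \<le> N" "0 < k 1" "F * (\<Sum>d\<in>{1..N}. Polynomial.smult (real (k d)) (chi d)) \<in> cone"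
proof -
  obtain G where G: "G \<in> cone" "G \<noteq> 0" "F * G \<in> cone" using catalyst[OF assms] by blast
  have "F \<noteq> 0" using assms[of 2] by auto
  \<comment> \<open>the exponent has to bound both degrees, for the use of \<open>spread\<close> with \<open>G\<close> and with \<open>F * G\<close>\<close>
  define M where "M = degree G + degree (F * G)"
  define H where "H = one_plus_u ^ M * G"
  have FH: "F * H = one_plus_u ^ M * (F * G)" by (simp add: H_def algebra_simps)
  have FG0: "F * G \<noteq> 0" using G \<open>F \<noteq> 0\<close> by simp
  have H0: "H \<noteq> 0" using G by (simp add: H_def)
  have degF: "degree (F * H) = degree F + degree H" using \<open>F \<noteq> 0\<close> H0 by (rule degree_mult_eq)
  have degM: "degree (F * H) = M + degree (F * G)"
    unfolding FH using FG0 by (subst degree_mult_eq) (auto simp: degree_power_eq)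
  have pos: "0 < chi_coeff (F * H) d" if "1 \<le> d" "d \<le> Suc (degree (F * H))" for d
    unfolding FH using that degM G FG0 by (intro spread) (auto simp: M_def)
  have Hc: "H \<in> cone" unfolding H_def using G by (intro cone_mult cone_power) auto
  have H1: "0 < chi_coeff H 1" unfolding H_def using G by (intro spread) (auto simp: M_def)
  define N where "N = Suc (degree H)"
  define D where "D = Suc (degree (F * H))"
  define a where "a d e = chi_coeff (F * chi e) d" for d e
  have chi_coeff_comb: "chi_coeff (F * (\<Sum>e\<in>{1..N}. Polynomial.smult (g e) (chi e))) d = (\<Sum>e\<in>{1..N}. g e * a d e)" for g d
    by (simp add: sum_distrib_left chi_coeff_sum chi_coeff_smult a_def)
  have chi_coeff_FH: "chi_coeff (F * H) d = (\<Sum>e\<in>{1..N}. chi_coeff H e * a d e)" for d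
    unfolding chi_coeff_comb[symmetric] using chi_expansion[of H N] by (simp add: N_def)
  define \<epsilon> where "\<epsilon> = Min (chi_coeff (F * H) ` {1..D})"
  have \<epsilon>: "0 < \<epsilon>" "\<And>d. d \<in> {1..D} \<Longrightarrow> \<epsilon> \<le> chi_coeff (F * H) d"
    unfolding \<epsilon>_def using pos by (auto simp: D_def Min_gr_iff)
  \<comment> \<open>rounding moves every coordinate of the multiplier by at most one, hence every coordinate of the product by at most \<open>C\<close>\<close>
  define C where "C = (\<Sum>d\<in>{1..D}. \<Sum>e\<in>{1..N}. \<bar>a d e\<bar>)"
  obtain n1 :: nat where n1: "C < real n1 * \<epsilon>" using \<epsilon>(1) reals_Archimedean3 by blast
  obtain n2 :: nat where n2: "1 < real n2 * chi_coeff H 1" using H1 reals_Archimedean3 by blast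
  define n where "n = max n1 n2"
  have nC: "C < real n * \<epsilon>" using \<epsilon>(1) by (intro order_less_le_trans[OF n1]) (simp add: n_def)
  have n1': "1 < real n * chi_coeff H 1" using H1 by (intro order_less_le_trans[OF n2]) (simp add: n_def)
  define k where "k e = nat \<lfloor>real n * chi_coeff H e\<rfloor>" for e
  have cH: "0 \<le> chi_coeff H e" for e using Hc by (simp add: cone_def)
  have kd: "\<bar>real (k e) - real n * chi_coeff H e\<bar> \<le> 1" for e
    unfolding k_def using cH[of e] by (simp add: of_nat_nat) linarith
  have "0 < k 1" unfolding k_def using n1' by simp
  moreover have "F * (\<Sum>d\<in>{1..N}. Polynomial.smult (real (k d)) (chi d)) \<in> cone" (is "F * ?K \<in> _")
    unfolding cone_def
  proof safe
    fix d
    consider "d = 0" | "d \<in> {1..D}" | "D < d" by fastforce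
    then show "0 \<le> chi_coeff (F * ?K) d"
    proof cases
      case 1
      then show ?thesis by simp
    next
      case 2
      have "chi_coeff (F * ?K) d = real n * chi_coeff (F * H) d + (\<Sum>e\<in>{1..N}. (real (k e) - real n * chi_coeff H e) * a d e)"
        unfolding chi_coeff_comb chi_coeff_FH by (simp add: sum_distrib_left sum.distrib[symmetric] algebra_simps)
      moreover have "\<bar>\<Sum>e\<in>{1..N}. (real (k e) - real n * chi_coeff H e) * a d e\<bar> \<le> C"
      proof -
        have "\<bar>\<Sum>e\<in>{1..N}. (real (k e) - real n * chi_coeff H e) * a d e\<bar> \<le> (\<Sum>e\<in>{1..N}. \<bar>a d e\<bar>)"
          by (rule order_trans[OF sum_abs sum_mono]) (simp add: abs_mult mult_left_le_one_le kd)
        also have "\<dots> \<le> C" unfolding C_def using 2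
          by (intro member_le_sum[of d "{1..D}" "\<lambda>d. \<Sum>e\<in>{1..N}. \<bar>a d e\<bar>"]) (auto intro: sum_nonneg)
        finally show ?thesis .
      qed
      moreover have "real n * \<epsilon> \<le> real n * chi_coeff (F * H) d" using \<epsilon>(2)[OF 2] by (rule mult_left_mono) simp
      ultimately show ?thesis using nC by linarith
    next
      case 3
      have "degree ?K \<le> degree H"
      proof (rule degree_sum_le)
        fix e assume "e \<in> {1..N}"
        then obtain e' where "e = Suc e'" "e' \<le> degree H" by (cases e) (auto simp: N_def)
        then show "degree (Polynomial.smult (real (k e)) (chi e)) \<le> degree H"
          using degree_chi_Suc[of e'] degree_smult_le[of "real (k e)" "chi e"] by auto
      qed simp
      then have "degree (F * ?K) < d - 1" using degree_mult_le[of F ?K] 3 degF by (simp add: D_def)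
      then show ?thesis by (simp add: chi_coeff_beyond_degree)
    qed
  qed
  ultimately show ?thesis using that[of N k] by (simp add: N_def)
qed

section \<open>Comparison of high powers\<close>

lemma lead_coeff_pos:
  fixes p :: "real poly"
  assumes "\<And>u. 2 \<le> u \<Longrightarrow> 0 < poly p u"
  shows "0 < lead_coeff p"
proof (rule ccontr)
  assume "\<not> 0 < lead_coeff p"
  moreover have "p \<noteq> 0" using assms[of 2] by auto
  ultimately have "0 < lead_coeff (- p)" by (simp add: less_le)
  then obtain n where n: "\<forall>x\<ge>n. lead_coeff (- p) \<le> poly (- p) x" using poly_pinfty_gt_lc by blast
  have "0 < poly (- p) (max n 2)" using n \<open>0 < lead_coeff (- p)\<close> by (meson max.cobounded1 order_less_le_trans)
  then show False using assms[of "max n 2"] by simp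
qed

text \<open>Near infinity the gap comes from the leading coefficients, because \<open>(1 + u) R\<close> has at most the degree of \<open>S\<close>;
on the remaining compact interval it comes from the minimum of a continuous positive function.\<close>

lemma uniform_gap:
  fixes R S :: "real poly"
  assumes R: "\<And>u. 2 \<le> u \<Longrightarrow> 0 < poly R u" and RS: "\<And>u. 2 \<le> u \<Longrightarrow> poly R u < poly S u"
    and deg: "degree R < degree S"
  obtains \<epsilon> where "0 < \<epsilon>" "\<And>u. 2 \<le> u \<Longrightarrow> (1 + \<epsilon> * (1 + u)) * poly R u \<le> poly S u"
proof -
  have lS: "0 < lead_coeff S" using R RS by (intro lead_coeff_pos) (meson less_trans)
  obtain n where n: "degree S = Suc n" using deg by (cases "degree S") auto
  \<comment> \<open>small enough for the coefficient of \<open>u\<^bsup>n+1\<^esup>\<close> to keep half of the leading coefficient of \<open>S\<close>\<close>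
  define \<epsilon>1 where "\<epsilon>1 = lead_coeff S / (2 * (\<bar>coeff R n\<bar> + 1))"
  have \<epsilon>1: "0 < \<epsilon>1" using lS by (simp add: \<epsilon>1_def)
  define P where "P = S - R - Polynomial.smult \<epsilon>1 (one_plus_u * R)"
  have Rn: "coeff R (Suc n) = 0" using deg n by (simp add: coeff_eq_0)
  have cP: "coeff P (Suc n) = lead_coeff S - \<epsilon>1 * coeff R n" using n Rn by (simp add: P_def)
  have "\<epsilon>1 * coeff R n \<le> \<epsilon>1 * (\<bar>coeff R n\<bar> + 1)" using \<epsilon>1 by (intro mult_left_mono) auto
  also have "\<dots> = lead_coeff S / 2" unfolding \<epsilon>1_def by (simp add: field_simps)
  finally have pos: "0 < coeff P (Suc n)" unfolding cP using lS by linarith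
  have "degree P \<le> Suc n"
  proof -
    have "degree (one_plus_u * R) \<le> Suc n" using degree_mult_le[of one_plus_u R] deg n by simp
    then show ?thesis unfolding P_def using deg n degree_smult_le[of \<epsilon>1 "one_plus_u * R"]
      by (intro degree_diff_le) auto
  qed
  then have "degree P = Suc n" using pos le_degree[of P "Suc n"] by simp
  then obtain K where K: "\<forall>x\<ge>K. lead_coeff P \<le> poly P x" and lP: "0 < lead_coeff P"
    using poly_pinfty_gt_lc[of P] pos by auto
  define f where "f u = (poly S u - poly R u) / ((1 + u) * poly R u)" for u
  have nz: "(1 + u) * poly R u \<noteq> 0" if "2 \<le> u" for u using R[OF that] that by auto
  have "continuous_on {2..max 2 K} f"
    unfolding f_def using nz by (intro continuous_intros) auto
  then obtain x where x: "x \<in> {2..max 2 K}" "\<forall>y\<in>{2..max 2 K}. f x \<le> f y"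
    using continuous_attains_inf[of "{2..max 2 K}" f] by auto
  have fx: "0 < f x" unfolding f_def using x R[of x] RS[of x] by (intro divide_pos_pos mult_pos_pos) auto
  show ?thesis
  proof (rule that[of "min \<epsilon>1 (f x)"])
    show "0 < min \<epsilon>1 (f x)" using \<epsilon>1 fx by simp
    fix u :: real assume u: "2 \<le> u"
    have p: "0 < (1 + u) * poly R u" using R[OF u] u by simp
    show "(1 + min \<epsilon>1 (f x) * (1 + u)) * poly R u \<le> poly S u"
    proof (cases "K \<le> u")
      case True
      then have "0 \<le> poly P u" using K lP by force
      then have "\<epsilon>1 * ((1 + u) * poly R u) \<le> poly S u - poly R u" by (simp add: P_def algebra_simps)
      moreover have "min \<epsilon>1 (f x) * ((1 + u) * poly R u) \<le> \<epsilon>1 * ((1 + u) * poly R u)"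
        using p by (intro mult_right_mono) auto
      ultimately show ?thesis by (simp add: algebra_simps)
    next
      case False
      then have "f x \<le> f u" using x u by auto
      then have "min \<epsilon>1 (f x) \<le> f u" by simp
      then have "min \<epsilon>1 (f x) * ((1 + u) * poly R u) \<le> poly S u - poly R u"
        unfolding f_def using p by (simp add: pos_le_divide_eq)
      then show ?thesis by (simp add: algebra_simps)
    qed
  qed
qed

text \<open>By Bernoulli's inequality the gap grows linearly with the exponent.  The factor \<open>2 (1 + u)\<close> is the
slack that later pays for removing the catalyst.\<close>

lemma power_gap:
  fixes R S :: "real poly"
  assumes R: "\<And>u. 2 \<le> u \<Longrightarrow> 0 < poly R u" and RS: "\<And>u. 2 \<le> u \<Longrightarrow> poly R u < poly S u"
    and deg: "degree R < degree S"
  obtains k where "\<And>u. 2 \<le> u \<Longrightarrow> 0 < poly (S ^ k - Polynomial.smult 2 one_plus_u * R ^ k) u"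
proof -
  obtain \<epsilon> where \<epsilon>: "0 < \<epsilon>" "\<And>u. 2 \<le> u \<Longrightarrow> (1 + \<epsilon> * (1 + u)) * poly R u \<le> poly S u"
    using uniform_gap[OF assms] by blast
  obtain k :: nat where k: "2 < real k * \<epsilon>" using \<epsilon>(1) reals_Archimedean3 by blast
  show ?thesis
  proof (rule that[of k])
    fix u :: real assume u: "2 \<le> u"
    have "2 * (1 + u) < 1 + real k * (\<epsilon> * (1 + u))"
      using mult_strict_right_mono[OF k, of "1 + u"] u by simp
    also have "\<dots> \<le> (1 + \<epsilon> * (1 + u)) ^ k"
    proof (rule Bernoulli_inequality)
      have "0 \<le> \<epsilon> * (1 + u)" using \<epsilon>(1) u by simp
      then show "- 1 \<le> \<epsilon> * (1 + u)" by linarith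
    qed
    finally have "2 * (1 + u) * poly R u ^ k < (1 + \<epsilon> * (1 + u)) ^ k * poly R u ^ k"
      using R[OF u] by (intro mult_strict_right_mono) auto
    also have "\<dots> \<le> poly S u ^ k"
      unfolding power_mult_distrib[symmetric] using R[OF u] \<epsilon> u by (intro power_mono) auto
    finally show "0 < poly (S ^ k - Polynomial.smult 2 one_plus_u * R ^ k) u"
      by (simp add: algebra_simps)
  qed
qed

text \<open>A catalyst for a comparison is a catalyst for the comparison of all powers.\<close>

lemma cone_power_diff:
  assumes "p \<in> cone" "q \<in> cone" "(q - p) * g \<in> cone"
  shows "(q ^ n - p ^ n) * g \<in> cone"
proof (induction n)
  case 0
  then show ?case by simp
next
  case (Suc n)
  have "(q ^ Suc n - p ^ Suc n) * g = q * ((q ^ n - p ^ n) * g) + p ^ n * ((q - p) * g)"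
    by (simp add: algebra_simps)
  also have "\<dots> \<in> cone"
    using cone_add[OF cone_mult[OF assms(2) Suc] cone_mult[OF cone_power[OF assms(1)] assms(3)]] .
  finally show ?case .
qed

text \<open>All coordinates of \<open>(1 + u)\<^sup>m\<close> up to the top one are at least \<open>1\<close>, so a multiple of this power dominates every
polynomial of degree at most \<open>m\<close>.\<close>

lemma one_plus_u_power_dominates:
  assumes "\<And>d. chi_coeff p d \<le> b" "0 \<le> b" "degree p \<le> m"
  shows "Polynomial.smult b (one_plus_u ^ m) - p \<in> cone"
proof -
  have ge: "1 \<le> chi_coeff (one_plus_u ^ m) d" if "1 \<le> d" "d \<le> Suc m" for d
    using that
  proof (induction m arbitrary: d)
    case 0
    then show ?case by (simp add: chi_coeff_1)
  next
    case (Suc m)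
    have "one_plus_u ^ m \<in> cone" by (intro cone_power) auto
    then have nn: "0 \<le> chi_coeff (one_plus_u ^ m) i" for i by (simp add: cone_def)
    have e: "chi_coeff (one_plus_u ^ Suc m) d = chi_coeff (one_plus_u ^ m) d
        + (chi_coeff (one_plus_u ^ m) (d - 1) + chi_coeff (one_plus_u ^ m) (d + 1))"
      using Suc.prems(1) unfolding power_Suc chi_coeff_one_plus_u_mult by simp
    show ?case
    proof (cases "d \<le> Suc m")
      case True
      then show ?thesis using Suc.IH[of d] Suc.prems nn[of "d - 1"] nn[of "d + 1"] unfolding e by linarith
    next
      case False
      then have "d = Suc (Suc m)" using Suc.prems by simp
      then show ?thesis using Suc.IH[of "Suc m"] nn[of d] nn[of "d + 1"] unfolding e by auto
    qed
  qed
  have "0 \<le> b * chi_coeff (one_plus_u ^ m) d - chi_coeff p d" for d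
  proof -
    consider "d = 0" | "1 \<le> d" "d \<le> Suc m" | "Suc m < d" by linarith
    then show ?thesis
    proof cases
      case 2
      have "chi_coeff p d \<le> b * 1" using assms(1) by simp
      also have "\<dots> \<le> b * chi_coeff (one_plus_u ^ m) d" using ge[OF 2] assms(2) by (intro mult_left_mono)
      finally show ?thesis by simp
    next
      case 3
      have "degree (one_plus_u ^ m) = m" by (simp add: degree_power_eq)
      then show ?thesis using 3 assms(3) by (simp add: chi_coeff_beyond_degree)
    qed auto
  qed
  then show ?thesis by (simp add: cone_def chi_coeff_diff chi_coeff_smult)
qed

lemma chi_coeff_bounded: obtains b where "0 < b" "\<And>d. chi_coeff p d \<le> b"
proof -
  define b where "b = 1 + (\<Sum>d\<le>Suc (degree p). \<bar>chi_coeff p d\<bar>)"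
  have b0: "0 < b" unfolding b_def by (intro add_pos_nonneg sum_nonneg) auto
  moreover have "chi_coeff p d \<le> b" for d
  proof (cases "d \<le> Suc (degree p)")
    case True
    then have "\<bar>chi_coeff p d\<bar> \<le> (\<Sum>d\<le>Suc (degree p). \<bar>chi_coeff p d\<bar>)"
      by (intro member_le_sum[of d _ "\<lambda>d. \<bar>chi_coeff p d\<bar>"]) auto
    then show ?thesis by (simp add: b_def)
  next
    case False
    then show ?thesis using b0 by (simp add: chi_coeff_beyond_degree)
  qed
  ultimately show ?thesis by (rule that)
qed

text \<open>Write \<open>p \<preceq> q\<close> for \<open>q - p \<in> cone\<close>, and let \<open>G\<close> be a catalyst for \<open>c R\<^sup>k \<preceq> S\<^sup>k\<close> with \<open>c = 2 (1 + u)\<close>, scaled to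
\<open>1 \<preceq> G\<close>.  Then \<open>c\<^sup>n R\<^bsup>kn\<^esup> \<preceq> c\<^sup>n R\<^bsup>kn\<^esup> G \<preceq> S\<^bsup>kn\<^esup> G \<preceq> b S\<^bsup>kn+m\<^esup>\<close> for all \<open>m\<close> at least the degree of \<open>G\<close>.  Since
\<open>b R\<^sup>m \<preceq> c\<^sup>n\<close> for large \<open>n\<close>, the constant \<open>b\<close> cancels and \<open>R\<^bsup>kn+m\<^esup> \<preceq> S\<^bsup>kn+m\<^esup>\<close> remains.  Finitely many
values of \<open>m\<close> cover all residues modulo \<open>k\<close>.\<close>

lemma asymptotic_cone:
  assumes Rc: "R \<in> cone" and Sc: "S - one_plus_u \<in> cone"
    and R: "\<And>u. 2 \<le> u \<Longrightarrow> 0 < poly R u" and RS: "\<And>u. 2 \<le> u \<Longrightarrow> poly R u < poly S u"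
    and deg: "degree R < degree S"
  shows "\<exists>n0. \<forall>n\<ge>n0. S ^ n - R ^ n \<in> cone"
proof -
  define c where "c = Polynomial.smult 2 one_plus_u"
  have SC: "S \<in> cone" using cone_add[OF Sc one_plus_u_cone] by simp
  have cC: "c \<in> cone" unfolding c_def by (intro cone_smult) auto
  obtain k where k: "\<And>u. 2 \<le> u \<Longrightarrow> 0 < poly (S ^ k - c * R ^ k) u"
    using power_gap[OF R RS deg] unfolding c_def by blast
  have "k \<noteq> 0" using k[of 2] by (cases "k = 0") (auto simp: c_def)
  obtain G0 where G0: "G0 \<in> cone" "G0 \<noteq> 0" "(S ^ k - c * R ^ k) * G0 \<in> cone"
    using catalyst[OF k] by blast
  define G1 where "G1 = one_plus_u ^ degree G0 * G0"
  have G1: "0 < chi_coeff G1 1" unfolding G1_def using G0 by (intro spread) auto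
  have G1c: "G1 \<in> cone" unfolding G1_def using G0 by (intro cone_mult cone_power) auto
  define G where "G = Polynomial.smult (1 / chi_coeff G1 1) G1"
  have "(S ^ k - c * R ^ k) * G = Polynomial.smult (1 / chi_coeff G1 1) (one_plus_u ^ degree G0 * ((S ^ k - c * R ^ k) * G0))"
    unfolding G_def G1_def by (simp only: mult_smult_right mult_smult_left mult.left_commute)
  then have FG: "(S ^ k - c * R ^ k) * G \<in> cone"
    using cone_mult[OF cone_power[OF one_plus_u_cone] G0(3)] G1 by (simp only:) (rule cone_smult, auto)
  have Gc1: "G - 1 \<in> cone"
    using G1c G1 unfolding cone_def G_def by (auto simp: chi_coeff_diff chi_coeff_smult chi_coeff_1)
  obtain b where b: "0 < b" "\<And>d. chi_coeff G d \<le> b" using chi_coeff_bounded by blast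
  have GS: "Polynomial.smult b (S ^ m) - G \<in> cone" if "degree G \<le> m" for m
  proof -
    have 1: "S ^ m - one_plus_u ^ m \<in> cone"
      using cone_power_diff[of one_plus_u S 1 m] SC Sc by simp
    have "Polynomial.smult b (S ^ m) - G = Polynomial.smult b (S ^ m - one_plus_u ^ m) + (Polynomial.smult b (one_plus_u ^ m) - G)"
      by (simp add: smult_diff_right)
    also have "\<dots> \<in> cone"
      using 1 b that by (intro cone_add cone_smult one_plus_u_power_dominates) auto
    finally show ?thesis .
  qed
  have key: "S ^ (k * n + m) - R ^ (k * n + m) \<in> cone"
    if m: "degree G \<le> m" and n: "c ^ n - Polynomial.smult b (R ^ m) \<in> cone" for m n
  proof -
    have "Polynomial.smult b (S ^ (k * n + m) - R ^ (k * n + m))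
      = (Polynomial.smult b (S ^ m) - G) * S ^ (k * n) + ((S ^ k) ^ n - (c * R ^ k) ^ n) * G
        + (c * R ^ k) ^ n * (G - 1) + R ^ (k * n) * (c ^ n - Polynomial.smult b (R ^ m))"
      by (simp add: algebra_simps power_add power_mult power_mult_distrib smult_diff_right)
    also have "\<dots> \<in> cone"
    proof (intro cone_add)
      have "c * R ^ k \<in> cone" "S ^ k \<in> cone" using cC Rc SC by (auto intro: cone_mult cone_power)
      then show "((S ^ k) ^ n - (c * R ^ k) ^ n) * G \<in> cone" "(c * R ^ k) ^ n * (G - 1) \<in> cone"
        using FG Gc1 by (auto intro: cone_mult cone_power cone_power_diff)
    qed (use GS[OF m] SC Rc n in \<open>auto intro: cone_mult cone_power\<close>)
    finally have "0 \<le> b * chi_coeff (S ^ (k * n + m) - R ^ (k * n + m)) d" for d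
      by (simp only: cone_def mem_Collect_eq chi_coeff_smult)
    then show ?thesis using b(1) by (simp add: cone_def zero_le_mult_iff)
  qed
  have ev: "\<exists>n0. \<forall>n\<ge>n0. c ^ n - Polynomial.smult b (R ^ m) \<in> cone" for m
  proof -
    obtain b' where b': "0 < b'" "\<And>d. chi_coeff (Polynomial.smult b (R ^ m)) d \<le> b'" using chi_coeff_bounded by blast
    obtain n1 :: nat where n1: "b' < 2 ^ n1" using real_arch_pow[of 2 b'] by auto
    have "c ^ n - Polynomial.smult b (R ^ m) \<in> cone" if "max n1 (degree (Polynomial.smult b (R ^ m))) \<le> n" for n
    proof -
      have "(2::real) ^ n1 \<le> 2 ^ n" using that by (intro power_increasing) auto
      then have "chi_coeff (Polynomial.smult b (R ^ m)) d \<le> 2 ^ n" for d using b'(2)[of d] n1 by linarith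
      then show ?thesis unfolding c_def smult_power
        using that by (intro one_plus_u_power_dominates) auto
    qed
    then show ?thesis by blast
  qed
  then obtain f where f: "\<And>m n. f m \<le> n \<Longrightarrow> c ^ n - Polynomial.smult b (R ^ m) \<in> cone" by metis
  define n1 where "n1 = Max (f ` {degree G..degree G + k})"
  have n1: "f m \<le> n1" if "degree G \<le> m" "m \<le> degree G + k" for m
    unfolding n1_def using that by (intro Max_ge) auto
  have "S ^ N - R ^ N \<in> cone" if "degree G + k * n1 \<le> N" for N
  proof -
    define q where "q = N - degree G"
    \<comment> \<open>division with remainder after subtracting the smallest admissible \<open>m\<close>\<close>
    define m where "m = degree G + q mod k"
    define n where "n = q div k"
    have "N = k * n + m" using that by (simp add: q_def m_def n_def)
    moreover have "k * n1 \<le> q" using that by (simp add: q_def)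
    then have "n1 \<le> n" unfolding n_def using \<open>k \<noteq> 0\<close> by (simp add: less_eq_div_iff_mult_less_eq mult.commute)
    moreover have "m \<le> degree G + k" using \<open>k \<noteq> 0\<close> mod_less_divisor[of k q] by (simp add: m_def less_imp_le)
    ultimately show ?thesis using key[of m n] f[of m n] n1[of m] by (simp add: m_def)
  qed
  then show ?thesis by blast
qed

section \<open>The group and its algebraic representations\<close>

definition mat22 :: "complex \<Rightarrow> complex \<Rightarrow> complex \<Rightarrow> complex \<Rightarrow> complex mat" where
  "mat22 a b c d = mat 2 2 (\<lambda>(i, j). if i = 0 then if j = 0 then a else b else if j = 0 then c else d)"

lemma mat22_carrier [simp]: "mat22 a b c d \<in> carrier_mat 2 2"
  by (simp add: mat22_def)

lemma mat22_index [simp]: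
  "mat22 a b c d $$ (0, 0) = a" "mat22 a b c d $$ (0, Suc 0) = b"
  "mat22 a b c d $$ (Suc 0, 0) = c" "mat22 a b c d $$ (Suc 0, Suc 0) = d"
  by (simp_all add: mat22_def)

lemma mat22_eta: assumes "g \<in> carrier_mat 2 2"
  shows "g = mat22 (g $$ (0, 0)) (g $$ (0, 1)) (g $$ (1, 0)) (g $$ (1, 1))"
  using assms by (intro eq_matI) (auto simp: mat22_def less_2_cases_iff)

lemma mat22_mult:
  "mat22 a b c d * mat22 a' b' c' d' = mat22 (a * a' + b * c') (a * b' + b * d') (c * a' + d * c') (c * b' + d * d')"
  by (intro eq_matI) (auto simp: mat22_def scalar_prod_def numeral_2_eq_2 less_Suc_eq)

lemma mat22_one: "1\<^sub>m 2 = mat22 1 0 0 1"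
  by (intro eq_matI) (auto simp: mat22_def less_2_cases_iff)

lemma mat22_transpose: "transpose_mat (mat22 a b c d) = mat22 a c b d"
  by (intro eq_matI) (auto simp: mat22_def less_2_cases_iff)

lemma det_mat22: "det (mat22 a b c d) = a * d - b * c"
proof -
  have "mat22 a b c d = four_block_mat (mat 1 1 (\<lambda>_. a)) (mat 1 1 (\<lambda>_. b)) (mat 1 1 (\<lambda>_. c)) (mat 1 1 (\<lambda>_. d))"
    by (intro eq_matI) (auto simp: mat22_def less_2_cases_iff)
  then show ?thesis
    by (subst laplace_expansion_column[of _ 2 0]) (auto simp: numeral_2_eq_2 cofactor_def mat_delete_def det_single)
qed

lemma SL2_mat22 [simp]: "mat22 a b c d \<in> carrier SL2 \<longleftrightarrow> a * d - b * c = 1"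
  by (simp add: SL2_def det_mat22)

lemma SL2_cases:
  assumes "g \<in> carrier SL2"
  obtains a b c d where "g = mat22 a b c d" "a * d - b * c = 1"
proof -
  have "g \<in> carrier_mat 2 2" using assms by (simp add: SL2_def)
  then show ?thesis using that mat22_eta[of g] assms SL2_mat22 by metis
qed

lemma SL2_mult [simp]: "g \<in> carrier SL2 \<Longrightarrow> h \<in> carrier SL2 \<Longrightarrow> g * h \<in> carrier SL2"
  by (auto simp: SL2_def det_mult)

lemma SL2_one [simp]: "1\<^sub>m 2 \<in> carrier SL2"
  by (simp add: SL2_def)

lemma SL2_transpose [simp]: "g \<in> carrier SL2 \<Longrightarrow> transpose_mat g \<in> carrier SL2"
  by (auto simp: SL2_def det_transpose)

lemma SL2_inverse:
  assumes "g \<in> carrier SL2"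
  obtains h where "h \<in> carrier SL2" "g * h = 1\<^sub>m 2" "h * g = 1\<^sub>m 2"
proof -
  obtain a b c d where g: "g = mat22 a b c d" "a * d - b * c = 1" using SL2_cases[OF assms] .
  show ?thesis
    by (rule that[of "mat22 d (- b) (- c) a"]) (use g(2) in \<open>auto simp: g(1) mat22_mult mat22_one algebra_simps\<close>)
qed

lemma alg_rep_carrier:
  assumes "alg_rep \<rho>" "g \<in> carrier SL2"
  shows "\<rho> g \<in> carrier_mat (rep_dim \<rho>) (rep_dim \<rho>)"
  using assms by (auto simp: alg_rep_def GL_def units_of_def Units_def hom_def ring_mat_def)

lemma alg_rep_mult:
  assumes "alg_rep \<rho>" "g \<in> carrier SL2" "h \<in> carrier SL2"
  shows "\<rho> (g * h) = \<rho> g * \<rho> h"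
  using assms by (auto simp: alg_rep_def GL_def units_of_def hom_def ring_mat_def SL2_def)

lemma alg_rep_one:
  assumes "alg_rep \<rho>"
  shows "\<rho> (1\<^sub>m 2) = 1\<^sub>m (rep_dim \<rho>)"
proof -
  define n where "n = rep_dim \<rho>"
  define P where "P = \<rho> (1\<^sub>m 2)"
  have P: "P \<in> carrier_mat n n" unfolding P_def n_def using alg_rep_carrier[OF assms] by simp
  have PP: "P * P = P" unfolding P_def using alg_rep_mult[OF assms, of "1\<^sub>m 2" "1\<^sub>m 2"] by simp
  have "P \<in> Units (ring_mat TYPE(complex) n ())"
    using assms unfolding P_def n_def alg_rep_def GL_def units_of_def hom_def by auto
  then obtain Q where Q: "Q \<in> carrier_mat n n" "Q * P = 1\<^sub>m n"
    by (auto simp: Units_def ring_mat_def)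
  have "Q * (P * P) = P" using P Q by (simp add: assoc_mult_mat[of Q n n P n P n, symmetric])
  then have "P = 1\<^sub>m n" using PP Q by simp
  then show ?thesis by (simp add: P_def n_def)
qed

lemma alg_rep_entry:
  assumes "alg_rep \<rho>" "i < rep_dim \<rho>" "j < rep_dim \<rho>"
  obtains p where "regular_fun p" "\<And>g. g \<in> carrier SL2 \<Longrightarrow> \<rho> g $$ (i, j) = p g"
  using assms unfolding alg_rep_def by metis

text \<open>The values are invertible because \<open>SL2\<close> is closed under inverses.\<close>

lemma alg_repI:
  assumes carr: "\<And>g. g \<in> carrier SL2 \<Longrightarrow> \<rho> g \<in> carrier_mat n n"
    and mult: "\<And>g h. g \<in> carrier SL2 \<Longrightarrow> h \<in> carrier SL2 \<Longrightarrow> \<rho> (g * h) = \<rho> g * \<rho> h"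
    and one: "\<rho> (1\<^sub>m 2) = 1\<^sub>m n"
    and reg: "\<And>i j. i < n \<Longrightarrow> j < n \<Longrightarrow> \<exists>p. regular_fun p \<and> (\<forall>g \<in> carrier SL2. \<rho> g $$ (i, j) = p g)"
  shows "alg_rep \<rho>" "rep_dim \<rho> = n"
proof -
  show n: "rep_dim \<rho> = n" using one by (simp add: rep_dim_def)
  have "\<rho> g \<in> Units (ring_mat TYPE(complex) n ())" if g: "g \<in> carrier SL2" for g
  proof -
    obtain h where h: "h \<in> carrier SL2" "g * h = 1\<^sub>m 2" "h * g = 1\<^sub>m 2" using SL2_inverse[OF g] .
    then have "\<rho> g * \<rho> h = 1\<^sub>m n" "\<rho> h * \<rho> g = 1\<^sub>m n" using mult g one by metis+
    then show ?thesis using carr g h by (auto simp: Units_def ring_mat_def)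
  qed
  then show "alg_rep \<rho>"
    unfolding alg_rep_def n hom_def GL_def using mult reg
    by (auto simp: units_of_def SL2_def ring_mat_def)
qed

lemma regular_fun_sum: "(\<And>i. i \<in> I \<Longrightarrow> regular_fun (f i)) \<Longrightarrow> regular_fun (\<lambda>g. \<Sum>i\<in>I. f i g)"
  by (induction I rule: infinite_finite_induct) (auto intro: regular_fun.intros)

text \<open>Algebraicity enters the whole development through polynomial dependence along polynomial curves
in \<open>SL2\<close> and, in the next lemma, Laurent polynomial dependence along the diagonal torus.\<close>

lemma regular_fun_curve:
  "regular_fun p \<Longrightarrow> \<exists>P. \<forall>x. p (mat22 (poly a x) (poly b x) (poly c x) (poly d x)) = poly P x"
proof (induction rule: regular_fun.induct)
  case (const c)
  show ?case by (rule exI[of _ "[:c:]"]) simp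
next
  case (entry i j)
  then consider "i = 0" "j = 0" | "i = 0" "j = Suc 0" | "i = Suc 0" "j = 0" | "i = Suc 0" "j = Suc 0"
    by (auto simp: less_2_cases_iff)
  then show ?case by cases auto
next
  case (add p q)
  then show ?case by (metis poly_add)
next
  case (mult p q)
  then show ?case by (metis poly_mult)
qed

lemma regular_fun_torus:
  "regular_fun p \<Longrightarrow> \<exists>P N. \<forall>t. t \<noteq> 0 \<longrightarrow> t ^ N * p (mat22 t 0 0 (1 / t)) = poly P t"
proof (induction rule: regular_fun.induct)
  case (const c)
  show ?case by (rule exI[of _ "[:c:]"], rule exI[of _ 0]) simp
next
  case (entry i j)
  then consider "i = 0" "j = 0" | "i = 0" "j = Suc 0" | "i = Suc 0" "j = 0" | "i = Suc 0" "j = Suc 0"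
    by (auto simp: less_2_cases_iff)
  then show ?case
  proof cases
    case 1
    then show ?thesis by (intro exI[of _ "[:0, 1:]"] exI[of _ 0]) simp
  next
    case 4
    then show ?thesis by (intro exI[of _ "1"] exI[of _ 1]) simp
  qed (auto intro!: exI[of _ 0])
next
  case (add p q)
  then obtain P N Q M where "\<forall>t. t \<noteq> 0 \<longrightarrow> t ^ N * p (mat22 t 0 0 (1 / t)) = poly P t"
    "\<forall>t. t \<noteq> 0 \<longrightarrow> t ^ M * q (mat22 t 0 0 (1 / t)) = poly Q t" by blast
  then have "\<forall>t. t \<noteq> 0 \<longrightarrow> t ^ (N + M) * (p (mat22 t 0 0 (1 / t)) + q (mat22 t 0 0 (1 / t))) = poly (monom 1 M * P + monom 1 N * Q) t"
    by (simp add: poly_monom power_add algebra_simps)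
  then show ?case by blast
next
  case (mult p q)
  then obtain P N Q M where "\<forall>t. t \<noteq> 0 \<longrightarrow> t ^ N * p (mat22 t 0 0 (1 / t)) = poly P t"
    "\<forall>t. t \<noteq> 0 \<longrightarrow> t ^ M * q (mat22 t 0 0 (1 / t)) = poly Q t" by blast
  then have "\<forall>t. t \<noteq> 0 \<longrightarrow> t ^ (N + M) * (p (mat22 t 0 0 (1 / t)) * q (mat22 t 0 0 (1 / t))) = poly (P * Q) t"
    by (simp add: power_add flip: mult.assoc) (metis mult.assoc mult.commute)
  then show ?case by blast
qed

lemma regular_fun_transpose:
  "regular_fun p \<Longrightarrow> \<exists>q. regular_fun q \<and> (\<forall>g \<in> carrier_mat 2 2. p (transpose_mat g) = q g)"
proof (induction rule: regular_fun.induct)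
  case (const c)
  then show ?case using regular_fun.const by blast
next
  case (entry i j)
  then show ?case using regular_fun.entry[of j i] by (intro exI[of _ "\<lambda>g. g $$ (j, i)"]) auto
next
  case (add p q)
  then obtain p' q' where "regular_fun p'" "regular_fun q'"
    "\<forall>g \<in> carrier_mat 2 2. p (transpose_mat g) = p' g" "\<forall>g \<in> carrier_mat 2 2. q (transpose_mat g) = q' g" by blast
  then show ?case by (intro exI[of _ "\<lambda>g. p' g + q' g"]) (auto intro: regular_fun.intros)
next
  case (mult p q)
  then obtain p' q' where "regular_fun p'" "regular_fun q'"
    "\<forall>g \<in> carrier_mat 2 2. p (transpose_mat g) = p' g" "\<forall>g \<in> carrier_mat 2 2. q (transpose_mat g) = q' g" by blast
  then show ?case by (intro exI[of _ "\<lambda>g. p' g * q' g"]) (auto intro: regular_fun.intros)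
qed

text \<open>Transposition reverses products in \<open>SL2\<close> and in the target, so this is again a representation.  It turns
row vectors into column vectors, fixes the torus and exchanges the two unipotent subgroups, and thus makes
statements about linear forms instances of statements about vectors.\<close>

definition transpose_rep :: "rep \<Rightarrow> rep" where
  "transpose_rep \<rho> = (\<lambda>g. transpose_mat (\<rho> (transpose_mat g)))"

lemma alg_rep_transpose:
  assumes "alg_rep \<rho>"
  shows "alg_rep (transpose_rep \<rho>)" "rep_dim (transpose_rep \<rho>) = rep_dim \<rho>"
proof -
  let ?n = "rep_dim \<rho>"
  note C = alg_rep_carrier[OF assms]
  have 1: "transpose_rep \<rho> g \<in> carrier_mat ?n ?n" if "g \<in> carrier SL2" for g
    using C[OF SL2_transpose[OF that]] by (simp add: transpose_rep_def)
  have 2: "transpose_rep \<rho> (g * h) = transpose_rep \<rho> g * transpose_rep \<rho> h"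
    if "g \<in> carrier SL2" "h \<in> carrier SL2" for g h
  proof -
    have gh: "g \<in> carrier_mat 2 2" "h \<in> carrier_mat 2 2" using that by (auto simp: SL2_def)
    show ?thesis
      unfolding transpose_rep_def transpose_mult[OF gh]
      by (subst alg_rep_mult[OF assms]) (use that in \<open>simp_all add: transpose_mult[OF C[OF SL2_transpose[OF that(2)]] C[OF SL2_transpose[OF that(1)]]]\<close>)
  qed
  have 3: "transpose_rep \<rho> (1\<^sub>m 2) = 1\<^sub>m ?n" by (simp add: transpose_rep_def alg_rep_one[OF assms])
  have 4: "\<exists>p. regular_fun p \<and> (\<forall>g \<in> carrier SL2. transpose_rep \<rho> g $$ (i, j) = p g)"
    if ij: "i < ?n" "j < ?n" for i j
  proof -
    obtain p where p: "regular_fun p" "\<And>g. g \<in> carrier SL2 \<Longrightarrow> \<rho> g $$ (j, i) = p g"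
      using alg_rep_entry[OF assms ij(2,1)] by blast
    obtain q where q: "regular_fun q" "\<forall>g \<in> carrier_mat 2 2. p (transpose_mat g) = q g"
      using regular_fun_transpose[OF p(1)] by blast
    have "transpose_rep \<rho> g $$ (i, j) = q g" if g: "g \<in> carrier SL2" for g
    proof -
      have "transpose_rep \<rho> g $$ (i, j) = \<rho> (transpose_mat g) $$ (j, i)"
        using C[OF SL2_transpose[OF g]] ij by (auto simp: transpose_rep_def)
      then show ?thesis using p(2)[OF SL2_transpose[OF g]] q(2) g by (simp add: SL2_def)
    qed
    then show ?thesis using q(1) by blast
  qed
  show "alg_rep (transpose_rep \<rho>)" by (rule alg_repI[OF 1 2 3 4])
  show "rep_dim (transpose_rep \<rho>) = ?n" by (rule alg_repI[OF 1 2 3 4])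
qed

section \<open>Symmetric powers of the standard representation\<close>

lemma poly_eq_on_infinite:
  fixes p q :: "complex poly"
  assumes "infinite A" "\<And>x. x \<in> A \<Longrightarrow> poly p x = poly q x"
  shows "p = q"
proof (rule ccontr)
  assume "p \<noteq> q"
  then have "finite {x. poly (p - q) x = 0}" by (intro poly_roots_finite) simp
  moreover have "A \<subseteq> {x. poly (p - q) x = 0}" using assms(2) by auto
  ultimately show False using assms(1) finite_subset by blast
qed

lemma infinite_cofinite: "finite B \<Longrightarrow> infinite (- B :: complex set)"
  by (metis Compl_eq_Diff_UNIV finite_Diff2 infinite_UNIV_char_0)

lemma poly_eq_nonzero:
  fixes p q :: "complex poly"
  assumes "\<And>x. x \<noteq> 0 \<Longrightarrow> poly p x = poly q x"
  shows "p = q"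
  using infinite_cofinite[of "{0}"] assms by (intro poly_eq_on_infinite[of "- {0}"]) auto

text \<open>The image of the point \<open>(x, y)\<close> under the Veronese embedding of degree \<open>m\<close>.\<close>

definition power_col :: "nat \<Rightarrow> complex \<Rightarrow> complex \<Rightarrow> complex mat" where
  "power_col m x y = mat (Suc m) 1 (\<lambda>(k, _). x ^ (m - k) * y ^ k)"

lemma power_col_carrier [simp]: "power_col m x y \<in> carrier_mat (Suc m) 1" "power_col m x y \<in> carrier_mat (Suc m) (Suc 0)"
  by (simp_all add: power_col_def)

lemma mult_power_col_index:
  assumes "X \<in> carrier_mat r (Suc m)" "i < r"
  shows "(X * power_col m x y) $$ (i, 0) = (\<Sum>k\<le>m. X $$ (i, k) * (x ^ (m - k) * y ^ k))"
  using assms by (auto simp: power_col_def scalar_prod_def atLeast0LessThan lessThan_Suc_atMost intro!: sum.cong)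

text \<open>Two matrices that agree on infinitely many points of the rational normal curve are equal, since a
polynomial with infinitely many zeros vanishes.  Most identities between matrices are verified in this way.\<close>

lemma power_col_separating:
  assumes X: "X \<in> carrier_mat r (Suc m)" and Y: "Y \<in> carrier_mat r (Suc m)"
    and A: "infinite A" and eq: "\<And>s. s \<in> A \<Longrightarrow> X * power_col m 1 s = Y * power_col m 1 s"
  shows "X = Y"
proof (rule eq_matI)
  fix i j assume ij: "i < dim_row Y" "j < dim_col Y"
  let ?p = "\<lambda>Z :: complex mat. \<Sum>k\<le>m. monom (Z $$ (i, k)) k"
  have e: "(Z * power_col m 1 s) $$ (i, 0) = poly (?p Z) s" if "Z \<in> carrier_mat r (Suc m)" for Z s
    using mult_power_col_index[OF that, of i 1 s] ij Y by (simp add: poly_sum poly_monom)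
  have "?p X = ?p Y"
    using A by (rule poly_eq_on_infinite) (metis e X Y eq)
  then have "coeff (?p X) j = coeff (?p Y) j" by simp
  moreover have "coeff (?p Z) j = Z $$ (i, j)" for Z :: "complex mat"
    using ij Y by (simp add: coeff_sum)
  ultimately show "X $$ (i, j) = Y $$ (i, j)" by simp
qed (use X Y in auto)

text \<open>The \<open>m\<close>-th symmetric power of the standard representation: the matrix that moves the points of the Veronese
embedding as \<open>g\<close> moves the plane.\<close>

definition sym_rep :: "nat \<Rightarrow> rep" where
  "sym_rep m g = mat (Suc m) (Suc m) (\<lambda>(i, k).
     coeff ([:g $$ (0, 0), g $$ (0, 1):] ^ (m - i) * [:g $$ (1, 0), g $$ (1, 1):] ^ i) k)"

lemma sym_rep_carrier [simp]: "sym_rep m g \<in> carrier_mat (Suc m) (Suc m)"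
  by (simp add: sym_rep_def)

lemma homogenization_mult_linear:
  fixes P :: "complex poly"
  assumes "degree P \<le> m"
  shows "(\<Sum>k\<le>Suc m. coeff ([:a, b:] * P) k * (x ^ (Suc m - k) * y ^ k))
    = (a * x + b * y) * (\<Sum>k\<le>m. coeff P k * (x ^ (m - k) * y ^ k))"
proof -
  have P0: "coeff P (Suc m) = 0" using assms by (simp add: coeff_eq_0)
  have "(\<Sum>k\<le>Suc m. coeff ([:a, b:] * P) k * (x ^ (Suc m - k) * y ^ k))
     = (\<Sum>k\<le>Suc m. a * coeff P k * (x ^ (Suc m - k) * y ^ k))
     + (\<Sum>k\<le>Suc m. coeff (pCons 0 (Polynomial.smult b P)) k * (x ^ (Suc m - k) * y ^ k))"
    by (simp add: sum.distrib algebra_simps)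
  also have "(\<Sum>k\<le>Suc m. a * coeff P k * (x ^ (Suc m - k) * y ^ k)) = a * x * (\<Sum>k\<le>m. coeff P k * (x ^ (m - k) * y ^ k))"
    by (simp add: P0 sum_distrib_left) (intro sum.cong, auto simp: Suc_diff_le)
  also have "(\<Sum>k\<le>Suc m. coeff (pCons 0 (Polynomial.smult b P)) k * (x ^ (Suc m - k) * y ^ k))
     = b * y * (\<Sum>k\<le>m. coeff P k * (x ^ (m - k) * y ^ k))"
    by (subst sum.atMost_Suc_shift) (simp add: sum_distrib_left algebra_simps)
  finally show ?thesis by (simp add: algebra_simps)
qed

lemma homogenization_power_mult:
  fixes P :: "complex poly"
  assumes "degree P \<le> m"
  shows "degree ([:a, b:] ^ p * P) \<le> p + m \<and>
    (\<Sum>k\<le>p + m. coeff ([:a, b:] ^ p * P) k * (x ^ (p + m - k) * y ^ k))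
    = (a * x + b * y) ^ p * (\<Sum>k\<le>m. coeff P k * (x ^ (m - k) * y ^ k))"
proof (induction p)
  case 0
  then show ?case using assms by simp
next
  case (Suc p)
  have "degree ([:a, b:] * ([:a, b:] ^ p * P)) \<le> degree [:a, b:] + degree ([:a, b:] ^ p * P)"
    by (rule degree_mult_le)
  also have "\<dots> \<le> 1 + (p + m)" using Suc by (intro add_mono) (simp_all del: pCons_0_0)
  finally have "degree ([:a, b:] * ([:a, b:] ^ p * P)) \<le> Suc (p + m)" by simp
  then show ?case
    unfolding power_Suc mult.assoc add_Suc
    using homogenization_mult_linear[OF Suc[THEN conjunct1], of a b x y] Suc by (simp only: simp_thms)
qed

lemma homogenization_product:
  fixes a b c d x y :: complex
  assumes "i \<le> m"
  shows "(\<Sum>k\<le>m. coeff ([:a, b:] ^ (m - i) * [:c, d:] ^ i) k * (x ^ (m - k) * y ^ k))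
    = (a * x + b * y) ^ (m - i) * (c * x + d * y) ^ i"
  using homogenization_power_mult[of 1 0 c d i x y]
    homogenization_power_mult[of "[:c, d:] ^ i" i a b "m - i" x y] assms by simp

lemma sym_rep_power_col:
  "sym_rep m (mat22 a b c d) * power_col m x y = power_col m (a * x + b * y) (c * x + d * y)"
proof (rule eq_matI)
  fix i j assume "i < dim_row (power_col m (a * x + b * y) (c * x + d * y))" "j < dim_col (power_col m (a * x + b * y) (c * x + d * y))"
  then have ij: "i < Suc m" "j = 0" by (auto simp: power_col_def)
  have "(sym_rep m (mat22 a b c d) * power_col m x y) $$ (i, 0)
      = (\<Sum>k\<le>m. coeff ([:a, b:] ^ (m - i) * [:c, d:] ^ i) k * (x ^ (m - k) * y ^ k))"
    using ij by (subst mult_power_col_index[of _ "Suc m"]) (auto simp: sym_rep_def intro!: sum.cong)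
  then show "(sym_rep m (mat22 a b c d) * power_col m x y) $$ (i, j) = power_col m (a * x + b * y) (c * x + d * y) $$ (i, j)"
    using ij homogenization_product[of i m] by (simp add: power_col_def)
qed (auto simp: power_col_def sym_rep_def)

lemma regular_coeff_mult:
  assumes "\<And>k. regular_fun (\<lambda>g. coeff (P g) k)" "\<And>k. regular_fun (\<lambda>g. coeff (Q g) k)"
  shows "regular_fun (\<lambda>g. coeff (P g * Q g) k)"
  unfolding coeff_mult using assms by (intro regular_fun_sum regular_fun.mult)

lemma regular_coeff_power:
  assumes "\<And>k. regular_fun (\<lambda>g. coeff (P g) k)"
  shows "regular_fun (\<lambda>g. coeff (P g ^ n) k)"
proof (induction n arbitrary: k)
  case 0
  then show ?case by (simp add: regular_fun.const)
next
  case (Suc n)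
  then show ?case using regular_coeff_mult[OF assms] by simp
qed

lemma regular_coeff_linear:
  assumes "i < 2" shows "regular_fun (\<lambda>g. coeff [:g $$ (i, 0), g $$ (i, 1):] k)"
proof -
  consider "k = 0" | "k = 1" | j where "k = Suc (Suc j)" by (metis One_nat_def not0_implies_Suc)
  then show ?thesis
    using regular_fun.entry[OF assms, of 0] regular_fun.entry[OF assms, of 1] regular_fun.const[of 0]
    by cases auto
qed

lemma sym_rep_alg:
  shows "alg_rep (sym_rep m)" "rep_dim (sym_rep m) = Suc m"
proof -
  have mult: "sym_rep m (g * h) = sym_rep m g * sym_rep m h"
    if gh: "g \<in> carrier SL2" "h \<in> carrier SL2" for g h
  proof -
    obtain a b c d where g: "g = mat22 a b c d" using SL2_cases[OF gh(1)] by metis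
    obtain a' b' c' d' where h: "h = mat22 a' b' c' d'" using SL2_cases[OF gh(2)] by metis
    show ?thesis
    proof (rule power_col_separating[of _ "Suc m" m _ UNIV])
      fix s
      have "sym_rep m g * sym_rep m h * power_col m 1 s = sym_rep m g * (sym_rep m h * power_col m 1 s)"
        by (rule assoc_mult_mat[of _ "Suc m" "Suc m" _ "Suc m" _ 1]) auto
      then show "sym_rep m (g * h) * power_col m 1 s = sym_rep m g * sym_rep m h * power_col m 1 s"
        unfolding g h mat22_mult sym_rep_power_col by (simp add: algebra_simps)
    qed (auto intro: mult_carrier_mat[OF sym_rep_carrier sym_rep_carrier] simp: infinite_UNIV_char_0)
  qed
  have one: "sym_rep m (1\<^sub>m 2) = 1\<^sub>m (Suc m)"
    by (rule power_col_separating[of _ "Suc m" m _ UNIV])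
      (auto simp: infinite_UNIV_char_0 mat22_one sym_rep_power_col left_mult_one_mat[OF power_col_carrier(1)])
  have reg: "\<exists>p. regular_fun p \<and> (\<forall>g \<in> carrier SL2. sym_rep m g $$ (i, j) = p g)"
    if "i < Suc m" "j < Suc m" for i j
    using that by (intro exI[of _ "\<lambda>g. coeff ([:g $$ (0, 0), g $$ (0, 1):] ^ (m - i) * [:g $$ (1, 0), g $$ (1, 1):] ^ i) j"])
      (auto simp: sym_rep_def simp del: power_Suc intro!: regular_coeff_mult regular_coeff_power regular_coeff_linear[of 0, simplified] regular_coeff_linear[of 1, simplified])
  show "alg_rep (sym_rep m)" "rep_dim (sym_rep m) = Suc m"
    by (rule alg_repI[OF sym_rep_carrier mult one reg]; assumption)+
qed

section \<open>The orbit of a highest weight vector\<close>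

abbreviation upper :: "complex \<Rightarrow> complex mat" where "upper s \<equiv> mat22 1 s 0 1"
abbreviation lower :: "complex \<Rightarrow> complex mat" where "lower s \<equiv> mat22 1 0 s 1"
abbreviation torus :: "complex \<Rightarrow> complex mat" where "torus t \<equiv> mat22 t 0 0 (1 / t)"

text \<open>The big cell of \<open>SL2\<close> consists of the matrices with nonzero upper left entry.\<close>

lemma gauss_decomposition:
  assumes "a \<noteq> 0" "a * d - b * c = 1"
  shows "mat22 a b c d = lower (c / a) * (torus a * upper (b / a))"
proof -
  have "c * b / a + 1 / a = d" using assms by (simp add: field_simps)
  then show ?thesis using assms(1) by (simp add: mat22_mult)
qed

text \<open>Column vectors depending polynomially on a parameter, and below the vectors of their coefficients.\<close>

definition poly_col :: "nat \<Rightarrow> (nat \<Rightarrow> complex poly) \<Rightarrow> complex \<Rightarrow> complex mat" where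
  "poly_col n r s = mat n 1 (\<lambda>(i, _). poly (r i) s)"

definition coeff_col :: "nat \<Rightarrow> (nat \<Rightarrow> complex poly) \<Rightarrow> nat \<Rightarrow> complex mat" where
  "coeff_col n r k = mat n 1 (\<lambda>(i, _). coeff (r i) k)"

lemma poly_col_carrier [simp]: "poly_col n r s \<in> carrier_mat n 1" "poly_col n r s \<in> carrier_mat n (Suc 0)"
  by (simp_all add: poly_col_def)
lemma coeff_col_carrier [simp]: "coeff_col n r s \<in> carrier_mat n 1" "coeff_col n r s \<in> carrier_mat n (Suc 0)"
  by (simp_all add: coeff_col_def)

lemma poly_col_eq_coeffs:
  assumes "infinite A" "\<And>s. s \<in> A \<Longrightarrow> poly_col n r s = poly_col n r' s" "i < n"
  shows "r i = r' i"
proof (rule poly_eq_on_infinite[OF assms(1)])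
  fix s assume "s \<in> A"
  then have "poly_col n r s $$ (i, 0) = poly_col n r' s $$ (i, 0)" using assms(2) by simp
  then show "poly (r i) s = poly (r' i) s" using assms(3) by (simp add: poly_col_def)
qed

lemma mult_poly_col:
  assumes "X \<in> carrier_mat n' n"
  shows "X * poly_col n r s = poly_col n' (\<lambda>i. \<Sum>j<n. Polynomial.smult (X $$ (i, j)) (r j)) s"
  using assms by (intro eq_matI) (auto simp: poly_col_def scalar_prod_def poly_sum atLeast0LessThan intro!: sum.cong)

lemma mult_coeff_col:
  assumes "X \<in> carrier_mat n' n"
  shows "X * coeff_col n r k = coeff_col n' (\<lambda>i. \<Sum>j<n. Polynomial.smult (X $$ (i, j)) (r j)) k"
  using assms by (intro eq_matI) (auto simp: coeff_col_def scalar_prod_def coeff_sum atLeast0LessThan intro!: sum.cong)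

lemma rep_curve:
  assumes \<rho>: "alg_rep \<rho>" and v: "v \<in> carrier_mat (rep_dim \<rho>) 1"
    and det: "\<And>x. poly a x * poly d x - poly b x * poly c x = 1"
  obtains r where "\<And>x. \<rho> (mat22 (poly a x) (poly b x) (poly c x) (poly d x)) * v = poly_col (rep_dim \<rho>) r x"
proof -
  let ?n = "rep_dim \<rho>"
  let ?g = "\<lambda>x. mat22 (poly a x) (poly b x) (poly c x) (poly d x)"
  have g: "?g x \<in> carrier SL2" for x using det by simp
  have "\<exists>P. i < ?n \<longrightarrow> j < ?n \<longrightarrow> (\<forall>x. \<rho> (?g x) $$ (i, j) = poly P x)" for i j
  proof (cases "i < ?n \<and> j < ?n")
    case True
    then obtain p where "regular_fun p" "\<And>h. h \<in> carrier SL2 \<Longrightarrow> \<rho> h $$ (i, j) = p h"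
      using alg_rep_entry[OF \<rho>] by metis
    then show ?thesis using regular_fun_curve[of p a b c d] g by metis
  qed auto
  then obtain P where P: "\<And>i j x. i < ?n \<Longrightarrow> j < ?n \<Longrightarrow> \<rho> (?g x) $$ (i, j) = poly (P i j) x" by metis
  have "\<rho> (?g x) * v = poly_col ?n (\<lambda>i. \<Sum>j<?n. Polynomial.smult (v $$ (j, 0)) (P i j)) x" for x
    using alg_rep_carrier[OF \<rho> g[of x]] v P
    by (intro eq_matI) (auto simp: poly_col_def scalar_prod_def poly_sum atLeast0LessThan intro!: sum.cong)
  then show ?thesis by (rule that)
qed

definition weight_vec :: "rep \<Rightarrow> int \<Rightarrow> complex mat \<Rightarrow> bool" where
  "weight_vec \<rho> l x \<longleftrightarrow> (\<forall>t. t \<noteq> 0 \<longrightarrow> \<rho> (torus t) * x = (t powi l) \<cdot>\<^sub>m x)"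

text \<open>On the big cell the orbit of a weight vector fixed by the upper unipotent group is determined by its
restriction to the lower unipotent group.\<close>

lemma orbit_formula:
  assumes \<rho>: "alg_rep \<rho>" and v: "v \<in> carrier_mat (rep_dim \<rho>) 1"
    and wt: "weight_vec \<rho> l v" and fix_v: "\<And>s. \<rho> (upper s) * v = v"
    and a: "a \<noteq> 0" "a * d - b * c = 1"
  shows "\<rho> (mat22 a b c d) * v = (a powi l) \<cdot>\<^sub>m (\<rho> (lower (c / a)) * v)"
proof -
  let ?n = "rep_dim \<rho>"
  note C = alg_rep_carrier[OF \<rho>]
  have S: "lower (c / a) \<in> carrier SL2" "torus a \<in> carrier SL2" "upper (b / a) \<in> carrier SL2"
    using a by auto
  note Cs = C[OF S(1)] C[OF S(2)] C[OF S(3)]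
  have "\<rho> (mat22 a b c d) * v = \<rho> (lower (c / a)) * (\<rho> (torus a) * \<rho> (upper (b / a))) * v"
    unfolding gauss_decomposition[OF a] using S by (simp add: alg_rep_mult[OF \<rho>] del: SL2_mat22)
  also have "\<dots> = \<rho> (lower (c / a)) * (\<rho> (torus a) * (\<rho> (upper (b / a)) * v))"
    using Cs v by (simp add: assoc_mult_mat[of _ ?n ?n _ ?n _ 1] mult_carrier_mat[of _ ?n ?n])
  also have "\<dots> = \<rho> (lower (c / a)) * ((a powi l) \<cdot>\<^sub>m v)"
    using wt a by (simp add: fix_v weight_vec_def)
  finally show ?thesis using mult_smult_distrib[OF Cs(1) v] by simp
qed

text \<open>A function regular at \<open>x = 0\<close> has no pole there; this bounds the degree in the variable \<open>1 / x\<close>.\<close>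

lemma laurent_degree_bound:
  fixes p q :: "complex poly"
  assumes "\<And>x. x \<noteq> 0 \<Longrightarrow> poly p x = x powi l * poly q (1 / x)" "q \<noteq> 0"
  shows "int (degree q) \<le> l"
proof (rule ccontr)
  assume "\<not> int (degree q) \<le> l"
  then obtain j where j: "int j = int (degree q) - l" "0 < j" by (metis diff_gt_0_iff_gt int_ops(1) nat_0_le not_le of_nat_less_iff less_imp_le)
  have "monom 1 j * p = reflect_poly q"
  proof (rule poly_eq_nonzero)
    fix x :: complex assume x: "x \<noteq> 0"
    have "x ^ j * x powi l = x ^ degree q"
      using x j(1) by (metis add.commute diff_add_cancel power_int_add power_int_of_nat)
    then show "poly (monom 1 j * p) x = poly (reflect_poly q) x"
      using x assms(1)[OF x] by (simp add: poly_monom poly_reflect_poly_nz inverse_eq_divide flip: mult.assoc)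
  qed
  then have "coeff (monom 1 j * p) 0 = coeff (reflect_poly q) 0" by simp
  then show False using j(2) assms(2) by (simp add: coeff_mult)
qed

lemma poly_conv_sum_coeffs:
  fixes p :: "complex poly"
  assumes "degree p \<le> m" shows "poly p x = (\<Sum>k\<le>m. coeff p k * x ^ k)"
  unfolding poly_altdef using assms
  by (intro sum.mono_neutral_left) (auto simp: coeff_eq_0)

text \<open>The orbit of \<open>v\<close> along the lower unipotent group is polynomial.  Its degree is at most the weight \<open>l\<close>: along
the curve with first column \<open>(x, 1)\<close>, which leaves the big cell at \<open>x = 0\<close>, the orbit is regular, while
\<open>orbit_formula\<close> describes it for \<open>x \<noteq> 0\<close>.  The coefficient vectors of the orbit are the columns of \<open>A\<close>, and equivariance
follows by evaluating \<open>\<rho> (g h) v\<close> for lower unipotent \<open>h\<close>.\<close>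

lemma highest_weight_orbit:
  assumes \<rho>: "alg_rep \<rho>" and v: "v \<in> carrier_mat (rep_dim \<rho>) 1" "v \<noteq> 0\<^sub>m (rep_dim \<rho>) 1"
    and wt: "weight_vec \<rho> l v" and fix_v: "\<And>s. \<rho> (upper s) * v = v"
  obtains m A where "l = int m" "A \<in> carrier_mat (rep_dim \<rho>) (Suc m)"
    "\<And>g. g \<in> carrier SL2 \<Longrightarrow> \<rho> g * A = A * sym_rep m g"
    "\<And>s. \<rho> (lower s) * v = A * power_col m 1 s"
proof -
  let ?n = "rep_dim \<rho>"
  note C = alg_rep_carrier[OF \<rho>]
  obtain q where q: "\<And>s. \<rho> (lower s) * v = poly_col ?n q s"
    using rep_curve[OF \<rho> v(1), of 1 1 0 "[:0, 1:]"] by auto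
  \<comment> \<open>the curve that meets the complement of the big cell at \<open>s = 0\<close>\<close>
  obtain p where p: "\<And>s. \<rho> (mat22 s (- 1) 1 0) * v = poly_col ?n p s"
    using rep_curve[OF \<rho> v(1), of "[:0, 1:]" 0 "[:- 1:]" 1] by auto
  have deg: "int (degree (q i)) \<le> l" if "i < ?n" "q i \<noteq> 0" for i
  proof (rule laurent_degree_bound[OF _ that(2)])
    fix x :: complex assume x: "x \<noteq> 0"
    have "poly_col ?n p x = (x powi l) \<cdot>\<^sub>m poly_col ?n q (1 / x)"
      using orbit_formula[OF \<rho> v(1) wt fix_v x, of 0 "- 1" 1] by (simp add: p q)
    then have "poly_col ?n p x $$ (i, 0) = ((x powi l) \<cdot>\<^sub>m poly_col ?n q (1 / x)) $$ (i, 0)" by simp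
    then show "poly (p i) x = x powi l * poly (q i) (1 / x)" using that(1) by (simp add: poly_col_def)
  qed
  have v0: "v = poly_col ?n q 0"
    using q[of 0] v(1) alg_rep_one[OF \<rho>] by (simp add: mat22_one)
  have "\<exists>i<?n. q i \<noteq> 0"
  proof (rule ccontr)
    assume "\<not> ?thesis"
    then have "poly_col ?n q 0 = 0\<^sub>m ?n 1" by (intro eq_matI) (auto simp: poly_col_def)
    then show False using v0 v(2) by simp
  qed
  then have "0 \<le> l" using deg by force
  then obtain m where m: "l = int m" by (metis nat_0_le)
  have degm: "degree (q i) \<le> m" if "i < ?n" for i using deg[OF that] m by (cases "q i = 0") auto
  define A where "A = mat ?n (Suc m) (\<lambda>(i, k). coeff (q i) k)"
  have A: "A \<in> carrier_mat ?n (Suc m)" by (simp add: A_def)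
  have Ahpw: "\<rho> (lower s) * v = A * power_col m 1 s" for s
  proof (rule eq_matI)
    fix i j assume "i < dim_row (A * power_col m 1 s)" "j < dim_col (A * power_col m 1 s)"
    then have ij: "i < ?n" "j = 0" by (auto simp: A_def power_col_def)
    show "(\<rho> (lower s) * v) $$ (i, j) = (A * power_col m 1 s) $$ (i, j)"
      using ij degm[OF ij(1)] mult_power_col_index[OF A ij(1), of 1 s]
      by (simp add: q poly_col_def poly_conv_sum_coeffs) (simp add: A_def)
  qed (auto simp: q A_def power_col_def poly_col_def)
  have power_col_scale: "A * power_col m x y = (x powi l) \<cdot>\<^sub>m (A * power_col m 1 (y / x))" if "x \<noteq> 0" for x y
  proof -
    have "power_col m x y = (x powi l) \<cdot>\<^sub>m power_col m 1 (y / x)"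
      using that by (intro eq_matI) (auto simp: power_col_def m power_divide field_simps power_add[symmetric])
    then show ?thesis using mult_smult_distrib[OF A power_col_carrier(1)] by simp
  qed
  have "\<rho> g * A = A * sym_rep m g" if g: "g \<in> carrier SL2" for g
  proof -
    obtain a b c d where gs: "g = mat22 a b c d" "a * d - b * c = 1" using SL2_cases[OF g] .
    \<comment> \<open>outside of this set \<open>g * lower s\<close> lies in the big cell\<close>
    let ?Z = "{s. a + b * s = 0}"
    have "s = - a / b" if "a + b * s = 0" for s
    proof -
      have a: "a = - (b * s)" using that by (simp add: eq_neg_iff_add_eq_0)
      moreover have "b \<noteq> 0" using gs(2) a by auto
      ultimately show ?thesis by simp
    qed
    then have "?Z \<subseteq> {- a / b}" by auto
    then have inf: "infinite (- ?Z)" by (intro infinite_cofinite) (auto intro: finite_subset)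
    show ?thesis
    proof (rule power_col_separating[OF _ _ inf])
      show "\<rho> g * A \<in> carrier_mat ?n (Suc m)" using C[OF g] A by auto
      show "A * sym_rep m g \<in> carrier_mat ?n (Suc m)" using A by auto
      fix s assume "s \<in> - ?Z"
      then have s: "a + b * s \<noteq> 0" by simp
      have L: "lower s \<in> carrier SL2" by simp
      have "\<rho> g * A * power_col m 1 s = \<rho> g * (\<rho> (lower s) * v)"
        using C[OF g] A by (simp add: Ahpw assoc_mult_mat[of _ ?n ?n _ "Suc m" _ 1])
      also have "\<dots> = \<rho> (g * lower s) * v"
        using C[OF g] C[OF L] v(1) by (simp add: alg_rep_mult[OF \<rho> g L] assoc_mult_mat[of _ ?n ?n _ ?n _ 1])
      also have "\<dots> = \<rho> (mat22 (a + b * s) b (c + d * s) d) * v" by (simp add: gs mat22_mult)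
      also have "\<dots> = ((a + b * s) powi l) \<cdot>\<^sub>m (\<rho> (lower ((c + d * s) / (a + b * s))) * v)"
        using s gs(2) by (intro orbit_formula[OF \<rho> v(1) wt fix_v]) (auto simp: algebra_simps)
      also have "\<dots> = A * power_col m (a + b * s) (c + d * s)" using power_col_scale[OF s] by (simp add: Ahpw)
      also have "\<dots> = A * (sym_rep m g * power_col m 1 s)" by (simp add: gs sym_rep_power_col)
      also have "\<dots> = A * sym_rep m g * power_col m 1 s"
        using A by (simp add: assoc_mult_mat[of _ ?n "Suc m" _ "Suc m" _ 1])
      finally show "\<rho> g * A * power_col m 1 s = A * sym_rep m g * power_col m 1 s" .
    qed
  qed
  then show ?thesis using that[OF m A _ Ahpw] by blast
qed

section \<open>Weights of the diagonal torus\<close>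

text \<open>For a common denominator \<open>t\<^sup>N\<close> the entries of \<open>t\<^sup>N \<rho> (torus t)\<close> are polynomials in \<open>t\<close>, and \<open>W k\<close> collects their
coefficients of \<open>t\<^sup>k\<close>.  Allowing arbitrary factors \<open>Y\<close> and \<open>X\<close> on both sides makes every identity for \<open>\<rho> (torus t)\<close>
available for the \<open>W k\<close> by comparison of coefficients.\<close>

lemma torus_weights:
  assumes \<rho>: "alg_rep \<rho>"
  obtains N :: nat and W :: "nat \<Rightarrow> complex mat" where
    "\<And>k. W k \<in> carrier_mat (rep_dim \<rho>) (rep_dim \<rho>)"
    "finite {k. W k \<noteq> 0\<^sub>m (rep_dim \<rho>) (rep_dim \<rho>)}"
    "\<And>r r' Y X i j. Y \<in> carrier_mat r (rep_dim \<rho>) \<Longrightarrow> X \<in> carrier_mat (rep_dim \<rho>) r' \<Longrightarrow> i < r \<Longrightarrow> j < r' \<Longrightarrow>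
       \<exists>P. (\<forall>t. t \<noteq> 0 \<longrightarrow> poly P t = t ^ N * (Y * \<rho> (torus t) * X) $$ (i, j)) \<and>
           (\<forall>k. coeff P k = (Y * W k * X) $$ (i, j))"
proof -
  let ?n = "rep_dim \<rho>"
  have T: "torus t \<in> carrier SL2" if "t \<noteq> 0" for t using that by simp
  have "\<exists>P N. i < ?n \<longrightarrow> j < ?n \<longrightarrow> (\<forall>t. t \<noteq> 0 \<longrightarrow> t ^ N * \<rho> (torus t) $$ (i, j) = poly P t)" for i j
  proof (cases "i < ?n \<and> j < ?n")
    case True
    then obtain p where p: "regular_fun p" "\<And>h. h \<in> carrier SL2 \<Longrightarrow> \<rho> h $$ (i, j) = p h"
      using alg_rep_entry[OF \<rho>] by metis
    then show ?thesis using regular_fun_torus[OF p(1)] T by (metis (no_types, lifting))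
  qed auto
  then obtain P0 N0 where P0: "\<And>i j t. i < ?n \<Longrightarrow> j < ?n \<Longrightarrow> t \<noteq> 0 \<Longrightarrow> t ^ N0 i j * \<rho> (torus t) $$ (i, j) = poly (P0 i j) t"
    by metis
  define N where "N = (\<Sum>i<?n. \<Sum>j<?n. N0 i j)"
  have N0: "N0 i j \<le> N" if "i < ?n" "j < ?n" for i j
  proof -
    have "N0 i j \<le> (\<Sum>j<?n. N0 i j)" using that by (intro member_le_sum) auto
    also have "\<dots> \<le> N" unfolding N_def using that by (intro member_le_sum[of i _ "\<lambda>i. \<Sum>j<?n. N0 i j"]) auto
    finally show ?thesis .
  qed
  define p where "p i j = monom 1 (N - N0 i j) * P0 i j" for i j
  have p: "poly (p i j) t = t ^ N * \<rho> (torus t) $$ (i, j)" if "i < ?n" "j < ?n" "t \<noteq> 0" for i j t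
  proof -
    have "t ^ N = t ^ (N - N0 i j) * t ^ N0 i j" using N0[OF that(1,2)] by (simp flip: power_add)
    then show ?thesis using P0[OF that] by (simp add: p_def poly_monom flip: P0[OF that])
  qed
  define W where "W k = mat ?n ?n (\<lambda>(i, j). coeff (p i j) k)" for k
  have W: "W k \<in> carrier_mat ?n ?n" for k by (simp add: W_def)
  have "{k. W k \<noteq> 0\<^sub>m ?n ?n} \<subseteq> (\<Union>i<?n. \<Union>j<?n. {..degree (p i j)})"
  proof (rule subsetI, rule ccontr)
    fix k assume k: "k \<in> {k. W k \<noteq> 0\<^sub>m ?n ?n}" "k \<notin> (\<Union>i<?n. \<Union>j<?n. {..degree (p i j)})"
    then have "W k = 0\<^sub>m ?n ?n" by (intro eq_matI) (auto simp: W_def coeff_eq_0 not_le)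
    then show False using k by simp
  qed
  then have fin: "finite {k. W k \<noteq> 0\<^sub>m ?n ?n}" by (rule finite_subset) auto
  have "\<exists>P. (\<forall>t. t \<noteq> 0 \<longrightarrow> poly P t = t ^ N * (Y * \<rho> (torus t) * X) $$ (i, j)) \<and>
           (\<forall>k. coeff P k = (Y * W k * X) $$ (i, j))"
    if Y: "Y \<in> carrier_mat r ?n" and X: "X \<in> carrier_mat ?n r'" and ij: "i < r" "j < r'" for r r' Y X i j
  proof -
    have e: "(Y * Z * X) $$ (i, j) = (\<Sum>b<?n. \<Sum>a<?n. Y $$ (i, a) * Z $$ (a, b) * X $$ (b, j))"
      if "Z \<in> carrier_mat ?n ?n" for Z
      using that X Y ij
      by (simp add: scalar_prod_def atLeast0LessThan sum_distrib_left) (subst sum.swap, simp add: mult_ac)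
    show ?thesis
    proof (intro exI[of _ "\<Sum>b<?n. \<Sum>a<?n. Polynomial.smult (Y $$ (i, a) * X $$ (b, j)) (p a b)"] conjI allI impI)
      fix t :: complex assume t: "t \<noteq> 0"
      show "poly (\<Sum>b<?n. \<Sum>a<?n. Polynomial.smult (Y $$ (i, a) * X $$ (b, j)) (p a b)) t = t ^ N * (Y * \<rho> (torus t) * X) $$ (i, j)"
        unfolding e[OF alg_rep_carrier[OF \<rho> T[OF t]]]
        by (simp add: poly_sum sum_distrib_left p t algebra_simps)
    next
      fix k
      show "coeff (\<Sum>b<?n. \<Sum>a<?n. Polynomial.smult (Y $$ (i, a) * X $$ (b, j)) (p a b)) k = (Y * W k * X) $$ (i, j)"
        unfolding e[OF W] by (simp add: coeff_sum W_def algebra_simps)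
    qed
  qed
  then show ?thesis using that[of W N] W fin by blast
qed

text \<open>Conjugation by the torus scales the parameter of the upper unipotent group by \<open>t\<^sup>2\<close>, so the coefficient
of \<open>s\<^sup>k\<close> in \<open>\<rho> (upper s) v\<close> has weight \<open>l + 2 k\<close> and vanishes for \<open>k > 0\<close> by maximality.  The matrix \<open>Q\<close>
restricts the statement to the invariant subspace of its fixed vectors.\<close>

lemma unipotent_fixes_maximal_weight:
  assumes \<rho>: "alg_rep \<rho>" and Q: "Q \<in> carrier_mat (rep_dim \<rho>) (rep_dim \<rho>)"
    and comm: "\<And>g. g \<in> carrier SL2 \<Longrightarrow> Q * \<rho> g = \<rho> g * Q"
    and v: "v \<in> carrier_mat (rep_dim \<rho>) 1" "Q * v = v" and wt: "weight_vec \<rho> l v"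
    and max: "\<And>x l'. x \<in> carrier_mat (rep_dim \<rho>) 1 \<Longrightarrow> Q * x = x \<Longrightarrow> l < l' \<Longrightarrow> weight_vec \<rho> l' x
      \<Longrightarrow> x = 0\<^sub>m (rep_dim \<rho>) 1"
  shows "\<rho> (upper s) * v = v"
proof -
  let ?n = "rep_dim \<rho>"
  note C = alg_rep_carrier[OF \<rho>]
  have U: "upper s \<in> carrier SL2" for s by simp
  obtain r where r: "\<And>s. \<rho> (upper s) * v = poly_col ?n r s"
    using rep_curve[OF \<rho> v(1), of 1 1 "[:0, 1:]" 0] by auto
  have Qr: "Q * coeff_col ?n r k = coeff_col ?n r k" for k
  proof -
    have "Q * poly_col ?n r s = poly_col ?n r s" for s
    proof -
      have "Q * (\<rho> (upper s) * v) = Q * \<rho> (upper s) * v"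
        using Q C[OF U] v(1) by (simp add: assoc_mult_mat[of _ ?n ?n _ ?n _ 1])
      also have "\<dots> = \<rho> (upper s) * (Q * v)"
        unfolding comm[OF U] using Q C[OF U] v(1) by (simp add: assoc_mult_mat[of _ ?n ?n _ ?n _ 1])
      finally show ?thesis by (simp add: r v(2))
    qed
    then have "(\<Sum>j<?n. Polynomial.smult (Q $$ (i, j)) (r j)) = r i" if "i < ?n" for i
      using that unfolding mult_poly_col[OF Q] by (intro poly_col_eq_coeffs[of UNIV]) (auto simp: infinite_UNIV_char_0)
    then show ?thesis unfolding mult_coeff_col[OF Q] by (intro eq_matI) (auto simp: coeff_col_def)
  qed
  have wtk: "weight_vec \<rho> (l + 2 * int k) (coeff_col ?n r k)" for k
    unfolding weight_vec_def
  proof (intro allI impI)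
    fix t :: complex assume t: "t \<noteq> 0"
    then have T: "torus t \<in> carrier SL2" by simp
    have "\<rho> (torus t) * poly_col ?n r s = poly_col ?n (\<lambda>i. Polynomial.smult (t powi l) (pcompose (r i) [:0, t\<^sup>2:])) s" for s
    proof -
      have "\<rho> (torus t) * (\<rho> (upper s) * v) = \<rho> (torus t * upper s) * v"
        using C[OF T] C[OF U] v(1) by (simp add: alg_rep_mult[OF \<rho> T U] assoc_mult_mat[of _ ?n ?n _ ?n _ 1])
      also have "torus t * upper s = upper (t\<^sup>2 * s) * torus t"
        using t by (simp add: mat22_mult power2_eq_square)
      also have "\<rho> (upper (t\<^sup>2 * s) * torus t) * v = \<rho> (upper (t\<^sup>2 * s)) * (\<rho> (torus t) * v)"
        using C[OF T] C[OF U] v(1) by (simp add: alg_rep_mult[OF \<rho> U T] assoc_mult_mat[of _ ?n ?n _ ?n _ 1])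
      also have "\<dots> = (t powi l) \<cdot>\<^sub>m (\<rho> (upper (t\<^sup>2 * s)) * v)"
        using wt t mult_smult_distrib[OF C[OF U] v(1)] by (simp add: weight_vec_def)
      finally show ?thesis
        unfolding r by (simp add: poly_col_def poly_pcompose mult.commute) (intro eq_matI, auto)
    qed
    then have e: "(\<Sum>j<?n. Polynomial.smult (\<rho> (torus t) $$ (i, j)) (r j))
        = Polynomial.smult (t powi l) (pcompose (r i) [:0, t\<^sup>2:])" if "i < ?n" for i
      using that unfolding mult_poly_col[OF C[OF T]] by (intro poly_col_eq_coeffs[of UNIV]) (auto simp: infinite_UNIV_char_0)
    have "t powi (l + 2 * int k) = t powi l * (t\<^sup>2) ^ k"
      using t by (simp add: power_int_add power_int_mult flip: power_mult)
    then show "\<rho> (torus t) * coeff_col ?n r k = t powi (l + 2 * int k) \<cdot>\<^sub>m coeff_col ?n r k"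
      unfolding mult_coeff_col[OF C[OF T]]
      by (intro eq_matI) (auto simp: coeff_col_def e coeff_pcompose_linear)
  qed
  have zero: "coeff (r i) k = 0" if "i < ?n" "0 < k" for i k
  proof -
    have "coeff_col ?n r k = 0\<^sub>m ?n 1" using that by (intro max[OF _ Qr _ wtk]) auto
    then have "coeff_col ?n r k $$ (i, 0) = 0" using that by simp
    then show ?thesis using that by (simp add: coeff_col_def)
  qed
  have const: "poly (r i) s = poly (r i) 0" if "i < ?n" for i
  proof -
    have "degree (r i) = 0" using zero[OF that] by (metis leading_coeff_0_iff degree_0 neq0_conv)
    then obtain c where "r i = [:c:]" by (rule degree_eq_zeroE)
    then show ?thesis by simp
  qed
  have "\<rho> (upper s) * v = \<rho> (upper 0) * v"
    unfolding r using const by (intro eq_matI) (auto simp: poly_col_def)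
  then show ?thesis using v(1) by (simp add: alg_rep_one[OF \<rho>] flip: mat22_one)
qed

text \<open>The matrices \<open>W k\<close> are the projections onto the weight spaces of weight \<open>k - N\<close>.  All properties result from
comparing coefficients in \<open>\<rho> (torus s) \<rho> (torus t) = \<rho> (torus (s t))\<close> and in the identities that express the
hypotheses.\<close>

lemma torus_weight_spaces:
  assumes \<rho>: "alg_rep \<rho>"
  obtains N :: nat and W :: "nat \<Rightarrow> complex mat" where
    "\<And>k. W k \<in> carrier_mat (rep_dim \<rho>) (rep_dim \<rho>)"
    "finite {k. W k \<noteq> 0\<^sub>m (rep_dim \<rho>) (rep_dim \<rho>)}"
    "\<And>k. weight_vec \<rho> (int k - int N) (W k)"
    "\<And>k t. t \<noteq> 0 \<Longrightarrow> W k * \<rho> (torus t) = (t powi (int k - int N)) \<cdot>\<^sub>m W k"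
    "\<And>k r x. x \<in> carrier_mat (rep_dim \<rho>) r \<Longrightarrow> weight_vec \<rho> (int k - int N) x \<Longrightarrow> W k * x = x"
    "\<And>k r y. y \<in> carrier_mat r (rep_dim \<rho>) \<Longrightarrow>
      (\<And>t. t \<noteq> 0 \<Longrightarrow> y * \<rho> (torus t) = (t powi (int k - int N)) \<cdot>\<^sub>m y) \<Longrightarrow> y * W k = y"
    "\<And>r x. x \<in> carrier_mat (rep_dim \<rho>) r \<Longrightarrow> (\<And>k. W k * x = 0\<^sub>m (rep_dim \<rho>) r) \<Longrightarrow> x = 0\<^sub>m (rep_dim \<rho>) r"
    "\<And>k Q. Q \<in> carrier_mat (rep_dim \<rho>) (rep_dim \<rho>) \<Longrightarrow>
      (\<And>t. t \<noteq> 0 \<Longrightarrow> Q * \<rho> (torus t) = \<rho> (torus t) * Q) \<Longrightarrow> Q * W k = W k * Q"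
proof -
  let ?n = "rep_dim \<rho>"
  note C = alg_rep_carrier[OF \<rho>]
  have T: "torus t \<in> carrier SL2" if "t \<noteq> 0" for t using that by simp
  have CT: "\<rho> (torus t) \<in> carrier_mat ?n ?n" if "t \<noteq> 0" for t using C[OF T[OF that]] .
  obtain N W where W: "\<And>k. W k \<in> carrier_mat ?n ?n" and fin: "finite {k. W k \<noteq> 0\<^sub>m ?n ?n}"
    and E: "\<And>r r' Y X i j. Y \<in> carrier_mat r ?n \<Longrightarrow> X \<in> carrier_mat ?n r' \<Longrightarrow> i < r \<Longrightarrow> j < r' \<Longrightarrow>
       \<exists>P. (\<forall>t. t \<noteq> 0 \<longrightarrow> poly P t = t ^ N * (Y * \<rho> (torus t) * X) $$ (i, j)) \<and>
           (\<forall>k. coeff P k = (Y * W k * X) $$ (i, j))"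
    by (rule torus_weights[OF \<rho>]) (rule that)
  have one: "1\<^sub>m ?n \<in> carrier_mat ?n ?n" by simp
  have powN: "t ^ N * t powi (int k - int N) = t ^ k" if "t \<noteq> 0" for t :: complex and k
    using that by (simp add: power_int_diff)
  have tt: "\<rho> (torus s) * \<rho> (torus t) = \<rho> (torus (s * t))" if "s \<noteq> 0" "t \<noteq> 0" for s t
    using that by (subst alg_rep_mult[OF \<rho>, symmetric]) (auto simp: mat22_mult)
  have w1: "\<rho> (torus s) * W k = (s powi (int k - int N)) \<cdot>\<^sub>m W k \<and> W k * \<rho> (torus s) = (s powi (int k - int N)) \<cdot>\<^sub>m W k"
    if s: "s \<noteq> 0" for s k
  proof -
    have ent: "(\<rho> (torus s) * W k) $$ (i, j) = s powi (int k - int N) * W k $$ (i, j)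
      \<and> (W k * \<rho> (torus s)) $$ (i, j) = s powi (int k - int N) * W k $$ (i, j)" if ij: "i < ?n" "j < ?n" for i j
    proof -
      obtain P1 where P1: "\<And>t. t \<noteq> 0 \<Longrightarrow> poly P1 t = t ^ N * (1\<^sub>m ?n * \<rho> (torus t) * 1\<^sub>m ?n) $$ (i, j)"
        "\<And>k. coeff P1 k = (1\<^sub>m ?n * W k * 1\<^sub>m ?n) $$ (i, j)" using E[OF one one ij] by blast
      obtain P2 where P2: "\<And>t. t \<noteq> 0 \<Longrightarrow> poly P2 t = t ^ N * (\<rho> (torus s) * \<rho> (torus t) * 1\<^sub>m ?n) $$ (i, j)"
        "\<And>k. coeff P2 k = (\<rho> (torus s) * W k * 1\<^sub>m ?n) $$ (i, j)" using E[OF CT[OF s] one ij] by blast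
      obtain P3 where P3: "\<And>t. t \<noteq> 0 \<Longrightarrow> poly P3 t = t ^ N * (1\<^sub>m ?n * \<rho> (torus t) * \<rho> (torus s)) $$ (i, j)"
        "\<And>k. coeff P3 k = (1\<^sub>m ?n * W k * \<rho> (torus s)) $$ (i, j)" using E[OF one CT[OF s] ij] by blast
      have "Polynomial.smult (s ^ N) P2 = pcompose P1 [:0, s:]"
      proof (rule poly_eq_nonzero)
        fix t :: complex assume t: "t \<noteq> 0"
        show "poly (Polynomial.smult (s ^ N) P2) t = poly (pcompose P1 [:0, s:]) t"
          using s t CT[of "s * t"] CT[OF s] CT[OF t] by (simp add: poly_pcompose P1(1) P2(1) tt power_mult_distrib mult.commute)
      qed
      then have "coeff (Polynomial.smult (s ^ N) P2) k = coeff (pcompose P1 [:0, s:]) k" by simp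
      then have A: "s ^ N * (\<rho> (torus s) * W k) $$ (i, j) = s ^ k * W k $$ (i, j)"
        using W[of k] CT[OF s] by (simp add: coeff_pcompose_linear P1(2) P2(2) right_mult_one_mat[of _ ?n ?n])
      have "Polynomial.smult (s ^ N) P3 = pcompose P1 [:0, s:]"
      proof (rule poly_eq_nonzero)
        fix t :: complex assume t: "t \<noteq> 0"
        show "poly (Polynomial.smult (s ^ N) P3) t = poly (pcompose P1 [:0, s:]) t"
          using s t CT[of "s * t"] CT[OF s] CT[OF t] by (simp add: poly_pcompose P1(1) P3(1) tt power_mult_distrib mult.commute)
      qed
      then have "coeff (Polynomial.smult (s ^ N) P3) k = coeff (pcompose P1 [:0, s:]) k" by simp
      then have B: "s ^ N * (W k * \<rho> (torus s)) $$ (i, j) = s ^ k * W k $$ (i, j)"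
        using W[of k] CT[OF s] by (simp add: coeff_pcompose_linear P1(2) P3(2) left_mult_one_mat[of _ ?n ?n] right_mult_one_mat[of _ ?n ?n])
      have "s ^ k = s ^ N * s powi (int k - int N)" using powN[OF s] by simp
      then show ?thesis using A B s by simp
    qed
    show ?thesis
      by (intro conjI eq_matI) (use W[of k] CT[OF s] ent in \<open>auto simp del: index_mult_mat(1)\<close>)
  qed
  have w3: "W k * x = x" if x: "x \<in> carrier_mat ?n r" and wt: "weight_vec \<rho> (int k - int N) x" for k r x
  proof (rule eq_matI)
    fix i j assume "i < dim_row x" "j < dim_col x"
    then have ij: "i < ?n" "j < r" using x by auto
    obtain P where P: "\<And>t. t \<noteq> 0 \<Longrightarrow> poly P t = t ^ N * (1\<^sub>m ?n * \<rho> (torus t) * x) $$ (i, j)"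
        "\<And>k. coeff P k = (1\<^sub>m ?n * W k * x) $$ (i, j)" using E[OF one x ij] by blast
    have "P = monom (x $$ (i, j)) k"
    proof (rule poly_eq_nonzero)
      fix t :: complex assume t: "t \<noteq> 0"
      have "poly P t = (t ^ N * t powi (int k - int N)) * x $$ (i, j)"
      proof -
        have "1\<^sub>m ?n * \<rho> (torus t) * x = (t powi (int k - int N)) \<cdot>\<^sub>m x"
          unfolding left_mult_one_mat[OF CT[OF t]] using wt t by (simp add: weight_vec_def)
        then have "(1\<^sub>m ?n * \<rho> (torus t) * x) $$ (i, j) = ((t powi (int k - int N)) \<cdot>\<^sub>m x) $$ (i, j)"
          by (rule arg_cong)
        also have "\<dots> = t powi (int k - int N) * x $$ (i, j)" using x ij by simp
        finally show ?thesis using P(1)[OF t] by (simp only: mult.assoc)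
      qed
      then show "poly P t = poly (monom (x $$ (i, j)) k) t" unfolding powN[OF t] by (simp add: poly_monom)
    qed
    then have "coeff P k = x $$ (i, j)" by simp
    then show "(W k * x) $$ (i, j) = x $$ (i, j)" unfolding P(2) using W[of k] by (simp del: index_mult_mat(1))
  qed (use W[of k] x in auto)
  have w3': "y * W k = y" if y: "y \<in> carrier_mat r ?n"
    and wt: "\<And>t. t \<noteq> 0 \<Longrightarrow> y * \<rho> (torus t) = (t powi (int k - int N)) \<cdot>\<^sub>m y" for k r y
  proof (rule eq_matI)
    fix i j assume "i < dim_row y" "j < dim_col y"
    then have ij: "i < r" "j < ?n" using y by auto
    obtain P where P: "\<And>t. t \<noteq> 0 \<Longrightarrow> poly P t = t ^ N * (y * \<rho> (torus t) * 1\<^sub>m ?n) $$ (i, j)"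
        "\<And>k. coeff P k = (y * W k * 1\<^sub>m ?n) $$ (i, j)" using E[OF y one ij] by blast
    have "P = monom (y $$ (i, j)) k"
    proof (rule poly_eq_nonzero)
      fix t :: complex assume t: "t \<noteq> 0"
      have "poly P t = (t ^ N * t powi (int k - int N)) * y $$ (i, j)"
        using P(1)[OF t] wt[OF t] t CT[OF t] y ij right_mult_one_mat[of "(t powi (int k - int N)) \<cdot>\<^sub>m y" r ?n] by simp
      then show "poly P t = poly (monom (y $$ (i, j)) k) t" unfolding powN[OF t] by (simp add: poly_monom)
    qed
    then have "coeff P k = y $$ (i, j)" by simp
    moreover have "y * W k * 1\<^sub>m ?n = y * W k" by (rule right_mult_one_mat) (use y W[of k] in auto)
    ultimately show "(y * W k) $$ (i, j) = y $$ (i, j)" unfolding P(2) by simp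
  qed (use W[of k] y in auto)
  have w4: "x = 0\<^sub>m ?n r" if x: "x \<in> carrier_mat ?n r" and z: "\<And>k. W k * x = 0\<^sub>m ?n r" for r x
  proof (rule eq_matI)
    fix i j assume "i < dim_row (0\<^sub>m ?n r :: complex mat)" "j < dim_col (0\<^sub>m ?n r :: complex mat)"
    then have ij: "i < ?n" "j < r" by auto
    obtain P where P: "\<And>t. t \<noteq> 0 \<Longrightarrow> poly P t = t ^ N * (1\<^sub>m ?n * \<rho> (torus t) * x) $$ (i, j)"
        "\<And>k. coeff P k = (1\<^sub>m ?n * W k * x) $$ (i, j)" using E[OF one x ij] by blast
    have "coeff P k = 0" for k unfolding P(2) left_mult_one_mat[OF W] z using ij by simp
    then have "P = 0" by (simp add: poly_eq_iff)
    then have "(1\<^sub>m ?n * \<rho> (torus 1) * x) $$ (i, j) = 0" using P(1)[of 1] by simp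
    then show "x $$ (i, j) = 0\<^sub>m ?n r $$ (i, j)" using ij x by (simp add: alg_rep_one[OF \<rho>] flip: mat22_one)
  qed (use x in auto)
  have w5: "Q * W k = W k * Q" if Q: "Q \<in> carrier_mat ?n ?n"
    and c: "\<And>t. t \<noteq> 0 \<Longrightarrow> Q * \<rho> (torus t) = \<rho> (torus t) * Q" for k Q
  proof (rule eq_matI)
    fix i j assume "i < dim_row (W k * Q)" "j < dim_col (W k * Q)"
    then have ij: "i < ?n" "j < ?n" using Q W[of k] by auto
    obtain P where P: "\<And>t. t \<noteq> 0 \<Longrightarrow> poly P t = t ^ N * (1\<^sub>m ?n * \<rho> (torus t) * Q) $$ (i, j)"
        "\<And>k. coeff P k = (1\<^sub>m ?n * W k * Q) $$ (i, j)" using E[OF one Q ij] by blast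
    obtain P' where P': "\<And>t. t \<noteq> 0 \<Longrightarrow> poly P' t = t ^ N * (Q * \<rho> (torus t) * 1\<^sub>m ?n) $$ (i, j)"
        "\<And>k. coeff P' k = (Q * W k * 1\<^sub>m ?n) $$ (i, j)" using E[OF Q one ij] by blast
    have "P = P'"
    proof (rule poly_eq_nonzero)
      fix t :: complex assume t: "t \<noteq> 0"
      have "Q * \<rho> (torus t) * 1\<^sub>m ?n = \<rho> (torus t) * Q" "1\<^sub>m ?n * \<rho> (torus t) * Q = \<rho> (torus t) * Q"
        unfolding c[OF t] using CT[OF t] Q by auto
      then show "poly P t = poly P' t" unfolding P(1)[OF t] P'(1)[OF t] by simp
    qed
    then have "coeff P k = coeff P' k" by simp
    moreover have "Q * W k * 1\<^sub>m ?n = Q * W k" by (rule right_mult_one_mat) (use Q W[of k] in auto)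
    ultimately show "(Q * W k) $$ (i, j) = (W k * Q) $$ (i, j)"
      unfolding P(2) P'(2) left_mult_one_mat[OF W] by simp
  qed (use W[of k] Q in auto)
  show ?thesis
  proof (rule that[OF W fin _ _ w3 w3' w4 w5])
    show "weight_vec \<rho> (int k - int N) (W k)" for k using w1 unfolding weight_vec_def by blast
    show "t \<noteq> 0 \<Longrightarrow> W k * \<rho> (torus t) = (t powi (int k - int N)) \<cdot>\<^sub>m W k" for t k using w1 by blast
  qed
qed

section \<open>Splitting off a symmetric power\<close>

lemma weight_vec_mult:
  assumes "alg_rep \<rho>" "weight_vec \<rho> l x" "x \<in> carrier_mat (rep_dim \<rho>) r" "y \<in> carrier_mat r r'"
  shows "weight_vec \<rho> l (x * y)"
  unfolding weight_vec_def
proof (intro allI impI)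
  fix t :: complex assume t: "t \<noteq> 0"
  then have C: "\<rho> (torus t) \<in> carrier_mat (rep_dim \<rho>) (rep_dim \<rho>)" using alg_rep_carrier[OF assms(1)] by simp
  have "\<rho> (torus t) * (x * y) = (\<rho> (torus t) * x) * y" using C assms(3,4) by simp
  also have "\<dots> = (t powi l) \<cdot>\<^sub>m (x * y)"
    using assms(2) t mult_smult_assoc_mat[OF assms(3,4)] by (simp add: weight_vec_def)
  finally show "\<rho> (torus t) * (x * y) = (t powi l) \<cdot>\<^sub>m (x * y)" .
qed

lemma transpose_smult_mat: "transpose_mat (c \<cdot>\<^sub>m X) = c \<cdot>\<^sub>m transpose_mat X"
  by (intro eq_matI) auto

text \<open>The columns of the orbit map span the smallest invariant subspace containing \<open>v\<close>.  Since \<open>Q\<close> commutes with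
\<open>\<rho>\<close>, it fixes this subspace pointwise as soon as it fixes \<open>v\<close>.\<close>

lemma orbit_map_absorbs:
  assumes \<rho>: "alg_rep \<rho>" and Q: "Q \<in> carrier_mat (rep_dim \<rho>) (rep_dim \<rho>)"
    and comm: "\<And>g. g \<in> carrier SL2 \<Longrightarrow> Q * \<rho> g = \<rho> g * Q"
    and v: "v \<in> carrier_mat (rep_dim \<rho>) 1" "Q * v = v"
    and A: "A \<in> carrier_mat (rep_dim \<rho>) (Suc m)" "\<And>s. \<rho> (lower s) * v = A * power_col m 1 s"
  shows "Q * A = A"
proof (rule power_col_separating[OF _ A(1), of _ UNIV])
  fix s
  let ?n = "rep_dim \<rho>"
  have L: "lower s \<in> carrier SL2" by simp
  note CL = alg_rep_carrier[OF \<rho> L]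
  have "Q * A * power_col m 1 s = Q * (\<rho> (lower s) * v)" unfolding A(2) by (rule assoc_mult_mat[OF Q A(1) power_col_carrier(1)])
  also have "\<dots> = Q * \<rho> (lower s) * v" by (rule assoc_mult_mat[OF Q CL v(1), symmetric])
  also have "\<dots> = \<rho> (lower s) * Q * v" unfolding comm[OF L] ..
  also have "\<dots> = \<rho> (lower s) * (Q * v)" by (rule assoc_mult_mat[OF CL Q v(1)])
  finally show "Q * A * power_col m 1 s = A * power_col m 1 s" unfolding v(2) A(2) .
qed (use Q A in \<open>auto simp: infinite_UNIV_char_0\<close>)

lemma transpose_rep_commute:
  assumes \<rho>: "alg_rep \<rho>" and Q: "Q \<in> carrier_mat (rep_dim \<rho>) (rep_dim \<rho>)"
    and comm: "\<And>g. g \<in> carrier SL2 \<Longrightarrow> Q * \<rho> g = \<rho> g * Q" and g: "g \<in> carrier SL2"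
  shows "transpose_mat Q * transpose_rep \<rho> g = transpose_rep \<rho> g * transpose_mat Q"
proof -
  note gT = SL2_transpose[OF g]
  note C = alg_rep_carrier[OF \<rho> gT]
  show ?thesis
    unfolding transpose_rep_def transpose_mult[OF C Q, symmetric] transpose_mult[OF Q C, symmetric] comm[OF gT] ..
qed

text \<open>Let \<open>K\<close> be the largest index with \<open>M = W K Q\<close> different from \<open>0\<close>.  This \<open>M\<close> is the projection onto the highest weight space of
the image of \<open>Q\<close>.  A column and a row of \<open>M\<close> through a nonzero entry, suitably scaled, are a vector and a linear
form of maximal weight whose pairing is \<open>1\<close>, because \<open>M\<close> is idempotent.\<close>

lemma maximal_weight_pair:
  assumes \<rho>: "alg_rep \<rho>" and Q: "Q \<in> carrier_mat (rep_dim \<rho>) (rep_dim \<rho>)" "Q * Q = Q"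
    "Q \<noteq> 0\<^sub>m (rep_dim \<rho>) (rep_dim \<rho>)"
    and comm: "\<And>g. g \<in> carrier SL2 \<Longrightarrow> Q * \<rho> g = \<rho> g * Q"
  obtains l v w where "v \<in> carrier_mat (rep_dim \<rho>) 1" "w \<in> carrier_mat 1 (rep_dim \<rho>)" "w * v = 1\<^sub>m 1"
    "Q * v = v" "w * Q = w" "weight_vec \<rho> l v" "\<And>s. \<rho> (upper s) * v = v"
    "weight_vec (transpose_rep \<rho>) l (transpose_mat w)"
    "\<And>s. transpose_rep \<rho> (upper s) * transpose_mat w = transpose_mat w"
proof -
  let ?n = "rep_dim \<rho>"
  note C = alg_rep_carrier[OF \<rho>]
  have T: "torus t \<in> carrier SL2" if "t \<noteq> 0" for t using that by simp
  have CT: "\<rho> (torus t) \<in> carrier_mat ?n ?n" if "t \<noteq> 0" for t using C[OF T[OF that]] .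
  have U: "upper s \<in> carrier SL2" and L: "lower s \<in> carrier SL2" for s by simp_all
  obtain N W where W: "\<And>k. W k \<in> carrier_mat ?n ?n" and fin: "finite {k. W k \<noteq> 0\<^sub>m ?n ?n}"
    and W1: "\<And>k. weight_vec \<rho> (int k - int N) (W k)"
    and W2: "\<And>k t. t \<noteq> 0 \<Longrightarrow> W k * \<rho> (torus t) = (t powi (int k - int N)) \<cdot>\<^sub>m W k"
    and W3: "\<And>k r x. x \<in> carrier_mat ?n r \<Longrightarrow> weight_vec \<rho> (int k - int N) x \<Longrightarrow> W k * x = x"
    and W4: "\<And>k r y. y \<in> carrier_mat r ?n \<Longrightarrow>
      (\<And>t. t \<noteq> 0 \<Longrightarrow> y * \<rho> (torus t) = (t powi (int k - int N)) \<cdot>\<^sub>m y) \<Longrightarrow> y * W k = y"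
    and W5: "\<And>r x. x \<in> carrier_mat ?n r \<Longrightarrow> (\<And>k. W k * x = 0\<^sub>m ?n r) \<Longrightarrow> x = 0\<^sub>m ?n r"
    and W6: "\<And>k Q. Q \<in> carrier_mat ?n ?n \<Longrightarrow>
      (\<And>t. t \<noteq> 0 \<Longrightarrow> Q * \<rho> (torus t) = \<rho> (torus t) * Q) \<Longrightarrow> Q * W k = W k * Q"
  proof (rule torus_weight_spaces[OF \<rho>], goal_cases)
    case (1 W N)
    show ?case by (rule that[OF 1(2-9)])
  qed
  have QW: "Q * W k = W k * Q" for k by (rule W6[OF Q(1)]) (rule comm[OF T])
  define H where "H = {k. W k * Q \<noteq> 0\<^sub>m ?n ?n}"
  have "H \<subseteq> {k. W k \<noteq> 0\<^sub>m ?n ?n}" unfolding H_def using Q(1) by auto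
  then have finH: "finite H" using fin by (rule finite_subset)
  have neH: "H \<noteq> {}" using W5[OF Q(1)] Q(3) by (auto simp: H_def)
  define K where "K = Max H"
  have KH: "K \<in> H" and Kmax: "\<And>k. K < k \<Longrightarrow> W k * Q = 0\<^sub>m ?n ?n"
    using finH neH Max_in[of H] Max_ge[of H] by (auto simp: K_def H_def not_le[symmetric])
  define l where "l = int K - int N"
  define M where "M = W K * Q"
  have M: "M \<in> carrier_mat ?n ?n" unfolding M_def using W Q(1) by (rule mult_carrier_mat)
  have WW: "W K * W K = W K" by (rule W3[OF W W1])
  have QM: "Q * M = M"
    unfolding M_def assoc_mult_mat[OF Q(1) W Q(1), symmetric] QW assoc_mult_mat[OF W Q(1) Q(1)] Q(2) ..
  have MQ: "M * Q = M" unfolding M_def assoc_mult_mat[OF W Q(1) Q(1)] Q(2) ..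
  have WM: "W K * M = M" unfolding M_def assoc_mult_mat[OF W W Q(1), symmetric] WW ..
  have "M * M = W K * (Q * M)" by (subst M_def) (rule assoc_mult_mat[OF W Q(1) M])
  then have MM: "M * M = M" unfolding QM WM .
  have "M \<noteq> 0\<^sub>m ?n ?n" using KH by (simp add: H_def M_def)
  then obtain i0 j0 where ij: "i0 < ?n" "j0 < ?n" "M $$ (i0, j0) \<noteq> 0"
    using M by (metis carrier_matD eq_matI index_zero_mat)
  \<comment> \<open>\<open>M * e\<close> is column \<open>j0\<close> divided by the entry \<open>(i0, j0)\<close>, and \<open>f * M\<close> is row \<open>i0\<close>\<close>
  define e :: "complex mat" where "e = mat ?n 1 (\<lambda>(j, _). if j = j0 then 1 / M $$ (i0, j0) else 0)"
  define f :: "complex mat" where "f = mat 1 ?n (\<lambda>(_, i). if i = i0 then 1 else 0)"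
  have e: "e \<in> carrier_mat ?n 1" and f: "f \<in> carrier_mat 1 ?n" by (simp_all add: e_def f_def)
  define v where "v = M * e"
  define w where "w = f * M"
  have v: "v \<in> carrier_mat ?n 1" and w: "w \<in> carrier_mat 1 ?n" unfolding v_def w_def using M e f by auto
  have wM: "w * M = w" unfolding w_def assoc_mult_mat[OF f M M] MM ..
  have w_row: "w $$ (0, j) = M $$ (i0, j)" if "j < ?n" for j
  proof -
    have "w $$ (0, j) = (\<Sum>i<?n. f $$ (0, i) * M $$ (i, j))"
      unfolding w_def using f M that by (simp add: scalar_prod_def atLeast0LessThan)
    also have "\<dots> = (\<Sum>i<?n. if i = i0 then M $$ (i, j) else 0)"
      by (intro sum.cong) (auto simp: f_def)
    finally show ?thesis using ij by simp
  qed
  have wv: "w * v = 1\<^sub>m 1"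
  proof -
    have "w * v = w * e" unfolding v_def assoc_mult_mat[OF w M e, symmetric] wM ..
    moreover have "(w * e) $$ (0, 0) = (\<Sum>j<?n. w $$ (0, j) * e $$ (j, 0))"
      using w e by (simp add: scalar_prod_def atLeast0LessThan)
    then have "(w * e) $$ (0, 0) = (\<Sum>j<?n. if j = j0 then w $$ (0, j) / M $$ (i0, j0) else 0)"
      by (simp add: e_def if_distrib cong: if_cong)
    then have "(w * e) $$ (0, 0) = 1" using ij w_row by simp
    then have "w * e = 1\<^sub>m 1" using w e by (intro eq_matI) auto
    ultimately show ?thesis by simp
  qed
  have Qv: "Q * v = v" unfolding v_def assoc_mult_mat[OF Q(1) M e, symmetric] QM ..
  have wQ: "w * Q = w" unfolding w_def assoc_mult_mat[OF f M Q(1)] MQ ..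
  have wtv: "weight_vec \<rho> l v"
    unfolding v_def M_def l_def
    by (rule weight_vec_mult[OF \<rho> weight_vec_mult[OF \<rho> W1 W Q(1)] mult_carrier_mat[OF W Q(1)] e])
  have wtw: "w * \<rho> (torus t) = (t powi l) \<cdot>\<^sub>m w" if t: "t \<noteq> 0" for t
  proof -
    have fW: "f * W K \<in> carrier_mat 1 ?n" using f W[of K] by auto
    have wfW: "w = f * W K * Q" unfolding w_def M_def by (rule assoc_mult_mat[OF f W Q(1), symmetric])
    have "w * \<rho> (torus t) = f * W K * (\<rho> (torus t) * Q)"
      unfolding wfW assoc_mult_mat[OF fW Q(1) CT[OF t]] comm[OF T[OF t]] ..
    also have "\<dots> = f * (W K * \<rho> (torus t)) * Q"
      unfolding assoc_mult_mat[OF fW CT[OF t] Q(1), symmetric] assoc_mult_mat[OF f W CT[OF t]] ..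
    also have "\<dots> = (t powi l) \<cdot>\<^sub>m w"
      unfolding W2[OF t] l_def[symmetric] mult_smult_distrib[OF f W] mult_smult_assoc_mat[OF fW Q(1)] wfW ..
    finally show ?thesis .
  qed
  have weights: "\<exists>k>K. l' = int k - int N" if "l < l'" for l'
    using that by (intro exI[of _ "nat (l' + int N)"]) (auto simp: l_def)
  have upv: "\<rho> (upper s) * v = v" for s
  proof (rule unipotent_fixes_maximal_weight[OF \<rho> Q(1) comm v Qv wtv])
    fix x l' assume x: "x \<in> carrier_mat ?n 1" "Q * x = x" "l < l'" "weight_vec \<rho> l' x"
    obtain k where k: "K < k" "l' = int k - int N" using weights[OF x(3)] by blast
    have "x = W k * (Q * x)" using W3[OF x(1), of k] x(2,4) k(2) by simp
    also have "\<dots> = W k * Q * x" by (rule assoc_mult_mat[OF W Q(1) x(1), symmetric])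
    also have "\<dots> = 0\<^sub>m ?n 1" unfolding Kmax[OF k(1)] using x(1) by simp
    finally show "x = 0\<^sub>m ?n 1" .
  qed

  let ?\<rho>' = "transpose_rep \<rho>"
  note \<rho>' = alg_rep_transpose[OF \<rho>]
  let ?Q' = "transpose_mat Q" and ?v' = "transpose_mat w"
  have Q': "?Q' \<in> carrier_mat ?n ?n" and v': "?v' \<in> carrier_mat ?n 1" using Q w by auto
  note comm' = transpose_rep_commute[OF \<rho> Q(1) comm]
  have Qv': "?Q' * ?v' = ?v'" unfolding transpose_mult[OF w Q(1), symmetric] wQ ..
  have torus': "?\<rho>' (torus t) = transpose_mat (\<rho> (torus t))" for t
    by (simp add: transpose_rep_def mat22_transpose)
  have wtv': "weight_vec ?\<rho>' l ?v'"
    unfolding weight_vec_def torus'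
  proof (intro allI impI)
    fix t :: complex assume t: "t \<noteq> 0"
    show "transpose_mat (\<rho> (torus t)) * ?v' = (t powi l) \<cdot>\<^sub>m ?v'"
      unfolding transpose_mult[OF w CT[OF t], symmetric] wtw[OF t] transpose_smult_mat ..
  qed
  have upv': "?\<rho>' (upper s) * ?v' = ?v'" for s
  proof (rule unipotent_fixes_maximal_weight[OF \<rho>'(1), unfolded \<rho>'(2), OF Q' comm' v' Qv' wtv'])
    fix x l' assume x: "x \<in> carrier_mat ?n 1" "?Q' * x = x" "l < l'" "weight_vec ?\<rho>' l' x"
    obtain k where k: "K < k" "l' = int k - int N" using weights[OF x(3)] by blast
    let ?y = "transpose_mat x"
    have y: "?y \<in> carrier_mat 1 ?n" using x by auto
    have "?y * Q = ?y" using transpose_mult[OF Q' x(1)] unfolding x(2) by simp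
    moreover have "?y * W k = ?y"
    proof (rule W4[OF y])
      fix t :: complex assume t: "t \<noteq> 0"
      have "transpose_mat (\<rho> (torus t)) * x = t powi l' \<cdot>\<^sub>m x"
        using x(4) t unfolding weight_vec_def torus' by blast
      then have "transpose_mat (transpose_mat (\<rho> (torus t)) * x) = t powi l' \<cdot>\<^sub>m ?y"
        by (simp add: transpose_smult_mat)
      then show "?y * \<rho> (torus t) = t powi (int k - int N) \<cdot>\<^sub>m ?y"
        using transpose_mult[of "transpose_mat (\<rho> (torus t))" ?n ?n x 1] CT[OF t] x(1) k(2) by simp
    qed
    ultimately have "?y = ?y * Q * W k" by simp
    also have "\<dots> = ?y * (W k * Q)" unfolding assoc_mult_mat[OF y Q(1) W] QW ..
    also have "\<dots> = 0\<^sub>m 1 ?n" unfolding Kmax[OF k(1)] using y by simp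
    finally have "transpose_mat ?y = 0\<^sub>m ?n 1" by simp
    then show "x = 0\<^sub>m ?n 1" by simp
  qed
  show ?thesis by (rule that[OF v w wv Qv wQ wtv upv wtv' upv'])
qed

text \<open>The product \<open>upper t * lower s\<close> has upper left entry \<open>1 + t s\<close>, so the pairing of the two orbits is \<open>(1 + t s)\<^sup>m\<close>.
Its binomial expansion exhibits the product of the two orbit maps as a diagonal matrix.\<close>

lemma orbit_pairing:
  assumes \<rho>: "alg_rep \<rho>" and v: "v \<in> carrier_mat (rep_dim \<rho>) 1" and w: "w \<in> carrier_mat 1 (rep_dim \<rho>)"
    and wv: "w * v = 1\<^sub>m 1" and wtv: "weight_vec \<rho> (int m) v" and upv: "\<And>s. \<rho> (upper s) * v = v"
    and w_low: "\<And>s. w * \<rho> (lower s) = w"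
    and A: "A \<in> carrier_mat (rep_dim \<rho>) (Suc m)" "\<And>s. \<rho> (lower s) * v = A * power_col m 1 s"
    and D: "D \<in> carrier_mat (Suc m) (rep_dim \<rho>)"
    and w_up: "\<And>t. w * \<rho> (upper t) = transpose_mat (power_col m 1 t) * D"
  shows "D * A = mat (Suc m) (Suc m) (\<lambda>(i, j). if i = j then of_nat (m choose i) else 0)"
proof -
  note C = alg_rep_carrier[OF \<rho>]
  have U: "upper s \<in> carrier SL2" and L: "lower s \<in> carrier SL2" for s by simp_all
  define \<Delta> :: "complex mat" where "\<Delta> = mat (Suc m) (Suc m) (\<lambda>(i, j). if i = j then of_nat (m choose i) else 0)"
  have \<Delta>: "\<Delta> \<in> carrier_mat (Suc m) (Suc m)" by (simp add: \<Delta>_def)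
  have DA_carr: "D * A \<in> carrier_mat (Suc m) (Suc m)" using D A(1) by auto
  have hT: "transpose_mat (power_col m 1 t) \<in> carrier_mat 1 (Suc m)" for t by simp
  have row: "transpose_mat (power_col m 1 t) * (D * A) = transpose_mat (power_col m 1 t) * \<Delta>" for t
  proof -
    \<comment> \<open>outside of this set \<open>upper t * lower s\<close> lies in the big cell\<close>
    let ?Z = "{s. 1 + t * s = 0}"
    have "s = - 1 / t" if "1 + t * s = 0" for s
    proof -
      have "t \<noteq> 0" using that by auto
      moreover have "t * s = - 1" using that by (simp add: add_eq_0_iff)
      ultimately show ?thesis by (simp add: field_simps)
    qed
    then have "?Z \<subseteq> {- 1 / t}" by auto
    then have inf: "infinite (- ?Z)" by (intro infinite_cofinite) (auto intro: finite_subset)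
    show ?thesis
    proof (rule power_col_separating[OF _ _ inf])
      show "transpose_mat (power_col m 1 t) * (D * A) \<in> carrier_mat 1 (Suc m)" using hT DA_carr by (rule mult_carrier_mat)
      show H\<Delta>: "transpose_mat (power_col m 1 t) * \<Delta> \<in> carrier_mat 1 (Suc m)" using hT \<Delta> by (rule mult_carrier_mat)
      fix s assume "s \<in> - ?Z"
      then have s: "1 + t * s \<noteq> 0" by simp
      have "transpose_mat (power_col m 1 t) * (D * A) * power_col m 1 s = transpose_mat (power_col m 1 t) * (D * A * power_col m 1 s)"
        by (rule assoc_mult_mat[OF hT DA_carr power_col_carrier(1)])
      also have "D * A * power_col m 1 s = D * (A * power_col m 1 s)"
        by (rule assoc_mult_mat[OF D A(1) power_col_carrier(1)])
      also have "transpose_mat (power_col m 1 t) * (D * (A * power_col m 1 s)) = transpose_mat (power_col m 1 t) * D * (A * power_col m 1 s)"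
        by (rule assoc_mult_mat[OF hT D mult_carrier_mat[OF A(1) power_col_carrier(1)], symmetric])
      also have "\<dots> = w * \<rho> (upper t) * (\<rho> (lower s) * v)" by (simp only: w_up A(2))
      also have "\<dots> = w * (\<rho> (upper t) * \<rho> (lower s) * v)"
        unfolding assoc_mult_mat[OF C[OF U] C[OF L] v]
        by (rule assoc_mult_mat[OF w C[OF U] mult_carrier_mat[OF C[OF L] v]])
      also have "\<rho> (upper t) * \<rho> (lower s) = \<rho> (mat22 (1 + t * s) t s 1)"
        unfolding alg_rep_mult[OF \<rho> U L, symmetric] by (simp add: mat22_mult)
      also have "\<rho> (mat22 (1 + t * s) t s 1) * v = ((1 + t * s) powi int m) \<cdot>\<^sub>m (\<rho> (lower (s / (1 + t * s))) * v)"
        using s by (intro orbit_formula[OF \<rho> v wtv upv]) auto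
      also have "w * \<dots> = ((1 + t * s) powi int m) \<cdot>\<^sub>m (w * (\<rho> (lower (s / (1 + t * s))) * v))"
        by (rule mult_smult_distrib[OF w mult_carrier_mat[OF C[OF L] v]])
      also have "w * (\<rho> (lower (s / (1 + t * s))) * v) = 1\<^sub>m 1"
        unfolding assoc_mult_mat[OF w C[OF L] v, symmetric] w_low wv ..
      finally have lhs: "transpose_mat (power_col m 1 t) * (D * A) * power_col m 1 s = ((1 + t * s) ^ m) \<cdot>\<^sub>m 1\<^sub>m 1"
        by simp
      have ent: "(transpose_mat (power_col m 1 t) * \<Delta>) $$ (0, k) = of_nat (m choose k) * t ^ k" if "k \<le> m" for k
      proof -
        have "(transpose_mat (power_col m 1 t) * \<Delta>) $$ (0, k) = (\<Sum>i<Suc m. if i = k then t ^ i * of_nat (m choose i) else 0)"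
        proof -
          have "(transpose_mat (power_col m 1 t) * \<Delta>) $$ (0, k) = (\<Sum>i<Suc m. t ^ i * (if i = k then of_nat (m choose i) else 0))"
            using that by (simp add: power_col_def \<Delta>_def scalar_prod_def atLeast0LessThan del: sum.lessThan_Suc sum.delta sum.delta')
          also have "\<dots> = (\<Sum>i<Suc m. if i = k then t ^ i * of_nat (m choose i) else 0)"
            by (intro sum.cong) auto
          finally show ?thesis .
        qed
        then show ?thesis using that by simp
      qed
      have "(transpose_mat (power_col m 1 t) * \<Delta> * power_col m 1 s) $$ (0, 0) = (\<Sum>k\<le>m. of_nat (m choose k) * (t * s) ^ k)"
        using mult_power_col_index[OF H\<Delta>, of 0 1 s] by (simp add: ent power_mult_distrib mult.assoc cong: sum.cong_simp)
      also have "\<dots> = (1 + t * s) ^ m" using binomial_ring[of "t * s" 1 m] by (simp add: add.commute)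
      finally have "(transpose_mat (power_col m 1 t) * \<Delta> * power_col m 1 s) $$ (0, 0) = (1 + t * s) ^ m" .
      then show "transpose_mat (power_col m 1 t) * (D * A) * power_col m 1 s = transpose_mat (power_col m 1 t) * \<Delta> * power_col m 1 s"
        unfolding lhs using H\<Delta> by (intro eq_matI) (auto simp: power_col_def simp del: assoc_mult_mat index_mult_mat(1))
    qed
  qed
  have "transpose_mat (D * A) = transpose_mat \<Delta>"
  proof (rule power_col_separating[of _ "Suc m" m _ UNIV])
    fix t
    show "transpose_mat (D * A) * power_col m 1 t = transpose_mat \<Delta> * power_col m 1 t"
      using row[of t] transpose_mult[OF hT[of t] DA_carr] transpose_mult[OF hT[of t] \<Delta>] by simp
  qed (use DA_carr \<Delta> in \<open>auto simp: infinite_UNIV_char_0\<close>)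
  then show ?thesis unfolding \<Delta>_def[symmetric] by (metis transpose_transpose)
qed

lemma diagonal_mult:
  fixes a b :: "nat \<Rightarrow> complex"
  shows "mat k k (\<lambda>(i, j). if i = j then a i else 0) * mat k k (\<lambda>(i, j). if i = j then b i else 0)
    = mat k k (\<lambda>(i, j). if i = j then a i * b i else 0)"
proof (rule eq_matI)
  fix i j assume "i < dim_row (mat k k (\<lambda>(i, j). if i = j then a i * b i else 0))"
    "j < dim_col (mat k k (\<lambda>(i, j). if i = j then a i * b i else 0))"
  then have ij: "i < k" "j < k" by auto
  have "(mat k k (\<lambda>(i, j). if i = j then a i else 0) * mat k k (\<lambda>(i, j). if i = j then b i else 0)) $$ (i, j)
    = (\<Sum>p<k. (if i = p then a i else 0) * (if p = j then b p else 0))"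
    using ij by (simp add: scalar_prod_def atLeast0LessThan del: if_split)
  also have "\<dots> = (\<Sum>p<k. if p = i then (if i = j then a i * b i else 0) else 0)"
    by (intro sum.cong) auto
  finally show "(mat k k (\<lambda>(i, j). if i = j then a i else 0) * mat k k (\<lambda>(i, j). if i = j then b i else 0)) $$ (i, j)
    = mat k k (\<lambda>(i, j). if i = j then a i * b i else 0) $$ (i, j)" using ij by simp
qed auto

text \<open>The orbit map \<open>A\<close> of a highest weight vector embeds a symmetric power into the image of \<open>Q\<close>, and the orbit map \<open>D\<close> of
a highest linear form projects onto its dual.  As \<open>D A\<close> is an invertible diagonal matrix, rescaling \<open>D\<close> gives a left
inverse \<open>B\<close> of \<open>A\<close>.  A priori \<open>D\<close> intertwines \<open>\<rho>\<close> with the action \<open>S'\<close> on the dual; comparing \<open>D \<rho> A\<close> computed from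
both sides shows that the rescaling by \<open>E\<close> turns \<open>S'\<close> into the symmetric power itself.\<close>

lemma highest_weight_summand:
  assumes \<rho>: "alg_rep \<rho>" and Q: "Q \<in> carrier_mat (rep_dim \<rho>) (rep_dim \<rho>)" "Q * Q = Q"
    "Q \<noteq> 0\<^sub>m (rep_dim \<rho>) (rep_dim \<rho>)"
    and comm: "\<And>g. g \<in> carrier SL2 \<Longrightarrow> Q * \<rho> g = \<rho> g * Q"
  obtains m A B where "A \<in> carrier_mat (rep_dim \<rho>) (Suc m)" "B \<in> carrier_mat (Suc m) (rep_dim \<rho>)"
    "B * A = 1\<^sub>m (Suc m)" "Q * A = A" "B * Q = B"
    "\<And>g. g \<in> carrier SL2 \<Longrightarrow> \<rho> g * A = A * sym_rep m g"
    "\<And>g. g \<in> carrier SL2 \<Longrightarrow> B * \<rho> g = sym_rep m g * B"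
proof -
  let ?n = "rep_dim \<rho>"
  note C = alg_rep_carrier[OF \<rho>]
  have U: "upper s \<in> carrier SL2" and L: "lower s \<in> carrier SL2" for s by simp_all
  obtain l v w where v: "v \<in> carrier_mat ?n 1" and w: "w \<in> carrier_mat 1 ?n" and wv: "w * v = 1\<^sub>m 1"
    and Qv: "Q * v = v" and wQ: "w * Q = w" and wtv: "weight_vec \<rho> l v" and upv: "\<And>s. \<rho> (upper s) * v = v"
    and wtv': "weight_vec (transpose_rep \<rho>) l (transpose_mat w)"
    and upv': "\<And>s. transpose_rep \<rho> (upper s) * transpose_mat w = transpose_mat w"
  proof (rule maximal_weight_pair[OF \<rho> Q comm], goal_cases)
    case (2 v w l)
    show ?case by (rule that[OF 2(2-)])
  qed
  have v0: "v \<noteq> 0\<^sub>m ?n 1"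
  proof
    assume "v = 0\<^sub>m ?n 1"
    then have "(w * v) $$ (0, 0) = 0" using w by simp
    then show False unfolding wv by simp
  qed
  obtain m A where l: "l = int m" and A: "A \<in> carrier_mat ?n (Suc m)"
    "\<And>g. g \<in> carrier SL2 \<Longrightarrow> \<rho> g * A = A * sym_rep m g"
    "\<And>s. \<rho> (lower s) * v = A * power_col m 1 s"
    using highest_weight_orbit[OF \<rho> v v0 wtv upv] by blast
  have QA: "Q * A = A" by (rule orbit_map_absorbs[OF \<rho> Q(1) comm v Qv A(1,3)])

  let ?\<rho>' = "transpose_rep \<rho>"
  note \<rho>' = alg_rep_transpose[OF \<rho>]
  let ?Q' = "transpose_mat Q" and ?v' = "transpose_mat w"
  have Q': "?Q' \<in> carrier_mat ?n ?n" and v': "?v' \<in> carrier_mat ?n 1" using Q w by auto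
  note comm' = transpose_rep_commute[OF \<rho> Q(1) comm]
  have Qv': "?Q' * ?v' = ?v'" unfolding transpose_mult[OF w Q(1), symmetric] wQ ..
  have v0': "?v' \<noteq> 0\<^sub>m ?n 1"
  proof
    assume "?v' = 0\<^sub>m ?n 1"
    then have "transpose_mat ?v' = 0\<^sub>m 1 ?n" by simp
    then have "(w * v) $$ (0, 0) = 0" using v by simp
    then show False unfolding wv by simp
  qed
  obtain m' A' where l': "l = int m'" and A': "A' \<in> carrier_mat ?n (Suc m')"
    "\<And>g. g \<in> carrier SL2 \<Longrightarrow> ?\<rho>' g * A' = A' * sym_rep m' g"
    "\<And>s. ?\<rho>' (lower s) * ?v' = A' * power_col m' 1 s"
    by (rule highest_weight_orbit[OF \<rho>'(1), unfolded \<rho>'(2), OF v' v0' wtv' upv']) (rule that)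
  have "m' = m" using l l' by simp
  note A' = A'[unfolded this]
  have QA': "?Q' * A' = A'"
    by (rule orbit_map_absorbs[OF \<rho>'(1), unfolded \<rho>'(2), OF Q' comm' v' Qv' A'(1,3)])
  define D where "D = transpose_mat A'"
  have D: "D \<in> carrier_mat (Suc m) ?n" unfolding D_def using A' by auto
  have DQ: "D * Q = D" using transpose_mult[OF Q' A'(1)] unfolding QA' by (simp add: D_def)
  define S' where "S' g = transpose_mat (sym_rep m (transpose_mat g))" for g
  have S': "S' g \<in> carrier_mat (Suc m) (Suc m)" for g by (simp add: S'_def)
  have D\<rho>: "D * \<rho> g = S' g * D" if g: "g \<in> carrier SL2" for g
  proof -
    note gT = SL2_transpose[OF g]
    have "?\<rho>' (transpose_mat g) = transpose_mat (\<rho> g)" by (simp add: transpose_rep_def)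
    moreover have "transpose_mat (?\<rho>' (transpose_mat g) * A') = transpose_mat (A' * sym_rep m (transpose_mat g))"
      unfolding A'(2)[OF gT] ..
    ultimately show ?thesis
      using transpose_mult[of "transpose_mat (\<rho> g)" ?n ?n A' "Suc m"] C[OF g] A'(1)
        transpose_mult[OF A'(1) sym_rep_carrier] by (simp add: D_def S'_def)
  qed
  have w_up: "w * \<rho> (upper t) = transpose_mat (power_col m 1 t) * D" for t
  proof -
    have "?\<rho>' (lower t) = transpose_mat (\<rho> (upper t))" by (simp add: transpose_rep_def mat22_transpose)
    moreover have "transpose_mat (?\<rho>' (lower t) * ?v') = transpose_mat (A' * power_col m 1 t)" unfolding A'(3) ..
    ultimately show ?thesis
      using transpose_mult[OF w C[OF U[of t]]] transpose_mult[OF A'(1) power_col_carrier(1)]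
      by (metis D_def transpose_transpose)
  qed
  have w_low: "w * \<rho> (lower s) = w" for s
  proof -
    have "?\<rho>' (upper s) = transpose_mat (\<rho> (lower s))" by (simp add: transpose_rep_def mat22_transpose)
    then have "transpose_mat (w * \<rho> (lower s)) = transpose_mat w"
      using upv'[of s] transpose_mult[OF w C[OF L[of s]]] by simp
    then show ?thesis by (metis transpose_transpose)
  qed
  define \<Delta> :: "complex mat" where "\<Delta> = mat (Suc m) (Suc m) (\<lambda>(i, j). if i = j then of_nat (m choose i) else 0)"
  have \<Delta>: "\<Delta> \<in> carrier_mat (Suc m) (Suc m)" by (simp add: \<Delta>_def)
  have DA: "D * A = \<Delta>"
    unfolding \<Delta>_def by (rule orbit_pairing[OF \<rho> v w wv wtv[unfolded l] upv w_low A(1,3) D w_up])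
  define E :: "complex mat" where "E = mat (Suc m) (Suc m) (\<lambda>(i, j). if i = j then 1 / of_nat (m choose i) else 0)"
  have E: "E \<in> carrier_mat (Suc m) (Suc m)" by (simp add: E_def)
  have E\<Delta>: "E * \<Delta> = 1\<^sub>m (Suc m)" and \<Delta>E: "\<Delta> * E = 1\<^sub>m (Suc m)"
    unfolding E_def \<Delta>_def diagonal_mult by (intro eq_matI; auto)+
  define B where "B = E * D"
  have B: "B \<in> carrier_mat (Suc m) ?n" unfolding B_def using E D by auto
  have BA: "B * A = 1\<^sub>m (Suc m)" unfolding B_def assoc_mult_mat[OF E D A(1)] DA E\<Delta> ..
  have BQ: "B * Q = B" unfolding B_def assoc_mult_mat[OF E D Q(1)] DQ ..
  have B\<rho>: "B * \<rho> g = sym_rep m g * B" if g: "g \<in> carrier SL2" for g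
  proof -
    let ?S = "sym_rep m g"
    have S: "?S \<in> carrier_mat (Suc m) (Suc m)" by simp
    have "S' g * \<Delta> = S' g * D * A" unfolding DA[symmetric] assoc_mult_mat[OF S' D A(1)] ..
    also have "\<dots> = D * (\<rho> g * A)" unfolding D\<rho>[OF g, symmetric] assoc_mult_mat[OF D C[OF g] A(1)] ..
    also have "\<dots> = \<Delta> * ?S" unfolding A(2)[OF g] assoc_mult_mat[OF D A(1) S, symmetric] DA ..
    finally have S\<Delta>: "S' g * \<Delta> = \<Delta> * ?S" .
    have "E * S' g = E * (S' g * (\<Delta> * E))" unfolding \<Delta>E right_mult_one_mat[OF S'] ..
    also have "\<dots> = E * (S' g * \<Delta> * E)" unfolding assoc_mult_mat[OF S' \<Delta> E] ..
    also have "\<dots> = (E * \<Delta>) * (?S * E)"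
      unfolding S\<Delta> assoc_mult_mat[OF \<Delta> S E] by (rule assoc_mult_mat[OF E \<Delta> mult_carrier_mat[OF S E], symmetric])
    also have "\<dots> = ?S * E" unfolding E\<Delta> by (rule left_mult_one_mat[OF mult_carrier_mat[OF S E]])
    finally have ES: "E * S' g = ?S * E" .
    have "B * \<rho> g = E * (S' g * D)" unfolding B_def assoc_mult_mat[OF E D C[OF g]] D\<rho>[OF g] ..
    also have "\<dots> = ?S * B" unfolding assoc_mult_mat[OF E S' D, symmetric] ES B_def assoc_mult_mat[OF S E D] ..
    finally show ?thesis .
  qed
  show ?thesis by (rule that[OF A(1) B BA QA BQ A(2) B\<rho>])
qed

section \<open>Direct sums and complete reducibility\<close>

definition dsum :: "rep \<Rightarrow> rep \<Rightarrow> rep" where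
  "dsum \<rho> \<sigma> g = four_block_mat (\<rho> g) (0\<^sub>m (dim_row (\<rho> g)) (dim_col (\<sigma> g)))
     (0\<^sub>m (dim_row (\<sigma> g)) (dim_col (\<rho> g))) (\<sigma> g)"

lemma direct_sum_Cons: "direct_sum (\<tau> # \<tau>s) = dsum \<tau> (direct_sum \<tau>s)"
  by (simp add: direct_sum_def dsum_def fun_eq_iff Let_def)

lemma direct_sum_Nil: "direct_sum [] = (\<lambda>g. 0\<^sub>m 0 0)"
  by (simp add: direct_sum_def)

lemma dsum_eq:
  assumes "\<rho> g \<in> carrier_mat n n" "\<sigma> g \<in> carrier_mat k k"
  shows "dsum \<rho> \<sigma> g = four_block_mat (\<rho> g) (0\<^sub>m n k) (0\<^sub>m k n) (\<sigma> g)"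
  using assms by (simp add: dsum_def)

lemma alg_rep_dsum:
  assumes \<rho>: "alg_rep \<rho>" and \<sigma>: "alg_rep \<sigma>"
  shows "alg_rep (dsum \<rho> \<sigma>)" "rep_dim (dsum \<rho> \<sigma>) = rep_dim \<rho> + rep_dim \<sigma>"
proof -
  let ?n = "rep_dim \<rho>" and ?k = "rep_dim \<sigma>"
  note C = alg_rep_carrier[OF \<rho>] and D = alg_rep_carrier[OF \<sigma>]
  have e: "dsum \<rho> \<sigma> g = four_block_mat (\<rho> g) (0\<^sub>m ?n ?k) (0\<^sub>m ?k ?n) (\<sigma> g)" if "g \<in> carrier SL2" for g
    by (rule dsum_eq[of \<rho> g _ \<sigma> _, OF C[OF that] D[OF that]])
  have 1: "dsum \<rho> \<sigma> g \<in> carrier_mat (?n + ?k) (?n + ?k)" if "g \<in> carrier SL2" for g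
    unfolding e[OF that] using C[OF that] D[OF that] by auto
  have 2: "dsum \<rho> \<sigma> (g * h) = dsum \<rho> \<sigma> g * dsum \<rho> \<sigma> h" if g: "g \<in> carrier SL2" and h: "h \<in> carrier SL2" for g h
    unfolding e[OF g] e[OF h] e[OF SL2_mult[OF g h]] alg_rep_mult[OF \<rho> g h] alg_rep_mult[OF \<sigma> g h]
    by (subst mult_four_block_mat[OF C[OF g] zero_carrier_mat zero_carrier_mat D[OF g] C[OF h] zero_carrier_mat zero_carrier_mat D[OF h]])
      (use C[OF g] C[OF h] D[OF g] D[OF h] in simp)
  have 3: "dsum \<rho> \<sigma> (1\<^sub>m 2) = 1\<^sub>m (?n + ?k)"
    unfolding e[OF SL2_one] alg_rep_one[OF \<rho>] alg_rep_one[OF \<sigma>] by simp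
  have 4: "\<exists>p. regular_fun p \<and> (\<forall>g \<in> carrier SL2. dsum \<rho> \<sigma> g $$ (i, j) = p g)"
    if ij: "i < ?n + ?k" "j < ?n + ?k" for i j
  proof -
    have ent: "dsum \<rho> \<sigma> g $$ (i, j) = (if i < ?n then if j < ?n then \<rho> g $$ (i, j) else 0
        else if j < ?n then 0 else \<sigma> g $$ (i - ?n, j - ?n))" if "g \<in> carrier SL2" for g
      unfolding e[OF that] using C[OF that] D[OF that] ij by auto
    consider "i < ?n" "j < ?n" | "i < ?n" "\<not> j < ?n" | "\<not> i < ?n" "j < ?n" | "\<not> i < ?n" "\<not> j < ?n" by blast
    then show ?thesis
    proof cases
      case 1
      then show ?thesis using alg_rep_entry[OF \<rho> 1] ent by (metis (no_types, lifting))
    next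
      case 4
      then have "i - ?n < ?k" "j - ?n < ?k" using ij by auto
      then show ?thesis using alg_rep_entry[OF \<sigma>, of "i - ?n" "j - ?n"] ent 4 by (metis (no_types, lifting))
    qed (use ent regular_fun.const[of 0] in auto)
  qed
  show "alg_rep (dsum \<rho> \<sigma>)" by (rule alg_repI[OF 1 2 3 4])
  show "rep_dim (dsum \<rho> \<sigma>) = ?n + ?k" by (rule alg_repI[OF 1 2 3 4])
qed

lemma alg_rep_direct_sum:
  assumes "\<And>\<tau>. \<tau> \<in> set \<tau>s \<Longrightarrow> alg_rep \<tau>"
  shows "alg_rep (direct_sum \<tau>s) \<and> rep_dim (direct_sum \<tau>s) = sum_list (map rep_dim \<tau>s)"
  using assms
proof (induction \<tau>s)
  case Nil
  have "alg_rep (\<lambda>g. 0\<^sub>m 0 0)" by (rule alg_repI(1)[where n = 0]) auto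
  then show ?case by (simp add: direct_sum_Nil rep_dim_def)
next
  case (Cons \<tau> \<tau>s)
  then show ?case using alg_rep_dsum[of \<tau> "direct_sum \<tau>s"] by (auto simp: direct_sum_Cons)
qed

text \<open>Embeddings together with an equivariant left inverse.  In contrast to mere injectivity, this notion is
visibly compatible with direct sums.\<close>

definition summand_via :: "rep \<Rightarrow> rep \<Rightarrow> complex mat \<Rightarrow> complex mat \<Rightarrow> bool" where
  "summand_via \<rho> \<sigma> T T' \<longleftrightarrow> equivariant \<rho> \<sigma> T \<and> equivariant \<sigma> \<rho> T' \<and> T' * T = 1\<^sub>m (rep_dim \<rho>)"

definition summand :: "rep \<Rightarrow> rep \<Rightarrow> bool" where
  "summand \<rho> \<sigma> \<longleftrightarrow> (\<exists>T T'. summand_via \<rho> \<sigma> T T')"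

definition rep_equiv :: "rep \<Rightarrow> rep \<Rightarrow> bool" where
  "rep_equiv \<rho> \<sigma> \<longleftrightarrow> (\<exists>T T'. summand_via \<rho> \<sigma> T T' \<and> summand_via \<sigma> \<rho> T' T)"

lemma rep_equiv_sym: "rep_equiv \<rho> \<sigma> \<Longrightarrow> rep_equiv \<sigma> \<rho>"
  unfolding rep_equiv_def by blast

lemma rep_equiv_summand: "rep_equiv \<rho> \<sigma> \<Longrightarrow> summand \<rho> \<sigma>"
  unfolding rep_equiv_def summand_def by blast

lemma equivariant_comp:
  assumes \<rho>: "alg_rep \<rho>" and \<sigma>: "alg_rep \<sigma>" and \<tau>: "alg_rep \<tau>" and T: "equivariant \<rho> \<sigma> T" and S: "equivariant \<sigma> \<tau> S"
  shows "equivariant \<rho> \<tau> (S * T)"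
proof -
  have Tc: "T \<in> carrier_mat (rep_dim \<sigma>) (rep_dim \<rho>)" and Sc: "S \<in> carrier_mat (rep_dim \<tau>) (rep_dim \<sigma>)"
    using T S by (auto simp: equivariant_def)
  have "S * T * \<rho> g = \<tau> g * (S * T)" if g: "g \<in> carrier SL2" for g
  proof -
    have "S * T * \<rho> g = S * (\<sigma> g * T)"
      unfolding assoc_mult_mat[OF Sc Tc alg_rep_carrier[OF \<rho> g]] using T g by (simp add: equivariant_def)
    also have "\<dots> = \<tau> g * S * T"
      unfolding assoc_mult_mat[OF Sc alg_rep_carrier[OF \<sigma> g] Tc, symmetric] using S g by (simp add: equivariant_def)
    finally show ?thesis unfolding assoc_mult_mat[OF alg_rep_carrier[OF \<tau> g] Sc Tc] .
  qed
  then show ?thesis using Tc Sc by (auto simp: equivariant_def)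
qed

lemma rep_equiv_refl: "alg_rep \<rho> \<Longrightarrow> rep_equiv \<rho> \<rho>"
  unfolding rep_equiv_def summand_via_def equivariant_def
  by (intro exI[of _ "1\<^sub>m (rep_dim \<rho>)"] conjI ballI)
    (simp_all add: left_mult_one_mat[OF alg_rep_carrier] right_mult_one_mat[OF alg_rep_carrier])

lemma summand_refl: "alg_rep \<rho> \<Longrightarrow> summand \<rho> \<rho>"
  by (rule rep_equiv_summand[OF rep_equiv_refl])

lemma summand_trans:
  assumes \<rho>: "alg_rep \<rho>" and \<sigma>: "alg_rep \<sigma>" and \<tau>: "alg_rep \<tau>" and "summand \<rho> \<sigma>" "summand \<sigma> \<tau>"
  shows "summand \<rho> \<tau>"
proof -
  obtain T T' S S' where T: "equivariant \<rho> \<sigma> T" "equivariant \<sigma> \<rho> T'" "T' * T = 1\<^sub>m (rep_dim \<rho>)"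
    and S: "equivariant \<sigma> \<tau> S" "equivariant \<tau> \<sigma> S'" "S' * S = 1\<^sub>m (rep_dim \<sigma>)"
    using assms(4,5) unfolding summand_def summand_via_def by blast
  have c: "T \<in> carrier_mat (rep_dim \<sigma>) (rep_dim \<rho>)" "T' \<in> carrier_mat (rep_dim \<rho>) (rep_dim \<sigma>)"
    "S \<in> carrier_mat (rep_dim \<tau>) (rep_dim \<sigma>)" "S' \<in> carrier_mat (rep_dim \<sigma>) (rep_dim \<tau>)"
    using T S by (auto simp: equivariant_def)
  have "T' * S' * (S * T) = T' * (S' * (S * T))"
    by (rule assoc_mult_mat[OF c(2,4) mult_carrier_mat[OF c(3,1)]])
  also have "S' * (S * T) = S' * S * T" by (rule assoc_mult_mat[OF c(4,3,1), symmetric])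
  finally have "T' * S' * (S * T) = 1\<^sub>m (rep_dim \<rho>)" using c T(3) S(3) by simp
  then show ?thesis
    unfolding summand_def summand_via_def
    using equivariant_comp[OF \<rho> \<sigma> \<tau> T(1) S(1)] equivariant_comp[OF \<tau> \<sigma> \<rho> S(2) T(2)] by blast
qed

lemma equivariant_dsum:
  assumes \<rho>: "alg_rep \<rho>" and \<sigma>: "alg_rep \<sigma>" and \<rho>': "alg_rep \<rho>'" and \<sigma>': "alg_rep \<sigma>'"
    and T: "equivariant \<rho> \<rho>' T" and S: "equivariant \<sigma> \<sigma>' S"
  shows "equivariant (dsum \<rho> \<sigma>) (dsum \<rho>' \<sigma>')
    (four_block_mat T (0\<^sub>m (rep_dim \<rho>') (rep_dim \<sigma>)) (0\<^sub>m (rep_dim \<sigma>') (rep_dim \<rho>)) S)"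
proof -
  have Tc: "T \<in> carrier_mat (rep_dim \<rho>') (rep_dim \<rho>)" and Sc: "S \<in> carrier_mat (rep_dim \<sigma>') (rep_dim \<sigma>)"
    using T S by (auto simp: equivariant_def)
  have eq: "T * \<rho> g = \<rho>' g * T" "S * \<sigma> g = \<sigma>' g * S" if "g \<in> carrier SL2" for g
    using T S that by (auto simp: equivariant_def)
  show ?thesis
    unfolding equivariant_def alg_rep_dsum(2)[OF \<rho> \<sigma>] alg_rep_dsum(2)[OF \<rho>' \<sigma>']
  proof (intro conjI ballI)
    show "four_block_mat T (0\<^sub>m (rep_dim \<rho>') (rep_dim \<sigma>)) (0\<^sub>m (rep_dim \<sigma>') (rep_dim \<rho>)) S
      \<in> carrier_mat (rep_dim \<rho>' + rep_dim \<sigma>') (rep_dim \<rho> + rep_dim \<sigma>)" using Tc Sc by auto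
    fix g assume g: "g \<in> carrier SL2"
    note C = alg_rep_carrier[OF \<rho> g] alg_rep_carrier[OF \<sigma> g] alg_rep_carrier[OF \<rho>' g] alg_rep_carrier[OF \<sigma>' g]
    show "four_block_mat T (0\<^sub>m (rep_dim \<rho>') (rep_dim \<sigma>)) (0\<^sub>m (rep_dim \<sigma>') (rep_dim \<rho>)) S * dsum \<rho> \<sigma> g
      = dsum \<rho>' \<sigma>' g * four_block_mat T (0\<^sub>m (rep_dim \<rho>') (rep_dim \<sigma>)) (0\<^sub>m (rep_dim \<sigma>') (rep_dim \<rho>)) S"
      unfolding dsum_eq[of \<rho> g _ \<sigma> _, OF C(1,2)] dsum_eq[of \<rho>' g _ \<sigma>' _, OF C(3,4)]
      by (subst mult_four_block_mat[OF Tc zero_carrier_mat zero_carrier_mat Sc C(1) zero_carrier_mat zero_carrier_mat C(2)],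
          subst mult_four_block_mat[OF C(3) zero_carrier_mat zero_carrier_mat C(4) Tc zero_carrier_mat zero_carrier_mat Sc])
        (use C Tc Sc eq[OF g] in simp)
  qed
qed

lemma summand_dsum:
  assumes \<rho>: "alg_rep \<rho>" and \<sigma>: "alg_rep \<sigma>" and \<rho>': "alg_rep \<rho>'" and \<sigma>': "alg_rep \<sigma>'"
    and "summand \<rho> \<rho>'" "summand \<sigma> \<sigma>'"
  shows "summand (dsum \<rho> \<sigma>) (dsum \<rho>' \<sigma>')"
proof -
  obtain T T' S S' where T: "equivariant \<rho> \<rho>' T" "equivariant \<rho>' \<rho> T'" "T' * T = 1\<^sub>m (rep_dim \<rho>)"
    and S: "equivariant \<sigma> \<sigma>' S" "equivariant \<sigma>' \<sigma> S'" "S' * S = 1\<^sub>m (rep_dim \<sigma>)"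
    using assms(5,6) unfolding summand_def summand_via_def by blast
  have c: "T \<in> carrier_mat (rep_dim \<rho>') (rep_dim \<rho>)" "T' \<in> carrier_mat (rep_dim \<rho>) (rep_dim \<rho>')"
    "S \<in> carrier_mat (rep_dim \<sigma>') (rep_dim \<sigma>)" "S' \<in> carrier_mat (rep_dim \<sigma>) (rep_dim \<sigma>')"
    using T S by (auto simp: equivariant_def)
  have "four_block_mat T' (0\<^sub>m (rep_dim \<rho>) (rep_dim \<sigma>')) (0\<^sub>m (rep_dim \<sigma>) (rep_dim \<rho>')) S'
      * four_block_mat T (0\<^sub>m (rep_dim \<rho>') (rep_dim \<sigma>)) (0\<^sub>m (rep_dim \<sigma>') (rep_dim \<rho>)) S = 1\<^sub>m (rep_dim \<rho> + rep_dim \<sigma>)"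
    by (subst mult_four_block_mat[OF c(2) zero_carrier_mat zero_carrier_mat c(4) c(1) zero_carrier_mat zero_carrier_mat c(3)])
      (use c T(3) S(3) in simp)
  then show ?thesis
    unfolding summand_def summand_via_def alg_rep_dsum(2)[OF \<rho> \<sigma>]
    using equivariant_dsum[OF \<rho> \<sigma> \<rho>' \<sigma>' T(1) S(1)] equivariant_dsum[OF \<rho>' \<sigma>' \<rho> \<sigma> T(2) S(2)] by blast
qed

lemma mult_mat_vec_0: "(A :: complex mat) \<in> carrier_mat r n \<Longrightarrow> A *\<^sub>v 0\<^sub>v n = 0\<^sub>v r"
  by (intro eq_vecI) auto

text \<open>If there were more columns than rows, completing by zero rows would give a singular square matrix with
trivial kernel.\<close>

lemma injective_dim_le:
  fixes T :: "complex mat"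
  assumes T: "T \<in> carrier_mat n r" and inj: "\<And>x. x \<in> carrier_vec r \<Longrightarrow> T *\<^sub>v x = 0\<^sub>v n \<Longrightarrow> x = 0\<^sub>v r"
  shows "r \<le> n"
proof (rule ccontr)
  assume "\<not> r \<le> n"
  then have nr: "n < r" by simp
  define S where "S = mat r r (\<lambda>(i, j). if i < n then T $$ (i, j) else 0)"
  have S: "S \<in> carrier_mat r r" by (simp add: S_def)
  have "det S = 0" unfolding laplace_expansion_row[OF S nr] using nr by (simp add: S_def)
  then obtain x where x: "x \<in> carrier_vec r" "x \<noteq> 0\<^sub>v r" "S *\<^sub>v x = 0\<^sub>v r"
    using det_0_iff_vec_prod_zero[OF S] by blast
  have "T *\<^sub>v x = 0\<^sub>v n"
  proof (rule eq_vecI)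
    fix i assume i: "i < dim_vec (0\<^sub>v n :: complex vec)"
    have "(S *\<^sub>v x) $ i = 0" unfolding x(3) using i nr by simp
    moreover have "row S i = row T i" using i nr T by (intro eq_vecI) (auto simp: S_def)
    ultimately show "(T *\<^sub>v x) $ i = 0\<^sub>v n $ i" using i nr T S by simp
  qed (use T in auto)
  then show False using inj x by blast
qed

lemma left_inverse_dim_le:
  fixes T :: "complex mat"
  assumes T: "T \<in> carrier_mat n r" "T' \<in> carrier_mat r n" "T' * T = 1\<^sub>m r"
  shows "r \<le> n"
proof (rule injective_dim_le[OF T(1)])
  fix x assume x: "x \<in> carrier_vec r" "T *\<^sub>v x = 0\<^sub>v n"
  have "x = (T' * T) *\<^sub>v x" unfolding T(3) using x(1) by simp
  also have "\<dots> = T' *\<^sub>v (T *\<^sub>v x)" by (rule assoc_mult_mat_vec[OF T(2,1) x(1)])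
  also have "\<dots> = 0\<^sub>v r" unfolding x(2) by (rule mult_mat_vec_0[OF T(2)])
  finally show "x = 0\<^sub>v r" .
qed

abbreviation sym_sum :: "nat list \<Rightarrow> rep" where
  "sym_sum ms \<equiv> direct_sum (map sym_rep ms)"

lemma sym_sum_alg: "alg_rep (sym_sum ms)" "rep_dim (sym_sum ms) = sum_list (map Suc ms)"
proof -
  have "alg_rep (sym_sum ms) \<and> rep_dim (sym_sum ms) = sum_list (map rep_dim (map sym_rep ms))"
    by (rule alg_rep_direct_sum) (auto simp: sym_rep_alg)
  moreover have "map rep_dim (map sym_rep ms) = map Suc ms" by (simp add: sym_rep_alg o_def)
  ultimately show "alg_rep (sym_sum ms)" "rep_dim (sym_sum ms) = sum_list (map Suc ms)"
    by (simp_all only: simp_thms)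
qed

lemma sym_sum_Cons: "sym_sum (m # ms) = dsum (sym_rep m) (sym_sum ms)"
  by (simp add: direct_sum_Cons)

lemma summand_empty:
  assumes \<rho>: "alg_rep \<rho>"
  shows "summand (sym_sum []) \<rho>"
proof -
  let ?n = "rep_dim \<rho>"
  have d: "rep_dim (\<lambda>g. 0\<^sub>m 0 0) = 0" by (simp add: rep_dim_def)
  have "equivariant (sym_sum []) \<rho> (0\<^sub>m ?n 0)" "equivariant \<rho> (sym_sum []) (0\<^sub>m 0 ?n)"
    using right_mult_zero_mat[OF alg_rep_carrier[OF \<rho>]] left_mult_zero_mat[OF alg_rep_carrier[OF \<rho>]]
      left_mult_zero_mat[of "0\<^sub>m 0 0" 0 0 ?n] left_mult_zero_mat[of "0\<^sub>m 0 ?n" 0 ?n 0]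
    by (auto simp: equivariant_def direct_sum_Nil d)
  moreover have "0\<^sub>m 0 ?n * 0\<^sub>m ?n 0 = (1\<^sub>m (rep_dim (sym_sum [])) :: complex mat)"
    by (intro eq_matI) (auto simp: direct_sum_Nil d)
  ultimately show ?thesis unfolding summand_def summand_via_def by blast
qed

lemma mult_row_block:
  fixes X :: "complex mat"
  assumes "X \<in> carrier_mat n n" "A \<in> carrier_mat n a" "T \<in> carrier_mat n r"
  shows "X * four_block_mat A T (0\<^sub>m 0 a) (0\<^sub>m 0 r) = four_block_mat (X * A) (X * T) (0\<^sub>m 0 a) (0\<^sub>m 0 r)"
  using assms by (intro eq_matI) (auto simp: scalar_prod_def intro!: sum.cong)

lemma mult_col_block:
  fixes X :: "complex mat"
  assumes "X \<in> carrier_mat n n" "B \<in> carrier_mat a n" "T \<in> carrier_mat r n"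
  shows "four_block_mat B (0\<^sub>m a 0) T (0\<^sub>m r 0) * X = four_block_mat (B * X) (0\<^sub>m a 0) (T * X) (0\<^sub>m r 0)"
  using assms by (intro eq_matI) (auto simp: scalar_prod_def intro!: sum.cong)

text \<open>A summand that is not everything leaves the nonzero invariant complement \<open>Q = 1 - T T'\<close>.  A symmetric power
split off from the image of \<open>Q\<close> is automatically complementary to the given summand, since \<open>Q T = 0\<close> and \<open>T' Q = 0\<close>.\<close>

lemma summand_extend:
  assumes \<rho>: "alg_rep \<rho>" and \<sigma>: "alg_rep \<sigma>" and via: "summand_via \<sigma> \<rho> T T'"
    and lt: "T * T' \<noteq> 1\<^sub>m (rep_dim \<rho>)"
  shows "\<exists>m. summand (dsum (sym_rep m) \<sigma>) \<rho>"
proof -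
  let ?n = "rep_dim \<rho>" and ?r = "rep_dim \<sigma>"
  note C = alg_rep_carrier[OF \<rho>] and D = alg_rep_carrier[OF \<sigma>]
  have T: "T \<in> carrier_mat ?n ?r" and T': "T' \<in> carrier_mat ?r ?n" and TT: "T' * T = 1\<^sub>m ?r"
    and eT: "\<And>g. g \<in> carrier SL2 \<Longrightarrow> T * \<sigma> g = \<rho> g * T" and eT': "\<And>g. g \<in> carrier SL2 \<Longrightarrow> T' * \<rho> g = \<sigma> g * T'"
    using via by (auto simp: summand_via_def equivariant_def)
  define P where "P = T * T'"
  have P: "P \<in> carrier_mat ?n ?n" unfolding P_def using T T' by auto
  have PT: "P * T = T" unfolding P_def assoc_mult_mat[OF T T' T] TT using T by simp
  have TP: "T' * P = T'" unfolding P_def assoc_mult_mat[OF T' T T', symmetric] TT using T' by simp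
  have PP: "P * P = P" using PT P_def assoc_mult_mat[OF P T T'] by simp
  define Q where "Q = 1\<^sub>m ?n - P"
  have Q: "Q \<in> carrier_mat ?n ?n" unfolding Q_def using P by auto
  have QX: "Q * X = X - P * X" if "X \<in> carrier_mat ?n k" for X k
    unfolding Q_def using P that by (simp add: minus_mult_distrib_mat[OF one_carrier_mat P that])
  have XQ: "X * Q = X - X * P" if "X \<in> carrier_mat k ?n" for X k
    unfolding Q_def using P that by (simp add: mult_minus_distrib_mat[OF that one_carrier_mat P])
  have QQ: "Q * Q = Q"
  proof -
    have "P * Q = 0\<^sub>m ?n ?n" unfolding XQ[OF P] PP using P by simp
    then show ?thesis unfolding QX[OF Q] using Q by (auto simp: minus_r_inv_mat)
  qed
  have Q0: "Q \<noteq> 0\<^sub>m ?n ?n"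
  proof
    assume z: "Q = 0\<^sub>m ?n ?n"
    have "P = 1\<^sub>m ?n"
    proof (rule eq_matI)
      fix i j assume "i < dim_row (1\<^sub>m ?n :: complex mat)" "j < dim_col (1\<^sub>m ?n :: complex mat)"
      then have ij: "i < ?n" "j < ?n" by auto
      have "Q $$ (i, j) = 0" unfolding z using ij by simp
      then show "P $$ (i, j) = 1\<^sub>m ?n $$ (i, j)" unfolding Q_def using ij P by simp
    qed (use P in auto)
    then show False using lt by (simp add: P_def)
  qed
  have comm: "Q * \<rho> g = \<rho> g * Q" if g: "g \<in> carrier SL2" for g
  proof -
    have "P * \<rho> g = T * (T' * \<rho> g)" unfolding P_def by (rule assoc_mult_mat[OF T T' C[OF g]])
    also have "\<dots> = T * \<sigma> g * T'" unfolding eT'[OF g] by (rule assoc_mult_mat[OF T D[OF g] T', symmetric])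
    also have "\<dots> = \<rho> g * P" unfolding eT[OF g] P_def by (rule assoc_mult_mat[OF C[OF g] T T'])
    finally show ?thesis unfolding QX[OF C[OF g]] XQ[OF C[OF g]] by simp
  qed
  obtain m A B where A: "A \<in> carrier_mat ?n (Suc m)" and B: "B \<in> carrier_mat (Suc m) ?n"
    and BA: "B * A = 1\<^sub>m (Suc m)" and QA: "Q * A = A" and BQ: "B * Q = B"
    and eA: "\<And>g. g \<in> carrier SL2 \<Longrightarrow> \<rho> g * A = A * sym_rep m g"
    and eB: "\<And>g. g \<in> carrier SL2 \<Longrightarrow> B * \<rho> g = sym_rep m g * B"
  proof (rule highest_weight_summand[OF \<rho> Q QQ Q0 comm], goal_cases)
    case (2 A m B)
    show ?case by (rule that[OF 2(2-8)])
  qed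
  have QT: "Q * T = 0\<^sub>m ?n ?r" unfolding QX[OF T] PT using T by (auto simp: minus_r_inv_mat)
  have TQ: "T' * Q = 0\<^sub>m ?r ?n" unfolding XQ[OF T'] TP using T' by (auto simp: minus_r_inv_mat)
  have BT: "B * T = 0\<^sub>m (Suc m) ?r"
    using assoc_mult_mat[OF B Q T] unfolding BQ QT using B by simp
  have TA: "T' * A = 0\<^sub>m ?r (Suc m)"
    using assoc_mult_mat[OF T' Q A] unfolding TQ QA using A by simp
  let ?S = "four_block_mat A T (0\<^sub>m 0 (Suc m)) (0\<^sub>m 0 ?r)"
  let ?S' = "four_block_mat B (0\<^sub>m (Suc m) 0) T' (0\<^sub>m ?r 0)"
  have S: "?S \<in> carrier_mat ?n (Suc m + ?r)" and S': "?S' \<in> carrier_mat (Suc m + ?r) ?n"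
    using A T B T' by auto
  have "?S' * ?S = 1\<^sub>m (Suc m + ?r)"
    by (subst mult_four_block_mat[OF B zero_carrier_mat T' zero_carrier_mat A T zero_carrier_mat zero_carrier_mat])
      (use A B T T' BA BT TA TT in simp)
  moreover have "?S * dsum (sym_rep m) \<sigma> g = \<rho> g * ?S" if g: "g \<in> carrier SL2" for g
  proof -
    have M: "sym_rep m g \<in> carrier_mat (Suc m) (Suc m)" by simp
    show ?thesis
      unfolding dsum_eq[of "sym_rep m" g _ \<sigma> _, OF M D[OF g]] mult_row_block[OF C[OF g] A T]
      by (subst mult_four_block_mat[OF A T zero_carrier_mat zero_carrier_mat M zero_carrier_mat zero_carrier_mat D[OF g]])
        (use A T D[OF g] C[OF g] left_mult_zero_mat[OF M] eA[OF g] eT[OF g] in simp)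
  qed
  moreover have "?S' * \<rho> g = dsum (sym_rep m) \<sigma> g * ?S'" if g: "g \<in> carrier SL2" for g
  proof -
    have M: "sym_rep m g \<in> carrier_mat (Suc m) (Suc m)" by simp
    show ?thesis
      unfolding dsum_eq[of "sym_rep m" g _ \<sigma> _, OF M D[OF g]] mult_col_block[OF C[OF g] B T']
      by (subst mult_four_block_mat[OF M zero_carrier_mat zero_carrier_mat D[OF g] B zero_carrier_mat T' zero_carrier_mat])
        (use B T' D[OF g] C[OF g] right_mult_zero_mat[OF M] right_add_zero_mat[OF mult_carrier_mat[OF M B]] eB[OF g] eT'[OF g] in simp)
  qed
  ultimately have "summand_via (dsum (sym_rep m) \<sigma>) \<rho> ?S ?S'"
    using S S' unfolding summand_via_def equivariant_def alg_rep_dsum(2)[OF sym_rep_alg(1) \<sigma>] sym_rep_alg(2)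
    by simp
  then show ?thesis unfolding summand_def by blast
qed

text \<open>The summand is enlarged until it is everything; the dimension bounds the number of steps.\<close>

theorem complete_reducibility:
  assumes \<rho>: "alg_rep \<rho>"
  shows "\<exists>ms. rep_equiv (sym_sum ms) \<rho>"
proof -
  let ?n = "rep_dim \<rho>"
  have "\<exists>ms'. rep_equiv (sym_sum ms') \<rho>" if "summand (sym_sum ms) \<rho>" for ms
    using that
  proof (induction "?n - rep_dim (sym_sum ms)" arbitrary: ms rule: less_induct)
    case less
    obtain T T' where via: "summand_via (sym_sum ms) \<rho> T T'" using less.prems by (auto simp: summand_def)
    show ?case
    proof (cases "T * T' = 1\<^sub>m ?n")
      case True
      then show ?thesis using via unfolding rep_equiv_def summand_via_def by blast
    next
      case False
      obtain m where m: "summand (sym_sum (m # ms)) \<rho>"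
        using summand_extend[OF \<rho> sym_sum_alg(1) via False] unfolding sym_sum_Cons by blast
      then have "rep_dim (sym_sum (m # ms)) \<le> ?n"
        unfolding summand_def summand_via_def equivariant_def using left_inverse_dim_le by blast
      then have "?n - rep_dim (sym_sum (m # ms)) < ?n - rep_dim (sym_sum ms)"
        unfolding sym_sum_alg(2) by simp
      then show ?thesis using less.hyps m by blast
    qed
  qed
  moreover have "summand (sym_sum []) \<rho>" by (rule summand_empty[OF \<rho>])
  ultimately show ?thesis by blast
qed

section \<open>Embeddings and highest weight vectors\<close>

lemma invariant_subspaceI:
  assumes "W \<subseteq> carrier_vec (rep_dim \<rho>)" "0\<^sub>v (rep_dim \<rho>) \<in> W"
    "\<And>x y. x \<in> W \<Longrightarrow> y \<in> W \<Longrightarrow> x + y \<in> W" "\<And>c x. x \<in> W \<Longrightarrow> c \<cdot>\<^sub>v x \<in> W"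
    "\<And>g x. g \<in> carrier SL2 \<Longrightarrow> x \<in> W \<Longrightarrow> \<rho> g *\<^sub>v x \<in> W"
  shows "invariant_subspace \<rho> W"
  unfolding invariant_subspace_def VectorSpace.subspace_def submodule_def
  using assms vec_vs[of "rep_dim \<rho>"] vec_module[of "rep_dim \<rho>"]
  by (auto simp: module_vec_simps)

lemma invariant_subspaceD:
  assumes "invariant_subspace \<rho> W"
  shows "W \<subseteq> carrier_vec (rep_dim \<rho>)" "0\<^sub>v (rep_dim \<rho>) \<in> W"
    "\<And>x y. x \<in> W \<Longrightarrow> y \<in> W \<Longrightarrow> x + y \<in> W" "\<And>c x. x \<in> W \<Longrightarrow> c \<cdot>\<^sub>v x \<in> W"
    "\<And>g x. g \<in> carrier SL2 \<Longrightarrow> x \<in> W \<Longrightarrow> \<rho> g *\<^sub>v x \<in> W"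
  using assms unfolding invariant_subspace_def VectorSpace.subspace_def submodule_def
  by (auto simp: module_vec_simps)

lemma range_invariant:
  assumes \<rho>: "alg_rep \<rho>" and \<sigma>: "alg_rep \<sigma>" and T: "equivariant \<rho> \<sigma> T"
  shows "invariant_subspace \<sigma> ((*\<^sub>v) T ` carrier_vec (rep_dim \<rho>))"
proof -
  have Tc: "T \<in> carrier_mat (rep_dim \<sigma>) (rep_dim \<rho>)" using T by (simp add: equivariant_def)
  show ?thesis
  proof (rule invariant_subspaceI)
    show "(*\<^sub>v) T ` carrier_vec (rep_dim \<rho>) \<subseteq> carrier_vec (rep_dim \<sigma>)" using Tc by auto
    have "T *\<^sub>v 0\<^sub>v (rep_dim \<rho>) = 0\<^sub>v (rep_dim \<sigma>)" by (rule mult_mat_vec_0[OF Tc])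
    then show "0\<^sub>v (rep_dim \<sigma>) \<in> (*\<^sub>v) T ` carrier_vec (rep_dim \<rho>)" by (metis imageI zero_carrier_vec)
  next
    fix x y assume "x \<in> (*\<^sub>v) T ` carrier_vec (rep_dim \<rho>)" "y \<in> (*\<^sub>v) T ` carrier_vec (rep_dim \<rho>)"
    then obtain a b where "a \<in> carrier_vec (rep_dim \<rho>)" "b \<in> carrier_vec (rep_dim \<rho>)" "x = T *\<^sub>v a" "y = T *\<^sub>v b" by blast
    then show "x + y \<in> (*\<^sub>v) T ` carrier_vec (rep_dim \<rho>)"
      using mult_add_distrib_mat_vec[OF Tc, of a b] by (metis add_carrier_vec imageI)
  next
    fix c x assume "x \<in> (*\<^sub>v) T ` carrier_vec (rep_dim \<rho>)"
    then obtain a where "a \<in> carrier_vec (rep_dim \<rho>)" "x = T *\<^sub>v a" by blast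
    then show "c \<cdot>\<^sub>v x \<in> (*\<^sub>v) T ` carrier_vec (rep_dim \<rho>)"
      using mult_mat_vec[OF Tc, of a c] by (metis smult_carrier_vec imageI)
  next
    fix g x assume g: "g \<in> carrier SL2" and "x \<in> (*\<^sub>v) T ` carrier_vec (rep_dim \<rho>)"
    then obtain a where a: "a \<in> carrier_vec (rep_dim \<rho>)" "x = T *\<^sub>v a" by blast
    note C = alg_rep_carrier[OF \<rho> g] alg_rep_carrier[OF \<sigma> g]
    have "\<sigma> g *\<^sub>v x = (\<sigma> g * T) *\<^sub>v a" unfolding a(2) by (rule assoc_mult_mat_vec[OF C(2) Tc a(1), symmetric])
    also have "\<sigma> g * T = T * \<rho> g" using T g by (simp add: equivariant_def)
    also have "(T * \<rho> g) *\<^sub>v a = T *\<^sub>v (\<rho> g *\<^sub>v a)" by (rule assoc_mult_mat_vec[OF Tc C(1) a(1)])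
    finally show "\<sigma> g *\<^sub>v x \<in> (*\<^sub>v) T ` carrier_vec (rep_dim \<rho>)" using C(1) a(1) by (metis imageI mult_mat_vec_carrier)
  qed
qed

lemma summand_embeds:
  assumes \<rho>: "alg_rep \<rho>" and \<sigma>: "alg_rep \<sigma>" and "summand \<rho> \<sigma>"
  shows "embeds \<rho> \<sigma>"
proof -
  obtain T T' where T: "equivariant \<rho> \<sigma> T" "equivariant \<sigma> \<rho> T'" "T' * T = 1\<^sub>m (rep_dim \<rho>)"
    using assms(3) unfolding summand_def summand_via_def by blast
  have c: "T \<in> carrier_mat (rep_dim \<sigma>) (rep_dim \<rho>)" "T' \<in> carrier_mat (rep_dim \<rho>) (rep_dim \<sigma>)"
    using T by (auto simp: equivariant_def)
  have "x = T' *\<^sub>v (T *\<^sub>v x)" if "x \<in> carrier_vec (rep_dim \<rho>)" for x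
    using assoc_mult_mat_vec[OF c(2,1) that] that unfolding T(3) by simp
  then have "inj_on ((*\<^sub>v) T) (carrier_vec (rep_dim \<rho>))" by (metis inj_onI)
  then show ?thesis
    unfolding embeds_def using range_invariant[OF \<rho> \<sigma> T(1)] T(1) by (blast intro: inj_on_imp_bij_betw)
qed

text \<open>Equivariant maps with trivial kernel.  They compose, so an embedding can be transported to decompositions of
its source and target.\<close>

definition injective_equivariant :: "rep \<Rightarrow> rep \<Rightarrow> bool" where
  "injective_equivariant \<rho> \<sigma> \<longleftrightarrow> (\<exists>T. equivariant \<rho> \<sigma> T \<and>
     (\<forall>x \<in> carrier_vec (rep_dim \<rho>). T *\<^sub>v x = 0\<^sub>v (rep_dim \<sigma>) \<longrightarrow> x = 0\<^sub>v (rep_dim \<rho>)))"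

lemma embeds_injective_equivariant:
  assumes "embeds \<rho> \<sigma>" shows "injective_equivariant \<rho> \<sigma>"
proof -
  obtain W T where T: "equivariant \<rho> \<sigma> T" "bij_betw ((*\<^sub>v) T) (carrier_vec (rep_dim \<rho>)) W"
    using assms unfolding embeds_def by blast
  have c: "T \<in> carrier_mat (rep_dim \<sigma>) (rep_dim \<rho>)" using T by (simp add: equivariant_def)
  have z: "T *\<^sub>v 0\<^sub>v (rep_dim \<rho>) = 0\<^sub>v (rep_dim \<sigma>)" by (rule mult_mat_vec_0[OF c])
  have "x = 0\<^sub>v (rep_dim \<rho>)" if "x \<in> carrier_vec (rep_dim \<rho>)" "T *\<^sub>v x = 0\<^sub>v (rep_dim \<sigma>)" for x
    using bij_betw_imp_inj_on[OF T(2)] that z by (metis inj_onD zero_carrier_vec)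
  then show ?thesis using T(1) unfolding injective_equivariant_def by blast
qed

lemma injective_equivariant_comp:
  assumes \<rho>: "alg_rep \<rho>" and \<sigma>: "alg_rep \<sigma>" and \<tau>: "alg_rep \<tau>"
    and "injective_equivariant \<rho> \<sigma>" "injective_equivariant \<sigma> \<tau>"
  shows "injective_equivariant \<rho> \<tau>"
proof -
  obtain T S where T: "equivariant \<rho> \<sigma> T" "\<forall>x \<in> carrier_vec (rep_dim \<rho>). T *\<^sub>v x = 0\<^sub>v (rep_dim \<sigma>) \<longrightarrow> x = 0\<^sub>v (rep_dim \<rho>)"
    and S: "equivariant \<sigma> \<tau> S" "\<forall>x \<in> carrier_vec (rep_dim \<sigma>). S *\<^sub>v x = 0\<^sub>v (rep_dim \<tau>) \<longrightarrow> x = 0\<^sub>v (rep_dim \<sigma>)"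
    using assms(4,5) unfolding injective_equivariant_def by blast
  have c: "T \<in> carrier_mat (rep_dim \<sigma>) (rep_dim \<rho>)" "S \<in> carrier_mat (rep_dim \<tau>) (rep_dim \<sigma>)"
    using T S by (auto simp: equivariant_def)
  have "x = 0\<^sub>v (rep_dim \<rho>)" if x: "x \<in> carrier_vec (rep_dim \<rho>)" "(S * T) *\<^sub>v x = 0\<^sub>v (rep_dim \<tau>)" for x
  proof -
    have "S *\<^sub>v (T *\<^sub>v x) = 0\<^sub>v (rep_dim \<tau>)" using x assoc_mult_mat_vec[OF c(2,1) x(1)] by simp
    then have "T *\<^sub>v x = 0\<^sub>v (rep_dim \<sigma>)" using S(2) c(1) x(1) by (metis mult_mat_vec_carrier)
    then show ?thesis using T(2) x(1) by blast
  qed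
  then show ?thesis using equivariant_comp[OF \<rho> \<sigma> \<tau> T(1) S(1)] unfolding injective_equivariant_def by blast
qed

lemma summand_injective_equivariant:
  assumes "alg_rep \<rho>" "alg_rep \<sigma>" "summand \<rho> \<sigma>"
  shows "injective_equivariant \<rho> \<sigma>"
  using embeds_injective_equivariant[OF summand_embeds[OF assms]] .

text \<open>Vectors of weight \<open>m\<close> fixed by the upper unipotent group.  Equivariant maps preserve them, and they form a space
whose dimension is the multiplicity of the \<open>m\<close>-th symmetric power.\<close>

definition highest_weight_vec :: "rep \<Rightarrow> nat \<Rightarrow> complex vec \<Rightarrow> bool" where
  "highest_weight_vec \<rho> m x \<longleftrightarrow> (\<forall>s. \<rho> (upper s) *\<^sub>v x = x) \<and>
     (\<forall>t. t \<noteq> 0 \<longrightarrow> \<rho> (torus t) *\<^sub>v x = (t ^ m) \<cdot>\<^sub>v x)"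

lemma equivariant_highest_weight_vec:
  assumes \<rho>: "alg_rep \<rho>" and \<sigma>: "alg_rep \<sigma>" and T: "equivariant \<rho> \<sigma> T"
    and x: "x \<in> carrier_vec (rep_dim \<rho>)" "highest_weight_vec \<rho> m x"
  shows "highest_weight_vec \<sigma> m (T *\<^sub>v x)"
proof -
  have Tc: "T \<in> carrier_mat (rep_dim \<sigma>) (rep_dim \<rho>)" using T by (simp add: equivariant_def)
  have e: "\<sigma> g *\<^sub>v (T *\<^sub>v x) = T *\<^sub>v (\<rho> g *\<^sub>v x)" if g: "g \<in> carrier SL2" for g
  proof -
    note C = alg_rep_carrier[OF \<rho> g] alg_rep_carrier[OF \<sigma> g]
    have "\<sigma> g *\<^sub>v (T *\<^sub>v x) = (\<sigma> g * T) *\<^sub>v x" by (rule assoc_mult_mat_vec[OF C(2) Tc x(1), symmetric])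
    also have "\<sigma> g * T = T * \<rho> g" using T g by (simp add: equivariant_def)
    finally show ?thesis using assoc_mult_mat_vec[OF Tc C(1) x(1)] by simp
  qed
  show ?thesis
    unfolding highest_weight_vec_def
  proof (intro conjI allI impI)
    fix s show "\<sigma> (upper s) *\<^sub>v (T *\<^sub>v x) = T *\<^sub>v x"
      using e[of "upper s"] x(2) by (simp add: highest_weight_vec_def)
  next
    fix t :: complex assume "t \<noteq> 0"
    then show "\<sigma> (torus t) *\<^sub>v (T *\<^sub>v x) = t ^ m \<cdot>\<^sub>v (T *\<^sub>v x)"
      using e[of "torus t"] x mult_mat_vec[OF Tc x(1)] by (simp add: highest_weight_vec_def)
  qed
qed

lemma sym_rep_torus:
  assumes "i \<le> k" "j \<le> k"
  shows "sym_rep k (torus t) $$ (i, j) = (if i = j then t ^ (k - i) * (1 / t) ^ i else 0)"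
proof -
  have "[:t, 0:] ^ (k - i) * [:0, 1 / t:] ^ i = monom (t ^ (k - i) * (1 / t) ^ i) i"
  proof -
    have 1: "[:t, 0:] = monom t 0" and 2: "[:0, 1 / t:] = monom (1 / t) 1" by (simp_all add: monom_altdef)
    show ?thesis unfolding 1 2 monom_power mult_monom by simp
  qed
  then show ?thesis using assms by (simp add: sym_rep_def)
qed

lemma sym_rep_upper:
  assumes "i \<le> k" "j \<le> k"
  shows "sym_rep k (upper s) $$ (i, j) = (if j < i then 0 else of_nat ((k - i) choose (j - i)) * s ^ (j - i))"
proof -
  have "[:0, 1:] ^ i = monom (1 :: complex) i" by (simp add: monom_altdef)
  then have e: "sym_rep k (upper s) $$ (i, j) = coeff (monom 1 i * [:1, s:] ^ (k - i)) j"
    using assms by (simp add: sym_rep_def mult.commute)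
  show ?thesis
    unfolding e coeff_monom_mult using assms by (auto simp: coeff_linear_poly_power)
qed

lemma sym_rep_lower_0:
  assumes "i \<le> k"
  shows "sym_rep k (lower 1) $$ (i, 0) = 1"
  using assms by (simp add: sym_rep_def coeff_mult coeff_0_power)

text \<open>Only the first coordinate matters: the first entry of \<open>upper s\<close> applied to \<open>x\<close> is a polynomial in \<open>s\<close> with
coefficients \<open>binomial(k, j) x\<^sub>j\<close>, and it is constant only if all other coordinates vanish.  The weight of the
first basis vector is \<open>k\<close>.\<close>

lemma sym_rep_highest_weight_vec:
  assumes x: "x \<in> carrier_vec (Suc k)"
  shows "highest_weight_vec (sym_rep k) m x \<longleftrightarrow> (\<forall>i<Suc k. i \<notin> (if k = m then {0} else {}) \<longrightarrow> x $ i = 0)"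
proof
  assume hw: "highest_weight_vec (sym_rep k) m x"
  have row: "(\<Sum>j<Suc k. sym_rep k g $$ (i, j) * x $ j) = (sym_rep k g *\<^sub>v x) $ i" if "i < Suc k" for g i
    using that x by (simp add: scalar_prod_def atLeast0LessThan sym_rep_def)
  have up: "(\<Sum>j<Suc k. of_nat (k choose j) * s ^ j * x $ j) = x $ 0" for s
    using row[of 0 "upper s"] hw by (simp add: highest_weight_vec_def sym_rep_upper cong: sum.cong_simp)
  have A: "x $ j = 0" if j: "0 < j" "j < Suc k" for j
  proof -
    have "(\<Sum>j<Suc k. monom (of_nat (k choose j) * x $ j) j) = [:x $ 0:]"
      using up by (intro poly_eq_on_infinite[of UNIV]) (simp_all add: poly_sum poly_monom infinite_UNIV_char_0 mult_ac)
    then have "coeff (\<Sum>j<Suc k. monom (of_nat (k choose j) * x $ j) j) j = coeff [:x $ 0:] j" by simp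
    also have "coeff (\<Sum>j<Suc k. monom (of_nat (k choose j) * x $ j) j) j = of_nat (k choose j) * x $ j"
      using j by (simp add: coeff_sum del: sum.lessThan_Suc)
    finally show ?thesis using j by (cases j) simp_all
  qed
  have B: "x $ 0 = 0" if "k \<noteq> m"
  proof -
    have "(\<Sum>j<Suc k. (if j = 0 then 2 ^ k * x $ j else 0)) = (\<Sum>j<Suc k. sym_rep k (torus 2) $$ (0, j) * x $ j)"
      by (intro sum.cong) (auto simp: sym_rep_torus)
    also have "\<dots> = (2 ^ m \<cdot>\<^sub>v x) $ 0"
      unfolding row[OF zero_less_Suc] using hw by (simp add: highest_weight_vec_def)
    finally have "(\<Sum>j<Suc k. (if j = 0 then 2 ^ k * x $ j else 0)) = 2 ^ m * x $ 0" using x by simp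
    then have "2 ^ k * x $ 0 = 2 ^ m * x $ 0" by (simp del: sum.lessThan_Suc)
    moreover have "(2 :: complex) ^ k \<noteq> 2 ^ m"
    proof
      assume "(2 :: complex) ^ k = 2 ^ m"
      then have "of_nat (2 ^ k) = (of_nat (2 ^ m) :: complex)" by simp
      then have "(2 :: nat) ^ k = 2 ^ m" by (simp only: of_nat_eq_iff)
      then show False using that by simp
    qed
    ultimately show ?thesis by simp
  qed
  show "\<forall>i<Suc k. i \<notin> (if k = m then {0} else {}) \<longrightarrow> x $ i = 0"
  proof (intro allI impI)
    fix i assume "i < Suc k" "i \<notin> (if k = m then {0} else {})"
    then show "x $ i = 0" using A[of i] B by (cases "i = 0") (auto split: if_splits)
  qed
next
  assume supp: "\<forall>i<Suc k. i \<notin> (if k = m then {0} else {}) \<longrightarrow> x $ i = 0"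
  then have x0: "x $ i = 0" if "0 < i" "i < Suc k" for i using that by auto
  have x00: "x $ 0 = 0" if "k \<noteq> m" using supp that by auto
  have col: "(sym_rep k g *\<^sub>v x) $ i = sym_rep k g $$ (i, 0) * x $ 0" if "i < Suc k" for g i
  proof -
    have "(sym_rep k g *\<^sub>v x) $ i = (\<Sum>j<Suc k. sym_rep k g $$ (i, j) * x $ j)"
      using that x by (simp add: scalar_prod_def atLeast0LessThan sym_rep_def)
    also have "\<dots> = (\<Sum>j<Suc k. if j = 0 then sym_rep k g $$ (i, 0) * x $ 0 else 0)"
      using x0 by (intro sum.cong) auto
    finally show ?thesis by (simp del: sum.lessThan_Suc)
  qed
  show "highest_weight_vec (sym_rep k) m x"
    unfolding highest_weight_vec_def
  proof (intro conjI allI impI)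
    fix s show "sym_rep k (upper s) *\<^sub>v x = x"
    proof (rule eq_vecI)
      fix i assume "i < dim_vec x"
      then have i: "i < Suc k" using x by simp
      show "(sym_rep k (upper s) *\<^sub>v x) $ i = x $ i"
        unfolding col[OF i] using i x0[of i] by (cases i) (simp_all add: sym_rep_upper)
    qed (use x in \<open>simp add: sym_rep_def\<close>)
  next
    fix t :: complex assume t: "t \<noteq> 0"
    show "sym_rep k (torus t) *\<^sub>v x = t ^ m \<cdot>\<^sub>v x"
    proof (rule eq_vecI)
      fix i assume "i < dim_vec (t ^ m \<cdot>\<^sub>v x)"
      then have i: "i < Suc k" using x by simp
      show "(sym_rep k (torus t) *\<^sub>v x) $ i = (t ^ m \<cdot>\<^sub>v x) $ i"
        unfolding col[OF i] using i x x0[of i] x00 by (cases i; cases "k = m") (simp_all add: sym_rep_torus)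
    qed (use x in \<open>simp add: sym_rep_def\<close>)
  qed
qed

text \<open>The positions of the first basis vectors of those blocks that are \<open>m\<close>-th symmetric powers.\<close>

fun hw_indices :: "nat \<Rightarrow> nat list \<Rightarrow> nat set" where
  "hw_indices m [] = {}"
| "hw_indices m (k # ks) = (if k = m then {0} else {}) \<union> (\<lambda>i. i + Suc k) ` hw_indices m ks"

lemma hw_indices_bound: "hw_indices m ms \<subseteq> {..<sum_list (map Suc ms)}"
  by (induction ms) auto

lemma card_hw_indices: "finite (hw_indices m ms) \<and> card (hw_indices m ms) = count (mset ms) m"
proof (induction ms)
  case Nil
  then show ?case by simp
next
  case (Cons k ks)
  have "card ((\<lambda>i. i + Suc k) ` hw_indices m ks) = card (hw_indices m ks)"
    by (intro card_image) (auto simp: inj_on_def)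
  moreover have "0 \<notin> (\<lambda>i. i + Suc k) ` hw_indices m ks" by auto
  ultimately show ?case using Cons by (cases "k = m") auto
qed

lemma dsum_highest_weight_vec:
  assumes \<rho>: "alg_rep \<rho>" and \<sigma>: "alg_rep \<sigma>"
    and a: "a \<in> carrier_vec (rep_dim \<rho>)" and b: "b \<in> carrier_vec (rep_dim \<sigma>)"
  shows "highest_weight_vec (dsum \<rho> \<sigma>) m (a @\<^sub>v b) \<longleftrightarrow> highest_weight_vec \<rho> m a \<and> highest_weight_vec \<sigma> m b"
proof -
  have e: "dsum \<rho> \<sigma> g *\<^sub>v (a @\<^sub>v b) = (\<rho> g *\<^sub>v a) @\<^sub>v (\<sigma> g *\<^sub>v b)" if g: "g \<in> carrier SL2" for g
  proof -
    note C = alg_rep_carrier[OF \<rho> g] alg_rep_carrier[OF \<sigma> g]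
    show ?thesis
      unfolding dsum_eq[of \<rho> g _ \<sigma> _, OF C]
      by (rule mult_mat_vec_split[OF C a b])
  qed
  have s: "c \<cdot>\<^sub>v (a @\<^sub>v b) = (c \<cdot>\<^sub>v a) @\<^sub>v (c \<cdot>\<^sub>v b)" for c by (intro eq_vecI) auto
  have 1: "dsum \<rho> \<sigma> (upper s) *\<^sub>v (a @\<^sub>v b) = a @\<^sub>v b \<longleftrightarrow> \<rho> (upper s) *\<^sub>v a = a \<and> \<sigma> (upper s) *\<^sub>v b = b" for s
    using alg_rep_carrier[OF \<rho>, of "upper s"] a by (subst e) (auto intro!: append_vec_eq)
  have 2: "dsum \<rho> \<sigma> (torus t) *\<^sub>v (a @\<^sub>v b) = t ^ m \<cdot>\<^sub>v (a @\<^sub>v b) \<longleftrightarrow> \<rho> (torus t) *\<^sub>v a = t ^ m \<cdot>\<^sub>v a \<and> \<sigma> (torus t) *\<^sub>v b = t ^ m \<cdot>\<^sub>v b" if "t \<noteq> 0" for t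
    using alg_rep_carrier[OF \<rho>, of "torus t"] a that unfolding s by (subst e) (auto intro!: append_vec_eq)
  show ?thesis unfolding highest_weight_vec_def using 1 2 by blast
qed

lemma sym_sum_highest_weight_vec:
  assumes "x \<in> carrier_vec (rep_dim (sym_sum ms))"
  shows "highest_weight_vec (sym_sum ms) m x \<longleftrightarrow>
    (\<forall>i < rep_dim (sym_sum ms). i \<notin> hw_indices m ms \<longrightarrow> x $ i = 0)"
  using assms
proof (induction ms arbitrary: x)
  case Nil
  have d: "rep_dim (sym_sum []) = 0" using sym_sum_alg(2)[of "[]"] by simp
  then have "x = 0\<^sub>v 0" using Nil by (intro eq_vecI) auto
  moreover have "0\<^sub>m 0 0 *\<^sub>v 0\<^sub>v 0 = (0\<^sub>v 0 :: complex vec)" by (intro eq_vecI) auto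
  moreover have "c \<cdot>\<^sub>v 0\<^sub>v 0 = (0\<^sub>v 0 :: complex vec)" for c by (intro eq_vecI) auto
  ultimately show ?case unfolding d highest_weight_vec_def by (simp add: direct_sum_Nil)
next
  case (Cons k ks)
  let ?r = "rep_dim (sym_sum ks)"
  define a where "a = vec_first x (Suc k)"
  define b where "b = vec_last x ?r"
  have dim: "rep_dim (sym_sum (k # ks)) = Suc k + ?r" unfolding sym_sum_alg(2) by simp
  have x: "x \<in> carrier_vec (Suc k + ?r)" using Cons.prems unfolding dim .
  have a: "a \<in> carrier_vec (Suc k)" and b: "b \<in> carrier_vec ?r" by (auto simp: a_def b_def)
  have xab: "x = a @\<^sub>v b" using x unfolding a_def b_def by simp
  have "highest_weight_vec (sym_sum (k # ks)) m x \<longleftrightarrow>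
      highest_weight_vec (sym_rep k) m a \<and> highest_weight_vec (sym_sum ks) m b"
    unfolding sym_sum_Cons xab using a b
    by (intro dsum_highest_weight_vec sym_rep_alg(1) sym_sum_alg(1)) (simp_all add: sym_rep_alg)
  also have "\<dots> \<longleftrightarrow> (\<forall>i<Suc k. i \<notin> (if k = m then {0} else {}) \<longrightarrow> x $ i = 0)
      \<and> (\<forall>i<?r. i \<notin> hw_indices m ks \<longrightarrow> x $ (i + Suc k) = 0)"
    unfolding sym_rep_highest_weight_vec[OF a] Cons.IH[OF b] xab using a b by (auto simp: add.commute)
  also have "\<dots> \<longleftrightarrow> (\<forall>i < Suc k + ?r. i \<notin> hw_indices m (k # ks) \<longrightarrow> x $ i = 0)"
  proof
    assume L: "(\<forall>i<Suc k. i \<notin> (if k = m then {0} else {}) \<longrightarrow> x $ i = 0)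
      \<and> (\<forall>i<?r. i \<notin> hw_indices m ks \<longrightarrow> x $ (i + Suc k) = 0)"
    show "\<forall>i < Suc k + ?r. i \<notin> hw_indices m (k # ks) \<longrightarrow> x $ i = 0"
    proof (intro allI impI)
      fix i assume i: "i < Suc k + ?r" "i \<notin> hw_indices m (k # ks)"
      show "x $ i = 0"
      proof (cases "i < Suc k")
        case True
        then show ?thesis using L i(2) by auto
      next
        case False
        then obtain j where "i = j + Suc k" by (metis add.commute le_Suc_ex not_less)
        then show ?thesis using L i by auto
      qed
    qed
  next
    assume R: "\<forall>i < Suc k + ?r. i \<notin> hw_indices m (k # ks) \<longrightarrow> x $ i = 0"
    show "(\<forall>i<Suc k. i \<notin> (if k = m then {0} else {}) \<longrightarrow> x $ i = 0)
      \<and> (\<forall>i<?r. i \<notin> hw_indices m ks \<longrightarrow> x $ (i + Suc k) = 0)"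
    proof (intro conjI allI impI)
      fix i assume "i < Suc k" "i \<notin> (if k = m then {0} else {})"
      then have "i < Suc k + ?r" "i \<notin> hw_indices m (k # ks)" by auto
      then show "x $ i = 0" using R by blast
    next
      fix i assume "i < ?r" "i \<notin> hw_indices m ks"
      then have "i + Suc k < Suc k + ?r" "i + Suc k \<notin> hw_indices m (k # ks)" by auto
      then show "x $ (i + Suc k) = 0" using R by blast
    qed
  qed
  finally show ?case unfolding dim .
qed

text \<open>An injective matrix that maps the coordinate subspace of \<open>I\<close> into that of \<open>J\<close> has an injective submatrix with
rows \<open>J\<close> and columns \<open>I\<close>.\<close>

lemma support_card_le:
  fixes T :: "complex mat"
  assumes T: "T \<in> carrier_mat n r" and inj: "\<And>x. x \<in> carrier_vec r \<Longrightarrow> T *\<^sub>v x = 0\<^sub>v n \<Longrightarrow> x = 0\<^sub>v r"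
    and I: "I \<subseteq> {..<r}" and J: "J \<subseteq> {..<n}"
    and supp: "\<And>x i. x \<in> carrier_vec r \<Longrightarrow> (\<And>i. i < r \<Longrightarrow> i \<notin> I \<Longrightarrow> x $ i = 0) \<Longrightarrow> i < n \<Longrightarrow> i \<notin> J \<Longrightarrow> (T *\<^sub>v x) $ i = 0"
  shows "card I \<le> card J"
proof -
  have fin: "finite I" "finite J" using I J finite_subset by blast+
  obtain f where f: "bij_betw f {0..<card I} I" using ex_bij_betw_nat_finite[OF fin(1)] by blast
  obtain h where h: "bij_betw h {0..<card J} J" using ex_bij_betw_nat_finite[OF fin(2)] by blast
  define M where "M = mat (card J) (card I) (\<lambda>(a, b). T $$ (h a, f b))"
  have M: "M \<in> carrier_mat (card J) (card I)" by (simp add: M_def)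
  show ?thesis
  proof (rule injective_dim_le[OF M])
    fix y assume y: "y \<in> carrier_vec (card I)" "M *\<^sub>v y = 0\<^sub>v (card J)"
    define x where "x = vec r (\<lambda>i. if i \<in> I then y $ (inv_into {0..<card I} f i) else 0)"
    have x: "x \<in> carrier_vec r" by (simp add: x_def)
    have fI: "f b \<in> I" if "b < card I" for b using f that by (auto simp: bij_betw_def)
    have xf: "x $ f b = y $ b" if "b < card I" for b
      using that fI[OF that] I bij_betw_inv_into_left[OF f] by (auto simp: x_def)
    have Tx: "(T *\<^sub>v x) $ i = (\<Sum>b<card I. T $$ (i, f b) * y $ b)" if i: "i < n" for i
    proof -
      have "(T *\<^sub>v x) $ i = (\<Sum>j<r. T $$ (i, j) * x $ j)"
        using i T x by (simp add: scalar_prod_def atLeast0LessThan)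
      also have "\<dots> = (\<Sum>j\<in>I. T $$ (i, j) * x $ j)"
        using I by (intro sum.mono_neutral_right) (auto simp: x_def)
      also have "\<dots> = (\<Sum>b\<in>{0..<card I}. T $$ (i, f b) * x $ f b)"
        by (rule sum.reindex_bij_betw[OF f, symmetric])
      also have "\<dots> = (\<Sum>b<card I. T $$ (i, f b) * y $ b)"
        by (intro sum.cong) (auto simp: xf)
      finally show ?thesis .
    qed
    have "T *\<^sub>v x = 0\<^sub>v n"
    proof (rule eq_vecI)
      fix i assume "i < dim_vec (0\<^sub>v n :: complex vec)"
      then have i: "i < n" by simp
      show "(T *\<^sub>v x) $ i = 0\<^sub>v n $ i"
      proof (cases "i \<in> J")
        case True
        then have "i \<in> h ` {0..<card J}" using bij_betw_imp_surj_on[OF h] by simp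
        then obtain a where a: "a < card J" "i = h a" by auto
        have "(M *\<^sub>v y) $ a = (\<Sum>b<card I. T $$ (i, f b) * y $ b)"
          using a y(1) by (simp add: M_def scalar_prod_def atLeast0LessThan)
        then show ?thesis using a i y(2) Tx[OF i] by simp
      next
        case False
        then show ?thesis using supp[OF x _ i False] i by (simp add: x_def)
      qed
    qed (use T in auto)
    then have x0: "x = 0\<^sub>v r" using inj x by blast
    show "y = 0\<^sub>v (card I)"
    proof (rule eq_vecI)
      fix b assume "b < dim_vec (0\<^sub>v (card I) :: complex vec)"
      then have b: "b < card I" by simp
      have "f b < r" using fI[OF b] I by auto
      then show "y $ b = 0\<^sub>v (card I) $ b" using xf[OF b] b x0 by simp
    qed (use y in auto)
  qed
qed

text \<open>In a direct sum of symmetric powers the highest weight vectors of weight \<open>m\<close> form a coordinate subspace with one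
coordinate for every summand of highest weight \<open>m\<close>.\<close>

lemma injective_equivariant_count_le:
  assumes "injective_equivariant (sym_sum ms) (sym_sum ms')"
  shows "count (mset ms) m \<le> count (mset ms') m"
proof -
  obtain T where T: "equivariant (sym_sum ms) (sym_sum ms') T"
    and inj: "\<And>x. x \<in> carrier_vec (rep_dim (sym_sum ms)) \<Longrightarrow> T *\<^sub>v x = 0\<^sub>v (rep_dim (sym_sum ms')) \<Longrightarrow> x = 0\<^sub>v (rep_dim (sym_sum ms))"
    using assms unfolding injective_equivariant_def by blast
  have Tc: "T \<in> carrier_mat (rep_dim (sym_sum ms')) (rep_dim (sym_sum ms))" using T by (simp add: equivariant_def)
  have "card (hw_indices m ms) \<le> card (hw_indices m ms')"
  proof (rule support_card_le[OF Tc inj])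
    fix x :: "complex vec" and i assume x: "x \<in> carrier_vec (rep_dim (sym_sum ms))"
      and s: "\<And>i. i < rep_dim (sym_sum ms) \<Longrightarrow> i \<notin> hw_indices m ms \<Longrightarrow> x $ i = 0"
      and i: "i < rep_dim (sym_sum ms')" "i \<notin> hw_indices m ms'"
    have "highest_weight_vec (sym_sum ms') m (T *\<^sub>v x)"
      using s by (intro equivariant_highest_weight_vec[OF sym_sum_alg(1) sym_sum_alg(1) T x])
        (simp add: sym_sum_highest_weight_vec[OF x])
    then show "(T *\<^sub>v x) $ i = 0"
      using sym_sum_highest_weight_vec[of "T *\<^sub>v x" ms' m] Tc x i by auto
  qed (use hw_indices_bound sym_sum_alg(2) in auto)
  then show ?thesis using card_hw_indices by simp
qed

section \<open>Irreducible representations and multiplicities\<close>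

text \<open>The element \<open>torus 2\<close> has distinct eigenvalues \<open>c i\<close> on the basis vectors, so an invariant subspace contains every
basis vector occurring in one of its elements.  An upper unipotent element leads from any basis vector to the
first one, and a lower unipotent element from there to all others.\<close>

lemma sym_rep_irreducible: "irreducible_rep (sym_rep m)"
  unfolding irreducible_rep_def sym_rep_alg(2)
proof (intro conjI allI impI)
  fix W assume inv: "invariant_subspace (sym_rep m) W"
  note W = invariant_subspaceD[OF inv, unfolded sym_rep_alg(2)]
  let ?e = "\<lambda>i. unit_vec (Suc m) i :: complex vec"
  define c :: "nat \<Rightarrow> complex" where "c i = 2 ^ (m - i) * (1 / 2) ^ i" for i
  have c_inj: "i = j" if "i \<le> m" "j \<le> m" "c i = c j" for i j
  proof -
    have c4: "c i * 4 ^ i = 2 ^ m" if "i \<le> m" for i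
    proof -
      have "c i * 4 ^ i = 2 ^ (m - i) * ((1 / 2) ^ i * 4 ^ i)" by (simp add: c_def)
      also have "(1 / 2) ^ i * 4 ^ i = (2 :: complex) ^ i" by (simp flip: power_mult_distrib)
      finally show ?thesis using that by (simp flip: power_add)
    qed
    have "c i \<noteq> 0" by (simp add: c_def)
    then have "(4 :: complex) ^ i = 4 ^ j" using c4[OF that(1)] c4[OF that(2)] that(3) by (metis mult_left_cancel)
    then have "of_nat (4 ^ i) = (of_nat (4 ^ j) :: complex)" by simp
    then have "(4 :: nat) ^ i = 4 ^ j" by (simp only: of_nat_eq_iff)
    then show ?thesis by simp
  qed
  have torus2: "(sym_rep m (torus 2) *\<^sub>v x) $ i = c i * x $ i" if "x \<in> carrier_vec (Suc m)" "i < Suc m" for x i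
  proof -
    have "(sym_rep m (torus 2) *\<^sub>v x) $ i = (\<Sum>j<Suc m. sym_rep m (torus 2) $$ (i, j) * x $ j)"
      using that by (simp add: scalar_prod_def atLeast0LessThan sym_rep_def)
    also have "\<dots> = (\<Sum>j<Suc m. if j = i then c i * x $ i else 0)"
      using that by (intro sum.cong) (auto simp: sym_rep_torus c_def)
    finally show ?thesis using that by (simp del: sum.lessThan_Suc)
  qed
  have unit: "?e j \<in> W" if "x \<in> W" "j \<le> m" "x $ j \<noteq> 0" for x j
    using that
  proof (induction "card {i. i \<le> m \<and> x $ i \<noteq> 0}" arbitrary: x rule: less_induct)
    case less
    have x: "x \<in> carrier_vec (Suc m)" using W(1) less.prems by blast
    show ?case
    proof (cases "\<exists>l\<le>m. l \<noteq> j \<and> x $ l \<noteq> 0")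
      case True
      then obtain l where l: "l \<le> m" "l \<noteq> j" "x $ l \<noteq> 0" by blast
      define y where "y = sym_rep m (torus 2) *\<^sub>v x + (- c l) \<cdot>\<^sub>v x"
      have y: "y \<in> W" unfolding y_def using less.prems(1) by (intro W(3) W(4) W(5)) auto
      have yi: "y $ i = (c i - c l) * x $ i" if "i \<le> m" for i
        using torus2[OF x, of i] that x unfolding y_def by (simp add: algebra_simps del: index_mult_mat_vec)
      have "{i. i \<le> m \<and> y $ i \<noteq> 0} \<subset> {i. i \<le> m \<and> x $ i \<noteq> 0}"
      proof (rule psubsetI)
        show "{i. i \<le> m \<and> y $ i \<noteq> 0} \<subseteq> {i. i \<le> m \<and> x $ i \<noteq> 0}" by (auto simp: yi)
        have "l \<in> {i. i \<le> m \<and> x $ i \<noteq> 0}" "l \<notin> {i. i \<le> m \<and> y $ i \<noteq> 0}" using l by (auto simp: yi)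
        then show "{i. i \<le> m \<and> y $ i \<noteq> 0} \<noteq> {i. i \<le> m \<and> x $ i \<noteq> 0}" by blast
      qed
      then have "card {i. i \<le> m \<and> y $ i \<noteq> 0} < card {i. i \<le> m \<and> x $ i \<noteq> 0}"
        by (intro psubset_card_mono) auto
      moreover have "y $ j \<noteq> 0" using less.prems l c_inj[of j l] by (auto simp: yi)
      ultimately show ?thesis using less.hyps y less.prems(2) by blast
    next
      case False
      have "?e j = (1 / x $ j) \<cdot>\<^sub>v x"
      proof (rule eq_vecI)
        fix i assume "i < dim_vec ((1 / x $ j) \<cdot>\<^sub>v x)"
        then have i: "i \<le> m" using x by simp
        show "?e j $ i = ((1 / x $ j) \<cdot>\<^sub>v x) $ i"
          using i x False less.prems by (cases "i = j") (auto simp: unit_vec_def)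
      qed (use x in simp)
      then show ?thesis using W(4)[OF less.prems(1)] by simp
    qed
  qed
  have col: "(sym_rep m g *\<^sub>v ?e j) $ i = sym_rep m g $$ (i, j)" if "i \<le> m" "j \<le> m" for g i j
    using that by (simp add: sym_rep_def)
  show "W = {0\<^sub>v (Suc m)} \<or> W = carrier_vec (Suc m)"
  proof (cases "W = {0\<^sub>v (Suc m)}")
    case False
    then obtain w where w: "w \<in> W" "w \<noteq> 0\<^sub>v (Suc m)" using W(2) by blast
    then have "w \<in> carrier_vec (Suc m)" using W(1) by blast
    then obtain k where k: "k \<le> m" "w $ k \<noteq> 0" using w(2) by (metis carrier_vecD eq_vecI index_zero_vec(1,2) less_Suc_eq_le)
    have "?e k \<in> W" using unit[OF w(1) k] .
    then have "sym_rep m (upper 1) *\<^sub>v ?e k \<in> W" by (intro W(5)) auto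
    then have "?e 0 \<in> W" using k by (elim unit) (simp_all add: col sym_rep_upper del: index_mult_mat_vec)
    then have "sym_rep m (lower 1) *\<^sub>v ?e 0 \<in> W" by (intro W(5)) auto
    then have e: "?e i \<in> W" if "i \<le> m" for i
      using that by (elim unit) (simp_all add: col sym_rep_lower_0 del: index_mult_mat_vec)
    have "x \<in> W" if x: "x \<in> carrier_vec (Suc m)" for x
    proof -
      have "n \<le> Suc m \<Longrightarrow> vec (Suc m) (\<lambda>i. if i < n then x $ i else 0) \<in> W" for n
      proof (induction n)
        case 0
        have "vec (Suc m) (\<lambda>i. if i < 0 then x $ i else 0) = 0\<^sub>v (Suc m)" by (intro eq_vecI) auto
        then show ?case using W(2) by simp
      next
        case (Suc n)
        have "vec (Suc m) (\<lambda>i. if i < Suc n then x $ i else 0)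
          = vec (Suc m) (\<lambda>i. if i < n then x $ i else 0) + x $ n \<cdot>\<^sub>v ?e n"
          using Suc.prems by (intro eq_vecI) (auto simp: unit_vec_def less_Suc_eq)
        then show ?case using Suc e[of n] by (auto intro!: W(3) W(4))
      qed
      from this[of "Suc m"] have "vec (Suc m) (\<lambda>i. if i < Suc m then x $ i else 0) \<in> W" by simp
      moreover have "vec (Suc m) (\<lambda>i. if i < Suc m then x $ i else 0) = x" using x by (intro eq_vecI) auto
      ultimately show ?thesis by simp
    qed
    then show ?thesis using W(1) by blast
  qed simp
qed simp

text \<open>The summand provided by a highest weight vector is a nonzero invariant subspace, hence everything.\<close>

lemma irreducible_is_sym_rep:
  assumes \<tau>: "alg_rep \<tau>" and irr: "irreducible_rep \<tau>"
  shows "rep_equiv (sym_rep (rep_dim \<tau> - 1)) \<tau>"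
proof -
  let ?n = "rep_dim \<tau>"
  have n: "0 < ?n" using irr by (simp add: irreducible_rep_def)
  have 1: "1\<^sub>m ?n \<noteq> (0\<^sub>m ?n ?n :: complex mat)"
  proof
    assume "1\<^sub>m ?n = (0\<^sub>m ?n ?n :: complex mat)"
    then have "1\<^sub>m ?n $$ (0, 0) = (0\<^sub>m ?n ?n :: complex mat) $$ (0, 0)" by simp
    then show False using n by simp
  qed
  obtain m A B where A: "A \<in> carrier_mat ?n (Suc m)" and B: "B \<in> carrier_mat (Suc m) ?n"
    and BA: "B * A = 1\<^sub>m (Suc m)"
    and eA: "\<And>g. g \<in> carrier SL2 \<Longrightarrow> \<tau> g * A = A * sym_rep m g"
    and eB: "\<And>g. g \<in> carrier SL2 \<Longrightarrow> B * \<tau> g = sym_rep m g * B"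
  proof (rule highest_weight_summand[OF \<tau> one_carrier_mat _ 1], goal_cases)
    case 1
    show ?case by simp
  next
    case (2 g)
    then show ?case using alg_rep_carrier[OF \<tau>, of g] by simp
  next
    case (3 A m B)
    show ?case by (rule that[OF 3(2-4,7-8)])
  qed
  have eqA: "equivariant (sym_rep m) \<tau> A" using A eA by (simp add: equivariant_def sym_rep_alg)
  have eqB: "equivariant \<tau> (sym_rep m) B" using B eB by (simp add: equivariant_def sym_rep_alg)
  have inv: "invariant_subspace \<tau> ((*\<^sub>v) A ` carrier_vec (Suc m))"
    using range_invariant[OF sym_rep_alg(1) \<tau> eqA] by (simp add: sym_rep_alg)
  have "\<forall>W. invariant_subspace \<tau> W \<longrightarrow> W = {0\<^sub>v ?n} \<or> W = carrier_vec ?n"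
    using irr unfolding irreducible_rep_def by (rule conjunct2)
  from this[rule_format, OF inv] consider "(*\<^sub>v) A ` carrier_vec (Suc m) = {0\<^sub>v ?n}" | "(*\<^sub>v) A ` carrier_vec (Suc m) = carrier_vec ?n"
    by (elim disjE)
  then have onto: "(*\<^sub>v) A ` carrier_vec (Suc m) = carrier_vec ?n"
  proof cases
    case 1
    have "A *\<^sub>v unit_vec (Suc m) 0 \<in> (*\<^sub>v) A ` carrier_vec (Suc m)" by (intro imageI) simp
    then have "A *\<^sub>v unit_vec (Suc m) 0 = 0\<^sub>v ?n" unfolding 1 by simp
    then have "B *\<^sub>v (A *\<^sub>v unit_vec (Suc m) 0) = 0\<^sub>v (Suc m)" by (simp only: mult_mat_vec_0[OF B])
    moreover have "B *\<^sub>v (A *\<^sub>v unit_vec (Suc m) 0) = unit_vec (Suc m) 0"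
      using assoc_mult_mat_vec[OF B A, of "unit_vec (Suc m) 0"] unfolding BA by simp
    ultimately have "unit_vec (Suc m) 0 $ 0 = (0\<^sub>v (Suc m) :: complex vec) $ 0" by simp
    then show ?thesis by simp
  qed
  have AB: "A *\<^sub>v (B *\<^sub>v x) = x" if "x \<in> carrier_vec ?n" for x
  proof -
    have "x \<in> (*\<^sub>v) A ` carrier_vec (Suc m)" unfolding onto by (rule that)
    then obtain a where a: "x = A *\<^sub>v a" "a \<in> carrier_vec (Suc m)" by (rule imageE)
    have "B *\<^sub>v x = a"
      unfolding a(1) assoc_mult_mat_vec[OF B A a(2), symmetric] BA by (rule one_mult_mat_vec[OF a(2)])
    then show ?thesis by (simp only: a(1))
  qed
  have "x = 0\<^sub>v ?n" if "x \<in> carrier_vec ?n" "B *\<^sub>v x = 0\<^sub>v (Suc m)" for x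
    using AB[OF that(1)] unfolding that(2) mult_mat_vec_0[OF A] by (rule sym)
  then have "?n \<le> Suc m" using injective_dim_le[OF B] by blast
  moreover have "Suc m \<le> ?n" using left_inverse_dim_le[OF A B BA] .
  ultimately have nm: "?n = Suc m" by simp
  have "A * B = 1\<^sub>m ?n" using mat_mult_left_right_inverse[OF B[unfolded nm] A[unfolded nm]] BA nm by simp
  then have "rep_equiv (sym_rep m) \<tau>"
    unfolding rep_equiv_def summand_via_def sym_rep_alg by (intro exI[of _ A] exI[of _ B] conjI eqA eqB BA)
  then show ?thesis unfolding nm by simp
qed

lemma rep_iso_iff_equiv:
  assumes \<rho>: "alg_rep \<rho>" and \<sigma>: "alg_rep \<sigma>"
  shows "rep_iso \<rho> \<sigma> \<longleftrightarrow> rep_equiv \<rho> \<sigma>"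
proof
  assume "rep_iso \<rho> \<sigma>"
  then obtain T where T: "equivariant \<rho> \<sigma> T" and bij: "bij_betw ((*\<^sub>v) T) (carrier_vec (rep_dim \<rho>)) (carrier_vec (rep_dim \<sigma>))"
    unfolding rep_iso_def by blast
  let ?n = "rep_dim \<rho>" and ?k = "rep_dim \<sigma>"
  have Tc: "T \<in> carrier_mat ?k ?n" using T by (simp add: equivariant_def)
  have "\<exists>x \<in> carrier_vec ?n. T *\<^sub>v x = unit_vec ?k j" for j
  proof -
    have "unit_vec ?k j \<in> (*\<^sub>v) T ` carrier_vec ?n" unfolding bij_betw_imp_surj_on[OF bij] by simp
    then obtain x where x: "unit_vec ?k j = T *\<^sub>v x" "x \<in> carrier_vec ?n" by (rule imageE)
    show ?thesis by (intro bexI[of _ x] x(1)[symmetric] x(2))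
  qed
  then have "\<forall>j. \<exists>x. x \<in> carrier_vec ?n \<and> T *\<^sub>v x = unit_vec ?k j" by blast
  from choice[OF this] obtain x where x: "\<And>j. x j \<in> carrier_vec ?n" "\<And>j. T *\<^sub>v x j = unit_vec ?k j" by blast
  define S where "S = mat ?n ?k (\<lambda>(i, j). x j $ i)"
  have S: "S \<in> carrier_mat ?n ?k" by (simp add: S_def)
  have TS: "T * S = 1\<^sub>m ?k"
  proof (rule eq_matI)
    fix i j assume "i < dim_row (1\<^sub>m ?k :: complex mat)" "j < dim_col (1\<^sub>m ?k :: complex mat)"
    then have ij: "i < ?k" "j < ?k" by auto
    have "col S j = x j" using ij x(1)[of j] by (intro eq_vecI) (auto simp: S_def)
    then have "(T * S) $$ (i, j) = (T *\<^sub>v x j) $ i" using ij Tc S by simp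
    then show "(T * S) $$ (i, j) = 1\<^sub>m ?k $$ (i, j)" using ij by (simp add: x(2))
  qed (use Tc S in auto)
  have "?k \<le> ?n" by (rule left_inverse_dim_le[OF S Tc TS])
  moreover have "?n \<le> ?k"
  proof (rule injective_dim_le[OF Tc])
    fix y assume y: "y \<in> carrier_vec ?n" "T *\<^sub>v y = 0\<^sub>v ?k"
    have "T *\<^sub>v 0\<^sub>v ?n = 0\<^sub>v ?k" by (rule mult_mat_vec_0[OF Tc])
    then show "y = 0\<^sub>v ?n" using inj_onD[OF bij_betw_imp_inj_on[OF bij], of y "0\<^sub>v ?n"] y by simp
  qed
  ultimately have nk: "?n = ?k" by simp
  have ST: "S * T = 1\<^sub>m ?n" using mat_mult_left_right_inverse[OF Tc[folded nk] S[folded nk] TS[folded nk]] .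
  have "S * \<sigma> g = \<rho> g * S" if g: "g \<in> carrier SL2" for g
  proof -
    note C = alg_rep_carrier[OF \<rho> g] alg_rep_carrier[OF \<sigma> g]
    have "S * \<sigma> g = S * (\<sigma> g * (T * S))" unfolding TS right_mult_one_mat[OF C(2)] ..
    also have "\<dots> = S * (T * \<rho> g * S)"
      unfolding assoc_mult_mat[OF C(2) Tc S, symmetric] using T g by (simp add: equivariant_def)
    also have "\<dots> = S * T * (\<rho> g * S)"
      unfolding assoc_mult_mat[OF Tc C(1) S] by (rule assoc_mult_mat[OF S Tc mult_carrier_mat[OF C(1) S], symmetric])
    finally show ?thesis unfolding ST left_mult_one_mat[OF mult_carrier_mat[OF C(1) S]] .
  qed
  then have "equivariant \<sigma> \<rho> S" using S by (simp add: equivariant_def)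
  then show "rep_equiv \<rho> \<sigma>"
    unfolding rep_equiv_def summand_via_def by (intro exI[of _ T] exI[of _ S] conjI T TS ST)
next
  assume "rep_equiv \<rho> \<sigma>"
  then obtain T S where T: "equivariant \<rho> \<sigma> T" "equivariant \<sigma> \<rho> S" "S * T = 1\<^sub>m (rep_dim \<rho>)" "T * S = 1\<^sub>m (rep_dim \<sigma>)"
    unfolding rep_equiv_def summand_via_def by blast
  have c: "T \<in> carrier_mat (rep_dim \<sigma>) (rep_dim \<rho>)" "S \<in> carrier_mat (rep_dim \<rho>) (rep_dim \<sigma>)"
    using T by (auto simp: equivariant_def)
  have "bij_betw ((*\<^sub>v) T) (carrier_vec (rep_dim \<rho>)) (carrier_vec (rep_dim \<sigma>))"
  proof (rule bij_betw_byWitness[where f' = "(*\<^sub>v) S"])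
    show "\<forall>a\<in>carrier_vec (rep_dim \<rho>). S *\<^sub>v (T *\<^sub>v a) = a"
      by (simp add: assoc_mult_mat_vec[OF c(2,1), symmetric] T(3) del: assoc_mult_mat_vec)
    show "\<forall>a\<in>carrier_vec (rep_dim \<sigma>). T *\<^sub>v (S *\<^sub>v a) = a"
      by (simp add: assoc_mult_mat_vec[OF c(1,2), symmetric] T(4) del: assoc_mult_mat_vec)
  qed (use c in auto)
  then show "rep_iso \<rho> \<sigma>" using T(1) unfolding rep_iso_def by blast
qed

lemma irreducible_sum_is_sym_sum:
  assumes "\<forall>\<tau> \<in> set \<tau>s. alg_rep \<tau> \<and> irreducible_rep \<tau>"
  defines "ms \<equiv> map (\<lambda>\<tau>. rep_dim \<tau> - 1) \<tau>s"
  shows "summand (direct_sum \<tau>s) (sym_sum ms) \<and> summand (sym_sum ms) (direct_sum \<tau>s)"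
  using assms(1) unfolding ms_def
proof (induction \<tau>s)
  case Nil
  then show ?case using summand_refl[OF sym_sum_alg(1)[of "[]"]] by simp
next
  case (Cons \<tau> \<tau>s)
  have e: "rep_equiv (sym_rep (rep_dim \<tau> - 1)) \<tau>" using Cons.prems by (intro irreducible_is_sym_rep) auto
  have alg: "alg_rep \<tau>" "alg_rep (direct_sum \<tau>s)" using Cons.prems alg_rep_direct_sum[of \<tau>s] by auto
  have IH: "summand (direct_sum \<tau>s) (sym_sum (map (\<lambda>\<tau>. rep_dim \<tau> - 1) \<tau>s))"
    "summand (sym_sum (map (\<lambda>\<tau>. rep_dim \<tau> - 1) \<tau>s)) (direct_sum \<tau>s)" using Cons by auto
  show ?case
    unfolding list.map(2)[of "\<lambda>\<tau>. rep_dim \<tau> - 1"] sym_sum_Cons direct_sum_Cons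
    by (rule conjI[OF summand_dsum[OF alg sym_rep_alg(1) sym_sum_alg(1) rep_equiv_summand[OF rep_equiv_sym[OF e]] IH(1)]
      summand_dsum[OF sym_rep_alg(1) sym_sum_alg(1) alg rep_equiv_summand[OF e] IH(2)]])
qed

lemma length_filter_Suc_eq: "length (filter (\<lambda>m. Suc m = d) ms) = (if d = 0 then 0 else count (mset ms) (d - 1))"
  by (induction ms) auto

text \<open>Two decompositions into irreducible representations embed into each other, so comparing highest weight
vectors in both directions shows that they have the same multiplicities.\<close>

lemma mult_map_sym_sum:
  assumes \<rho>: "alg_rep \<rho>" and eq: "rep_equiv (sym_sum ms) \<rho>"
  shows "mult_map \<rho> d = (if d = 0 then 0 else count (mset ms) (d - 1))"
  unfolding mult_map_def
proof (rule the_equality)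
  show "\<exists>\<tau>s. (\<forall>\<tau> \<in> set \<tau>s. alg_rep \<tau> \<and> irreducible_rep \<tau>) \<and> rep_iso \<rho> (direct_sum \<tau>s) \<and>
      (if d = 0 then 0 else count (mset ms) (d - 1)) = length (filter (\<lambda>\<tau>. rep_dim \<tau> = d) \<tau>s)"
  proof (intro exI[of _ "map sym_rep ms"] conjI)
    show "rep_iso \<rho> (sym_sum ms)"
      unfolding rep_iso_iff_equiv[OF \<rho> sym_sum_alg(1)] using eq by (rule rep_equiv_sym)
    have "length (filter (\<lambda>\<tau>. rep_dim \<tau> = d) (map sym_rep ms)) = length (filter (\<lambda>m. Suc m = d) ms)"
      by (simp add: filter_map o_def sym_rep_alg)
    then show "(if d = 0 then 0 else count (mset ms) (d - 1)) = length (filter (\<lambda>\<tau>. rep_dim \<tau> = d) (map sym_rep ms))"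
      by (simp only: length_filter_Suc_eq)
  qed (auto simp: sym_rep_alg sym_rep_irreducible)
next
  fix k assume "\<exists>\<tau>s. (\<forall>\<tau> \<in> set \<tau>s. alg_rep \<tau> \<and> irreducible_rep \<tau>) \<and> rep_iso \<rho> (direct_sum \<tau>s) \<and>
      k = length (filter (\<lambda>\<tau>. rep_dim \<tau> = d) \<tau>s)"
  then obtain \<tau>s where \<tau>s: "\<forall>\<tau> \<in> set \<tau>s. alg_rep \<tau> \<and> irreducible_rep \<tau>" "rep_iso \<rho> (direct_sum \<tau>s)"
    "k = length (filter (\<lambda>\<tau>. rep_dim \<tau> = d) \<tau>s)" by blast
  define ms' where "ms' = map (\<lambda>\<tau>. rep_dim \<tau> - 1) \<tau>s"
  have D: "alg_rep (direct_sum \<tau>s)" using alg_rep_direct_sum \<tau>s(1) by blast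
  note S = sym_sum_alg(1)
  have e: "rep_equiv \<rho> (direct_sum \<tau>s)" using \<tau>s(2) rep_iso_iff_equiv[OF \<rho> D] by blast
  note d = irreducible_sum_is_sym_sum[OF \<tau>s(1), folded ms'_def]
  have "summand (sym_sum ms) (direct_sum \<tau>s)"
    by (rule summand_trans[OF S \<rho> D rep_equiv_summand[OF eq] rep_equiv_summand[OF e]])
  then have 1: "summand (sym_sum ms) (sym_sum ms')" using summand_trans[OF S D S] d by blast
  have "summand (direct_sum \<tau>s) (sym_sum ms)"
    by (rule summand_trans[OF D \<rho> S rep_equiv_summand[OF rep_equiv_sym[OF e]] rep_equiv_summand[OF rep_equiv_sym[OF eq]]])
  then have 2: "summand (sym_sum ms') (sym_sum ms)" using summand_trans[OF S D S] d by blast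
  have "count (mset ms) m = count (mset ms') m" for m
    using injective_equivariant_count_le[OF summand_injective_equivariant[OF S S 1]]
      injective_equivariant_count_le[OF summand_injective_equivariant[OF S S 2]] by (intro le_antisym)
  moreover have "k = length (filter (\<lambda>m. Suc m = d) ms')"
  proof -
    have "0 < rep_dim \<tau>" if "\<tau> \<in> set \<tau>s" for \<tau> using \<tau>s(1) that by (auto simp: irreducible_rep_def)
    then have "filter (\<lambda>\<tau>. rep_dim \<tau> = d) \<tau>s = filter (\<lambda>\<tau>. Suc (rep_dim \<tau> - 1) = d) \<tau>s"
      by (intro filter_cong) auto
    then show ?thesis unfolding \<tau>s(3) ms'_def by (simp add: filter_map o_def)
  qed
  ultimately show "k = (if d = 0 then 0 else count (mset ms) (d - 1))"
    by (simp only: length_filter_Suc_eq)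
qed

lemma dsum_assoc: "dsum \<rho> (dsum \<sigma> \<tau>) = dsum (dsum \<rho> \<sigma>) \<tau>"
  by (rule ext) (unfold dsum_def, rule assoc_four_block_mat)

text \<open>The intertwiner is the block permutation matrix.\<close>

lemma summand_dsum_swap:
  assumes \<rho>: "alg_rep \<rho>" and \<sigma>: "alg_rep \<sigma>"
  shows "summand (dsum \<rho> \<sigma>) (dsum \<sigma> \<rho>)"
proof -
  let ?n = "rep_dim \<rho>" and ?k = "rep_dim \<sigma>"
  have sw: "equivariant (dsum \<rho> \<sigma>) (dsum \<sigma> \<rho>)
      (four_block_mat (0\<^sub>m (rep_dim \<sigma>) (rep_dim \<rho>)) (1\<^sub>m (rep_dim \<sigma>)) (1\<^sub>m (rep_dim \<rho>)) (0\<^sub>m (rep_dim \<rho>) (rep_dim \<sigma>)))"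
    if \<rho>: "alg_rep \<rho>" and \<sigma>: "alg_rep \<sigma>" for \<rho> \<sigma>
    unfolding equivariant_def alg_rep_dsum(2)[OF \<rho> \<sigma>] alg_rep_dsum(2)[OF \<sigma> \<rho>]
  proof (intro conjI ballI)
    fix g assume g: "g \<in> carrier SL2"
    note C = alg_rep_carrier[OF \<rho> g] alg_rep_carrier[OF \<sigma> g]
    show "four_block_mat (0\<^sub>m (rep_dim \<sigma>) (rep_dim \<rho>)) (1\<^sub>m (rep_dim \<sigma>)) (1\<^sub>m (rep_dim \<rho>)) (0\<^sub>m (rep_dim \<rho>) (rep_dim \<sigma>)) * dsum \<rho> \<sigma> g
      = dsum \<sigma> \<rho> g * four_block_mat (0\<^sub>m (rep_dim \<sigma>) (rep_dim \<rho>)) (1\<^sub>m (rep_dim \<sigma>)) (1\<^sub>m (rep_dim \<rho>)) (0\<^sub>m (rep_dim \<rho>) (rep_dim \<sigma>))"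
      unfolding dsum_eq[of \<rho> g _ \<sigma> _, OF C] dsum_eq[of \<sigma> g _ \<rho> _, OF C(2,1)]
      by (subst mult_four_block_mat[OF zero_carrier_mat one_carrier_mat one_carrier_mat zero_carrier_mat C(1) zero_carrier_mat zero_carrier_mat C(2)],
          subst mult_four_block_mat[OF C(2) zero_carrier_mat zero_carrier_mat C(1) zero_carrier_mat one_carrier_mat one_carrier_mat zero_carrier_mat])
        (use C in simp)
  qed auto
  have "four_block_mat (0\<^sub>m ?n ?k) (1\<^sub>m ?n) (1\<^sub>m ?k) (0\<^sub>m ?k ?n) * four_block_mat (0\<^sub>m ?k ?n) (1\<^sub>m ?k) (1\<^sub>m ?n) (0\<^sub>m ?n ?k) = (1\<^sub>m (?n + ?k) :: complex mat)"
    by (subst mult_four_block_mat[OF zero_carrier_mat one_carrier_mat one_carrier_mat zero_carrier_mat zero_carrier_mat one_carrier_mat one_carrier_mat zero_carrier_mat]) simp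
  then show ?thesis
    unfolding summand_def summand_via_def alg_rep_dsum(2)[OF \<rho> \<sigma>]
    using sw[OF \<rho> \<sigma>] sw[OF \<sigma> \<rho>] by blast
qed

lemma summand_bring_to_front:
  assumes "y \<in> set ys"
  shows "summand (sym_sum (y # remove1 y ys)) (sym_sum ys)"
  using assms
proof (induction ys)
  case Nil
  then show ?case by simp
next
  case (Cons z ys)
  note S = sym_sum_alg(1) and R = sym_rep_alg(1)
  show ?case
  proof (cases "y = z")
    case True
    then show ?thesis using summand_refl[OF S[of "z # ys"]] by simp
  next
    case False
    let ?t = "sym_sum (remove1 y ys)"
    have IH: "summand (dsum (sym_rep y) ?t) (sym_sum ys)" using Cons False by (simp only: sym_sum_Cons) simp
    have 1: "summand (dsum (dsum (sym_rep y) (sym_rep z)) ?t) (dsum (dsum (sym_rep z) (sym_rep y)) ?t)"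
      by (intro summand_dsum summand_dsum_swap summand_refl alg_rep_dsum(1) S R)
    have 2: "summand (dsum (sym_rep z) (dsum (sym_rep y) ?t)) (dsum (sym_rep z) (sym_sum ys))"
      by (intro summand_dsum summand_refl alg_rep_dsum(1) S R IH)
    have "summand (dsum (sym_rep y) (dsum (sym_rep z) ?t)) (dsum (sym_rep z) (sym_sum ys))"
      using summand_trans[OF _ _ _ 1[folded dsum_assoc] 2] by (simp add: alg_rep_dsum(1) S R)
    then show ?thesis using False by (simp add: sym_sum_Cons del: list.map)
  qed
qed

lemma submultiset_summand:
  assumes "mset ms \<subseteq># mset ms'"
  shows "summand (sym_sum ms) (sym_sum ms')"
  using assms
proof (induction ms arbitrary: ms')
  case Nil
  show ?case by (rule summand_empty[OF sym_sum_alg(1)])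
next
  case (Cons m ms)
  have m: "m \<in> set ms'" using Cons.prems by (metis insert_subset_eq_iff mset.simps(2) set_mset_mset)
  have "mset ms \<subseteq># mset (remove1 m ms')" using Cons.prems by (simp add: insert_subset_eq_iff)
  then have "summand (sym_sum (m # ms)) (sym_sum (m # remove1 m ms'))"
    unfolding sym_sum_Cons using Cons.IH by (intro summand_dsum summand_refl sym_sum_alg(1) sym_rep_alg(1))
  then show ?case using summand_trans[OF sym_sum_alg(1) sym_sum_alg(1) sym_sum_alg(1)] summand_bring_to_front[OF m] by blast
qed

text \<open>Forwards, multiplicities are compared by counting highest weight vectors; backwards, a sub-multiset of the summands
is a direct summand.\<close>

theorem embeds_iff_mult_map_le:
  assumes \<rho>: "alg_rep \<rho>" and \<sigma>: "alg_rep \<sigma>"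
  shows "embeds \<rho> \<sigma> \<longleftrightarrow> (\<forall>d. mult_map \<rho> d \<le> mult_map \<sigma> d)"
proof -
  note S = sym_sum_alg(1)
  obtain ms ms' where ms: "rep_equiv (sym_sum ms) \<rho>" and ms': "rep_equiv (sym_sum ms') \<sigma>"
    using complete_reducibility[OF \<rho>] complete_reducibility[OF \<sigma>] by blast
  note s = rep_equiv_summand[OF ms] rep_equiv_summand[OF rep_equiv_sym[OF ms]]
    rep_equiv_summand[OF ms'] rep_equiv_summand[OF rep_equiv_sym[OF ms']]
  have "embeds \<rho> \<sigma> \<longleftrightarrow> mset ms \<subseteq># mset ms'"
  proof
    assume "embeds \<rho> \<sigma>"
    then have "injective_equivariant \<rho> \<sigma>" by (rule embeds_injective_equivariant)
    then have "injective_equivariant \<rho> (sym_sum ms')"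
      using injective_equivariant_comp[OF \<rho> \<sigma> S _ summand_injective_equivariant[OF \<sigma> S s(4)]] by blast
    then have "injective_equivariant (sym_sum ms) (sym_sum ms')"
      using injective_equivariant_comp[OF S \<rho> S summand_injective_equivariant[OF S \<rho> s(1)]] by blast
    then show "mset ms \<subseteq># mset ms'" using injective_equivariant_count_le by (intro mset_subset_eqI)
  next
    assume "mset ms \<subseteq># mset ms'"
    then have "summand (sym_sum ms) (sym_sum ms')" by (rule submultiset_summand)
    then have "summand \<rho> \<sigma>"
      using summand_trans[OF \<rho> S S s(2)] summand_trans[OF \<rho> S \<sigma> _ s(3)] by blast
    then show "embeds \<rho> \<sigma>" by (rule summand_embeds[OF \<rho> \<sigma>])
  qed
  also have "\<dots> \<longleftrightarrow> (\<forall>d. mult_map \<rho> d \<le> mult_map \<sigma> d)"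
  proof
    assume "mset ms \<subseteq># mset ms'"
    then show "\<forall>d. mult_map \<rho> d \<le> mult_map \<sigma> d"
      by (simp add: subseteq_mset_def mult_map_sym_sum[OF \<rho> ms] mult_map_sym_sum[OF \<sigma> ms'])
  next
    assume "\<forall>d. mult_map \<rho> d \<le> mult_map \<sigma> d"
    then have "mult_map \<rho> (Suc m) \<le> mult_map \<sigma> (Suc m)" for m by blast
    then show "mset ms \<subseteq># mset ms'"
      by (simp add: subseteq_mset_def mult_map_sym_sum[OF \<rho> ms] mult_map_sym_sum[OF \<sigma> ms'])
  qed
  finally show ?thesis .
qed

section \<open>Characters\<close>

definition mat_trace :: "complex mat \<Rightarrow> complex" where
  "mat_trace A = (\<Sum>i<dim_row A. A $$ (i, i))"

lemma mat_trace_mult_commute: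
  assumes "A \<in> carrier_mat n k" "B \<in> carrier_mat k n"
  shows "mat_trace (A * B) = mat_trace (B * A)"
proof -
  have "mat_trace (A * B) = (\<Sum>i<n. \<Sum>j<k. A $$ (i, j) * B $$ (j, i))"
    using assms by (simp add: mat_trace_def scalar_prod_def atLeast0LessThan)
  also have "\<dots> = (\<Sum>j<k. \<Sum>i<n. B $$ (j, i) * A $$ (i, j))"
    by (subst sum.swap) (simp add: mult.commute)
  also have "\<dots> = mat_trace (B * A)"
    using assms by (simp add: mat_trace_def scalar_prod_def atLeast0LessThan)
  finally show ?thesis .
qed

lemma mat_trace_rep_equiv:
  assumes \<rho>: "alg_rep \<rho>" and \<sigma>: "alg_rep \<sigma>" and "rep_equiv \<rho> \<sigma>" and g: "g \<in> carrier SL2"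
  shows "mat_trace (\<rho> g) = mat_trace (\<sigma> g)"
proof -
  obtain T S where T: "equivariant \<rho> \<sigma> T" "equivariant \<sigma> \<rho> S" "S * T = 1\<^sub>m (rep_dim \<rho>)" "T * S = 1\<^sub>m (rep_dim \<sigma>)"
    using assms(3) unfolding rep_equiv_def summand_via_def by blast
  have c: "T \<in> carrier_mat (rep_dim \<sigma>) (rep_dim \<rho>)" "S \<in> carrier_mat (rep_dim \<rho>) (rep_dim \<sigma>)"
    using T by (auto simp: equivariant_def)
  note C = alg_rep_carrier[OF \<rho> g] alg_rep_carrier[OF \<sigma> g]
  have "\<rho> g = S * T * \<rho> g" unfolding T(3) left_mult_one_mat[OF C(1)] ..
  also have "\<dots> = S * (\<sigma> g * T)" unfolding assoc_mult_mat[OF c(2,1) C(1)] using T(1) g by (simp add: equivariant_def)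
  finally have "mat_trace (\<rho> g) = mat_trace (\<sigma> g * T * S)" using mat_trace_mult_commute[OF c(2) mult_carrier_mat[OF C(2) c(1)]] by simp
  also have "\<sigma> g * T * S = \<sigma> g" unfolding assoc_mult_mat[OF C(2) c] T(4) right_mult_one_mat[OF C(2)] ..
  finally show ?thesis .
qed

lemma sum_lessThan_add: "(\<Sum>i<m + n. f i) = (\<Sum>i<m. f i) + (\<Sum>i<n. f (m + i))" for f :: "nat \<Rightarrow> 'a :: comm_monoid_add"
  by (induction n) (simp_all add: add.assoc)

lemma mat_trace_dsum:
  assumes \<rho>: "alg_rep \<rho>" and \<sigma>: "alg_rep \<sigma>" and g: "g \<in> carrier SL2"
  shows "mat_trace (dsum \<rho> \<sigma> g) = mat_trace (\<rho> g) + mat_trace (\<sigma> g)"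
proof -
  note C = alg_rep_carrier[OF \<rho> g] alg_rep_carrier[OF \<sigma> g]
  show ?thesis
    unfolding dsum_eq[of \<rho> g _ \<sigma> _, OF C] mat_trace_def using C by (simp add: sum_lessThan_add)
qed

text \<open>Weyl's character formula for \<open>SL2\<close>, with \<open>x\<close> and \<open>y\<close> the eigenvalues of a torus element.\<close>

lemma chi_recurrence_value:
  fixes x y :: real
  assumes "x * y = 1"
  shows "(x - y) * poly (chi n) (x + y) = x ^ n - y ^ n"
proof (induction n rule: chi.induct)
  case (3 n)
  have "(x - y) * poly (chi (Suc (Suc n))) (x + y)
      = (x + y) * ((x - y) * poly (chi (Suc n)) (x + y)) - (x - y) * poly (chi n) (x + y)"
    by (simp add: algebra_simps)
  also have "\<dots> = (x + y) * (x ^ Suc n - y ^ Suc n) - (x ^ n - y ^ n)" unfolding 3 ..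
  also have "\<dots> = x ^ Suc (Suc n) - y ^ Suc (Suc n) + (x * y - 1) * (x ^ n - y ^ n)"
    by (simp add: algebra_simps)
  finally show ?case using assms by simp
qed simp_all

lemma mat_trace_sym_rep:
  assumes "1 < x"
  shows "mat_trace (sym_rep m (torus (of_real x))) = of_real (poly (chi (Suc m)) (x + 1 / x))"
proof -
  have "mat_trace (sym_rep m (torus (of_real x))) = (\<Sum>i<Suc m. of_real (x ^ (m - i) * (1 / x) ^ i))"
    unfolding mat_trace_def carrier_matD(1)[OF sym_rep_carrier] by (intro sum.cong) (auto simp: sym_rep_torus)
  also have "\<dots> = of_real (\<Sum>i<Suc m. x ^ (m - i) * (1 / x) ^ i)" by simp
  also have "(\<Sum>i<Suc m. x ^ (m - i) * (1 / x) ^ i) = poly (chi (Suc m)) (x + 1 / x)"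
  proof -
    have "(x - 1 / x) * (\<Sum>i<Suc m. x ^ (m - i) * (1 / x) ^ i) = x ^ Suc m - (1 / x) ^ Suc m"
      using power_diff_sumr2[of x "Suc m" "1 / x"] diff_power_eq_sum[of x m "1 / x"]
        sum.nat_diff_reindex[of "\<lambda>i. x ^ i * (1 / x) ^ (m - i)" "Suc m"] by (simp add: mult.commute)
    also have "\<dots> = (x - 1 / x) * poly (chi (Suc m)) (x + 1 / x)"
      using assms by (intro chi_recurrence_value[symmetric]) simp
    finally have "(x - 1 / x) * (\<Sum>i<Suc m. x ^ (m - i) * (1 / x) ^ i) = (x - 1 / x) * poly (chi (Suc m)) (x + 1 / x)" .
    moreover have "1 / x < 1" using assms by simp
    then have "x - 1 / x \<noteq> 0" using assms by linarith
    ultimately show ?thesis using mult_left_cancel[of "x - 1 / x"] by blast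
  qed
  finally show ?thesis .
qed

text \<open>The character as a polynomial in \<open>u = t + 1/t\<close>, put together from the multiplicities.\<close>

definition rep_poly :: "rep \<Rightarrow> real poly" where
  "rep_poly \<rho> = (\<Sum>d\<in>mult_supp \<rho>. Polynomial.smult (real (mult_map \<rho> d)) (chi d))"

lemma finite_mult_supp:
  assumes \<rho>: "alg_rep \<rho>" shows "finite (mult_supp \<rho>)"
proof -
  obtain ms where ms: "rep_equiv (sym_sum ms) \<rho>" using complete_reducibility[OF \<rho>] by blast
  have "mult_supp \<rho> \<subseteq> Suc ` set ms"
  proof
    fix d assume "d \<in> mult_supp \<rho>"
    then have "0 < d" "0 < count (mset ms) (d - 1)"
      by (auto simp: mult_supp_def mult_map_sym_sum[OF \<rho> ms])
    then have "d = Suc (d - 1)" "d - 1 \<in> set ms" by auto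
    then show "d \<in> Suc ` set ms" by blast
  qed
  then show ?thesis using finite_subset by blast
qed

lemma chi_coeff_rep_poly:
  assumes \<rho>: "alg_rep \<rho>"
  shows "chi_coeff (rep_poly \<rho>) d = real (mult_map \<rho> d)"
proof -
  have 0: "mult_map \<rho> 0 = 0"
    using complete_reducibility[OF \<rho>] mult_map_sym_sum[OF \<rho>] by fastforce
  have "chi_coeff (rep_poly \<rho>) d = (\<Sum>e\<in>mult_supp \<rho>. if e = d then real (mult_map \<rho> d) else 0)"
    unfolding rep_poly_def chi_coeff_sum chi_coeff_smult chi_coeff_chi by (intro sum.cong) (auto simp: mult_supp_def)
  also have "\<dots> = real (mult_map \<rho> d)"
    using 0 finite_mult_supp[OF \<rho>] by (cases "d = 0") (auto simp: mult_supp_def)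
  finally show ?thesis .
qed

lemma rep_poly_cone: "alg_rep \<rho> \<Longrightarrow> rep_poly \<rho> \<in> cone"
  by (simp add: cone_def chi_coeff_rep_poly)

lemma embeds_iff_cone:
  assumes "alg_rep \<rho>" "alg_rep \<sigma>"
  shows "embeds \<rho> \<sigma> \<longleftrightarrow> rep_poly \<sigma> - rep_poly \<rho> \<in> cone"
  using embeds_iff_mult_map_le[OF assms] by (simp add: cone_def chi_coeff_diff chi_coeff_rep_poly assms)

lemma rep_poly_sym_sum:
  assumes \<rho>: "alg_rep \<rho>" and ms: "rep_equiv (sym_sum ms) \<rho>"
  shows "rep_poly \<rho> = (\<Sum>m\<leftarrow>ms. chi (Suc m))"
proof (rule chi_coeff_eqD)
  fix d
  have "chi_coeff (\<Sum>m\<leftarrow>ms. chi (Suc m)) d = real (if d = 0 then 0 else count (mset ms) (d - 1))"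
    by (induction ms) (auto simp: chi_coeff_add chi_coeff_chi)
  then show "chi_coeff (rep_poly \<rho>) d = chi_coeff (\<Sum>m\<leftarrow>ms. chi (Suc m)) d"
    by (simp only: chi_coeff_rep_poly[OF \<rho>] mult_map_sym_sum[OF \<rho> ms])
qed

text \<open>Torus elements with real \<open>x > 1\<close> suffice to identify a polynomial, and for them \<open>x\<close> differs from \<open>1 / x\<close>, so that
Weyl's formula can be divided by \<open>x - 1 / x\<close>.\<close>

lemma mat_trace_torus_rep_poly:
  assumes \<rho>: "alg_rep \<rho>" and x: "1 < x"
  shows "mat_trace (\<rho> (torus (of_real x))) = of_real (poly (rep_poly \<rho>) (x + 1 / x))"
proof -
  obtain ms where ms: "rep_equiv (sym_sum ms) \<rho>" using complete_reducibility[OF \<rho>] by blast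
  have T: "torus (of_real x) \<in> carrier SL2" using x by simp
  have "mat_trace (sym_sum ms (torus (of_real x))) = of_real (\<Sum>m\<leftarrow>ms. poly (chi (Suc m)) (x + 1 / x))"
  proof (induction ms)
    case Nil
    then show ?case by (simp add: direct_sum_Nil mat_trace_def)
  next
    case (Cons m ms)
    then show ?case unfolding sym_sum_Cons mat_trace_dsum[OF sym_rep_alg(1) sym_sum_alg(1) T] mat_trace_sym_rep[OF x] by simp
  qed
  moreover have "(\<Sum>m\<leftarrow>ms. poly (chi (Suc m)) u) = poly (\<Sum>m\<leftarrow>ms. chi (Suc m)) u" for u
    by (induction ms) auto
  ultimately show ?thesis
    using mat_trace_rep_equiv[OF sym_sum_alg(1) \<rho> ms T] by (simp only: rep_poly_sym_sum[OF \<rho> ms])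
qed

lemma rep_poly_eqI:
  assumes \<rho>: "alg_rep \<rho>"
    and e: "\<And>x. 1 < x \<Longrightarrow> mat_trace (\<rho> (torus (of_real x))) = of_real (poly p (x + 1 / x))"
  shows "rep_poly \<rho> = p"
proof (rule ccontr)
  assume "rep_poly \<rho> \<noteq> p"
  then have fin: "finite {u. poly (rep_poly \<rho> - p) u = 0}" by (intro poly_roots_finite) simp
  have "(\<lambda>x. x + 1 / x) ` {1<..} \<subseteq> {u. poly (rep_poly \<rho> - p) u = 0}"
  proof safe
    fix x :: real assume "1 < x"
    then have "complex_of_real (poly (rep_poly \<rho>) (x + 1 / x)) = of_real (poly p (x + 1 / x))"
      using e mat_trace_torus_rep_poly[OF \<rho>] by metis
    then show "poly (rep_poly \<rho> - p) (x + 1 / x) = 0" by simp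
  qed
  then have "finite ((\<lambda>x :: real. x + 1 / x) ` {1<..})" using fin finite_subset by blast
  moreover have "inj_on (\<lambda>x :: real. x + 1 / x) {1<..}"
  proof (rule inj_onI)
    fix x y :: real assume xy: "x \<in> {1<..}" "y \<in> {1<..}" "x + 1 / x = y + 1 / y"
    then have "(x - y) * (x * y - 1) = 0" by (simp add: field_simps)
    moreover have "1 < x * y" using xy by (simp add: less_1_mult)
    ultimately show "x = y" by simp
  qed
  ultimately have "finite {1 :: real<..}" using finite_imageD by blast
  then show False using infinite_Ioi[of "1 :: real"] by blast
qed

section \<open>Tensor products\<close>

lemma sum_div_mod:
  fixes f h :: "nat \<Rightarrow> complex"
  shows "(\<Sum>p<k * l. f (p div l) * h (p mod l)) = (\<Sum>a<k. f a) * (\<Sum>b<l. h b)"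
proof (cases "l = 0")
  case False
  have "(\<Sum>p<k * l. f (p div l) * h (p mod l)) = (\<Sum>(a, b)\<in>{..<k} \<times> {..<l}. f a * h b)"
  proof (rule sum.reindex_bij_witness[where i = "\<lambda>(a, b). a * l + b" and j = "\<lambda>p. (p div l, p mod l)"])
    fix x assume "x \<in> {..<k} \<times> {..<l}"
    then obtain a b where x: "x = (a, b)" "a < k" "b < l" by auto
    have "a * l + b < (a + 1) * l" using x by simp
    also have "\<dots> \<le> k * l" using x by (intro mult_right_mono) auto
    finally show "(case x of (a, b) \<Rightarrow> a * l + b) \<in> {..<k * l}" using x by simp
  qed (use False in \<open>auto simp: less_mult_imp_div_less\<close>)
  then show ?thesis by (simp add: sum_product sum.cartesian_product)
qed simp

lemma kronecker_carrier:
  "A \<in> carrier_mat n k \<Longrightarrow> B \<in> carrier_mat n' k' \<Longrightarrow> kronecker A B \<in> carrier_mat (n * n') (k * k')"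
  by (simp add: kronecker_def)

lemma kronecker_index:
  "A \<in> carrier_mat n k \<Longrightarrow> B \<in> carrier_mat n' k' \<Longrightarrow> i < n * n' \<Longrightarrow> j < k * k' \<Longrightarrow>
    kronecker A B $$ (i, j) = A $$ (i div n', j div k') * B $$ (i mod n', j mod k')"
  by (simp add: kronecker_def)

lemma div_mod_less:
  "i < n * n' \<Longrightarrow> i div n' < n" "i < n * n' \<Longrightarrow> i mod n' < n'" for i :: nat
  by (auto simp: less_mult_imp_div_less) (metis mod_less_divisor mult_0_right neq0_conv not_less_zero)

lemma kronecker_mult:
  assumes A: "A \<in> carrier_mat n k" "B \<in> carrier_mat k l" and C: "C \<in> carrier_mat n' k'" "D \<in> carrier_mat k' l'"
  shows "kronecker (A * B) (C * D) = kronecker A C * kronecker B D"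
proof (rule eq_matI)
  have K: "kronecker A C \<in> carrier_mat (n * n') (k * k')" "kronecker B D \<in> carrier_mat (k * k') (l * l')"
    using assms by (auto intro: kronecker_carrier)
  fix i j assume "i < dim_row (kronecker A C * kronecker B D)" "j < dim_col (kronecker A C * kronecker B D)"
  then have ij: "i < n * n'" "j < l * l'" using K by auto
  note d = div_mod_less[OF ij(1)] div_mod_less[OF ij(2)]
  have "kronecker (A * B) (C * D) $$ (i, j) = (A * B) $$ (i div n', j div l') * (C * D) $$ (i mod n', j mod l')"
    using mult_carrier_mat[OF A] mult_carrier_mat[OF C] ij by (rule kronecker_index)
  also have "\<dots> = (\<Sum>a<k. A $$ (i div n', a) * B $$ (a, j div l')) * (\<Sum>b<k'. C $$ (i mod n', b) * D $$ (b, j mod l'))"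
    using A C d by (simp add: scalar_prod_def atLeast0LessThan)
  also have "\<dots> = (\<Sum>p<k * k'. (A $$ (i div n', p div k') * B $$ (p div k', j div l')) * (C $$ (i mod n', p mod k') * D $$ (p mod k', j mod l')))"
    by (rule sum_div_mod[symmetric])
  also have "\<dots> = (\<Sum>p<k * k'. kronecker A C $$ (i, p) * kronecker B D $$ (p, j))"
    by (intro sum.cong refl) (simp add: kronecker_index[OF A(1) C(1) ij(1)] kronecker_index[OF A(2) C(2) _ ij(2)])
  also have "\<dots> = (kronecker A C * kronecker B D) $$ (i, j)"
    using K ij by (simp add: scalar_prod_def atLeast0LessThan)
  finally show "kronecker (A * B) (C * D) $$ (i, j) = (kronecker A C * kronecker B D) $$ (i, j)" .
qed (use assms in \<open>auto simp: kronecker_def\<close>)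

lemma mat_trace_kronecker:
  assumes "A \<in> carrier_mat n n" "B \<in> carrier_mat k k"
  shows "mat_trace (kronecker A B) = mat_trace A * mat_trace B"
proof -
  have "mat_trace (kronecker A B) = (\<Sum>i<n * k. A $$ (i div k, i div k) * B $$ (i mod k, i mod k))"
    using kronecker_carrier[OF assms] by (auto simp: mat_trace_def kronecker_index[OF assms] intro!: sum.cong)
  then show ?thesis
    using sum_div_mod[of "\<lambda>i. A $$ (i, i)" k "\<lambda>i. B $$ (i, i)" n] assms by (simp add: mat_trace_def)
qed

lemma kronecker_one: "kronecker (1\<^sub>m n) (1\<^sub>m k) = 1\<^sub>m (n * k)"
proof (rule eq_matI)
  fix i j assume "i < dim_row (1\<^sub>m (n * k) :: complex mat)" "j < dim_col (1\<^sub>m (n * k) :: complex mat)"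
  then have ij: "i < n * k" "j < n * k" by auto
  have "i = j" if "i div k = j div k" "i mod k = j mod k" using that by (metis div_mult_mod_eq)
  then show "kronecker (1\<^sub>m n) (1\<^sub>m k) $$ (i, j) = 1\<^sub>m (n * k) $$ (i, j)"
    using ij div_mod_less[OF ij(1)] div_mod_less[OF ij(2)]
    by (auto simp: kronecker_index[OF one_carrier_mat one_carrier_mat ij])
qed (auto simp: kronecker_def)

lemma alg_rep_tensor:
  assumes \<rho>: "alg_rep \<rho>" and \<sigma>: "alg_rep \<sigma>"
  shows "alg_rep (rep_tensor \<rho> \<sigma>)"
proof (rule alg_repI(1)[where n = "rep_dim \<rho> * rep_dim \<sigma>"])
  note C = alg_rep_carrier[OF \<rho>] and D = alg_rep_carrier[OF \<sigma>]
  fix g assume g: "g \<in> carrier SL2"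
  show "rep_tensor \<rho> \<sigma> g \<in> carrier_mat (rep_dim \<rho> * rep_dim \<sigma>) (rep_dim \<rho> * rep_dim \<sigma>)"
    unfolding rep_tensor_def by (rule kronecker_carrier[OF C[OF g] D[OF g]])
  fix h assume h: "h \<in> carrier SL2"
  show "rep_tensor \<rho> \<sigma> (g * h) = rep_tensor \<rho> \<sigma> g * rep_tensor \<rho> \<sigma> h"
    unfolding rep_tensor_def alg_rep_mult[OF \<rho> g h] alg_rep_mult[OF \<sigma> g h]
    by (rule kronecker_mult[OF C[OF g] C[OF h] D[OF g] D[OF h]])
next
  show "rep_tensor \<rho> \<sigma> (1\<^sub>m 2) = 1\<^sub>m (rep_dim \<rho> * rep_dim \<sigma>)"
    unfolding rep_tensor_def alg_rep_one[OF \<rho>] alg_rep_one[OF \<sigma>] by (rule kronecker_one)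
next
  fix i j assume ij: "i < rep_dim \<rho> * rep_dim \<sigma>" "j < rep_dim \<rho> * rep_dim \<sigma>"
  note d = div_mod_less[OF ij(1)] div_mod_less[OF ij(2)]
  obtain p where p: "regular_fun p" "\<And>g. g \<in> carrier SL2 \<Longrightarrow> \<rho> g $$ (i div rep_dim \<sigma>, j div rep_dim \<sigma>) = p g"
    using alg_rep_entry[OF \<rho> d(1,3)] by blast
  obtain q where q: "regular_fun q" "\<And>g. g \<in> carrier SL2 \<Longrightarrow> \<sigma> g $$ (i mod rep_dim \<sigma>, j mod rep_dim \<sigma>) = q g"
    using alg_rep_entry[OF \<sigma> d(2,4)] by blast
  have "rep_tensor \<rho> \<sigma> g $$ (i, j) = p g * q g" if g: "g \<in> carrier SL2" for g
    unfolding rep_tensor_def kronecker_index[OF alg_rep_carrier[OF \<rho> g] alg_rep_carrier[OF \<sigma> g] ij] p(2)[OF g] q(2)[OF g] ..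
  then show "\<exists>p. regular_fun p \<and> (\<forall>g \<in> carrier SL2. rep_tensor \<rho> \<sigma> g $$ (i, j) = p g)"
    using regular_fun.mult[OF p(1) q(1)] by (intro exI[of _ "\<lambda>g. p g * q g"]) auto
qed

lemma rep_poly_tensor:
  assumes \<rho>: "alg_rep \<rho>" and \<sigma>: "alg_rep \<sigma>"
  shows "rep_poly (rep_tensor \<rho> \<sigma>) = rep_poly \<rho> * rep_poly \<sigma>"
proof (rule rep_poly_eqI[OF alg_rep_tensor[OF assms]])
  fix x :: real assume x: "1 < x"
  then have T: "torus (of_real x) \<in> carrier SL2" by simp
  show "mat_trace (rep_tensor \<rho> \<sigma> (torus (of_real x))) = of_real (poly (rep_poly \<rho> * rep_poly \<sigma>) (x + 1 / x))"
    unfolding rep_tensor_def mat_trace_kronecker[OF alg_rep_carrier[OF \<rho> T] alg_rep_carrier[OF \<sigma> T]]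
      mat_trace_torus_rep_poly[OF \<rho> x] mat_trace_torus_rep_poly[OF \<sigma> x] by simp
qed

lemma trivial_rep: "alg_rep trivial_rep" "rep_poly trivial_rep = 1"
proof -
  have "\<exists>p. regular_fun p \<and> (\<forall>g \<in> carrier SL2. trivial_rep g $$ (i, j) = p g)" if "i < 1" "j < 1" for i j
    using that regular_fun.const[of 1] by (intro exI[of _ "\<lambda>g. 1"]) (auto simp: trivial_rep_def)
  then show a: "alg_rep trivial_rep" by (intro alg_repI(1)[where n = 1]) (auto simp: trivial_rep_def)
  show "rep_poly trivial_rep = 1"
    by (rule rep_poly_eqI[OF a]) (simp add: trivial_rep_def mat_trace_def)
qed

lemma standard_rep: "alg_rep standard_rep" "rep_poly standard_rep = [:0, 1:]"
proof -
  show a: "alg_rep standard_rep"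
    by (intro alg_repI(1)[where n = 2]) (auto simp: standard_rep_def SL2_def intro: regular_fun.entry)
  show "rep_poly standard_rep = [:0, 1:]"
    by (rule rep_poly_eqI[OF a]) (simp add: standard_rep_def mat_trace_def mat22_def numeral_2_eq_2)
qed

lemma rep_tensor_pow:
  assumes \<rho>: "alg_rep \<rho>"
  shows "alg_rep (rep_tensor_pow \<rho> n)" "rep_poly (rep_tensor_pow \<rho> n) = rep_poly \<rho> ^ n"
proof -
  have "alg_rep (rep_tensor_pow \<rho> n) \<and> rep_poly (rep_tensor_pow \<rho> n) = rep_poly \<rho> ^ n"
    using \<rho> by (induction n) (simp_all add: trivial_rep alg_rep_tensor rep_poly_tensor)
  then show "alg_rep (rep_tensor_pow \<rho> n)" "rep_poly (rep_tensor_pow \<rho> n) = rep_poly \<rho> ^ n" by auto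
qed

lemma rep_poly_eq_0:
  assumes \<rho>: "alg_rep \<rho>" and "rep_poly \<rho> = 0"
  shows "rep_dim \<rho> = 0"
proof -
  obtain ms where ms: "rep_equiv (sym_sum ms) \<rho>" using complete_reducibility[OF \<rho>] by blast
  have "count (mset ms) m = 0" for m
    using chi_coeff_rep_poly[OF \<rho>, of "Suc m"] assms(2) mult_map_sym_sum[OF \<rho> ms, of "Suc m"] by simp
  then have "ms = []" by (metis count_empty multiset_eqI mset_zero_iff)
  then have "rep_equiv \<rho> (sym_sum [])" using ms rep_equiv_sym by simp
  then obtain T T' where "summand_via \<rho> (sym_sum []) T T'" unfolding rep_equiv_def by blast
  then have "T \<in> carrier_mat (rep_dim (sym_sum [])) (rep_dim \<rho>)" "T' \<in> carrier_mat (rep_dim \<rho>) (rep_dim (sym_sum []))"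
    "T' * T = 1\<^sub>m (rep_dim \<rho>)" unfolding summand_via_def equivariant_def by blast+
  then have "rep_dim \<rho> \<le> rep_dim (sym_sum [])" by (rule left_inverse_dim_le)
  then show ?thesis unfolding sym_sum_alg(2) by simp
qed

text \<open>Prescribed multiplicities are realised by a direct sum of symmetric powers.\<close>

lemma rep_with_multiplicities:
  assumes "1 \<le> N" "0 < k 1"
  obtains \<eta> where "alg_rep \<eta>" "0 < rep_dim \<eta>" "rep_poly \<eta> = (\<Sum>d\<in>{1..N}. Polynomial.smult (real (k d)) (chi d))"
proof -
  define ms where "ms = concat (map (\<lambda>m. replicate (k (Suc m)) m) [0..<N])"
  have "rep_equiv (sym_sum ms) (sym_sum ms)" by (rule rep_equiv_refl[OF sym_sum_alg(1)])
  then have "rep_poly (sym_sum ms) = (\<Sum>m\<leftarrow>ms. chi (Suc m))" by (rule rep_poly_sym_sum[OF sym_sum_alg(1)])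
  also have "\<dots> = (\<Sum>m<N. Polynomial.smult (real (k (Suc m))) (chi (Suc m)))"
  proof -
    have r: "sum_list (replicate j p) = Polynomial.smult (real j) p" for j and p :: "real poly"
      by (induction j) (simp_all add: smult_add_left)
    show ?thesis unfolding ms_def by (induction N) (simp_all add: r)
  qed
  also have "\<dots> = (\<Sum>d\<in>{1..N}. Polynomial.smult (real (k d)) (chi d))"
    by (rule sum.reindex_bij_witness[where i = "\<lambda>d. d - 1" and j = Suc]) auto
  finally have p: "rep_poly (sym_sum ms) = (\<Sum>d\<in>{1..N}. Polynomial.smult (real (k d)) (chi d))" .
  have "0 \<in> set ms" unfolding ms_def using assms by (auto intro!: bexI[of _ 0])
  then have "0 < rep_dim (sym_sum ms)" unfolding sym_sum_alg(2) by (cases ms) auto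
  then show ?thesis using that p sym_sum_alg(1) by blast
qed

section \<open>Hyperbolic sines and dimensions\<close>

lemma chi_at_2: "poly (chi d) 2 = real d"
  by (induction d rule: chi.induct) auto

lemma sinh_chi: "sinh \<alpha> * poly (chi d) (2 * cosh \<alpha>) = sinh (\<alpha> * real d)"
proof (induction d rule: chi.induct)
  case (3 n)
  let ?b = "\<alpha> * real (Suc n)"
  have "sinh \<alpha> * poly (chi (Suc (Suc n))) (2 * cosh \<alpha>)
      = 2 * cosh \<alpha> * (sinh \<alpha> * poly (chi (Suc n)) (2 * cosh \<alpha>)) - sinh \<alpha> * poly (chi n) (2 * cosh \<alpha>)"
    by (simp add: algebra_simps)
  also have "\<dots> = 2 * cosh \<alpha> * sinh ?b - sinh (\<alpha> * real n)" unfolding 3 ..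
  also have "\<alpha> * real n = ?b - \<alpha>" by (simp add: algebra_simps)
  also have "2 * cosh \<alpha> * sinh ?b - sinh (?b - \<alpha>) = sinh (?b + \<alpha>)" by (simp add: sinh_add sinh_diff)
  also have "?b + \<alpha> = \<alpha> * real (Suc (Suc n))" by (simp add: algebra_simps)
  finally show ?case .
qed simp_all

lemma sinh_sum_eq:
  assumes "0 \<le> \<alpha>" shows "sinh_sum \<rho> \<alpha> = poly (rep_poly \<rho>) (2 * cosh \<alpha>)"
proof -
  have "sinh_quotient \<alpha> d = poly (chi d) (2 * cosh \<alpha>)" for d
  proof (cases "\<alpha> = 0")
    case False
    then have "sinh \<alpha> \<noteq> 0" by simp
    then show ?thesis using False sinh_chi[of \<alpha> d] by (simp add: sinh_quotient_def field_simps)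
  qed (simp add: sinh_quotient_def chi_at_2)
  then show ?thesis by (simp add: sinh_sum_def rep_poly_def poly_sum)
qed

lemma all_cosh_iff: "(\<forall>\<alpha>\<ge>0. P (2 * cosh \<alpha>)) \<longleftrightarrow> (\<forall>u\<ge>2. P (u :: real))"
proof
  assume L: "\<forall>\<alpha>\<ge>0. P (2 * cosh \<alpha>)"
  show "\<forall>u\<ge>2. P u"
  proof (intro allI impI)
    fix u :: real assume "2 \<le> u"
    then have "2 * cosh (arcosh (u / 2)) = u" "0 \<le> arcosh (u / 2)" by (auto simp: arcosh_nonneg_real)
    then show "P u" using L by metis
  qed
next
  assume "\<forall>u\<ge>2. P u"
  moreover have "2 \<le> 2 * cosh \<alpha>" for \<alpha> :: real using cosh_real_ge_1[of \<alpha>] by simp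
  ultimately show "\<forall>\<alpha>\<ge>0. P (2 * cosh \<alpha>)" by blast
qed

text \<open>The dimension of the largest irreducible constituent exceeds the degree of the character by one.\<close>

lemma max_dim_eq:
  assumes \<rho>: "alg_rep \<rho>"
  shows "max_dim \<rho> = (if rep_poly \<rho> = 0 then - \<infinity> else ereal (real (Suc (degree (rep_poly \<rho>)))))"
proof (cases "rep_poly \<rho> = 0")
  case True
  then have "mult_supp \<rho> = {}" using chi_coeff_rep_poly[OF \<rho>] by (auto simp: mult_supp_def)
  then show ?thesis using True by (simp add: max_dim_def)
next
  case False
  let ?d = "Suc (degree (rep_poly \<rho>))"
  have "real (mult_map \<rho> ?d) \<noteq> 0" using False chi_coeff_top[of "rep_poly \<rho>"] unfolding chi_coeff_rep_poly[OF \<rho>] by simp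
  then have d: "?d \<in> mult_supp \<rho>" by (simp add: mult_supp_def)
  have "e \<le> ?d" if "e \<in> mult_supp \<rho>" for e
  proof (rule ccontr)
    assume "\<not> e \<le> ?d"
    then have "chi_coeff (rep_poly \<rho>) e = 0" by (intro chi_coeff_beyond_degree) simp
    then show False using that unfolding chi_coeff_rep_poly[OF \<rho>] by (simp add: mult_supp_def)
  qed
  then have "Max (mult_supp \<rho>) = ?d" using d finite_mult_supp[OF \<rho>] by (intro Max_eqI) auto
  then show ?thesis using False d by (auto simp: max_dim_def)
qed

text \<open>On \<open>[2,\<infinity>)\<close> the recurrence is at least that of the natural numbers.\<close>

lemma chi_mono: assumes "2 \<le> u" shows "0 \<le> poly (chi n) u \<and> poly (chi n) u + 1 \<le> poly (chi (Suc n)) u"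
proof (induction n)
  case (Suc n)
  have "2 * poly (chi (Suc n)) u \<le> u * poly (chi (Suc n)) u" using Suc assms by (intro mult_right_mono) auto
  moreover have "poly (chi (Suc (Suc n))) u = u * poly (chi (Suc n)) u - poly (chi n) u" by simp
  ultimately show ?case using Suc by linarith
qed simp

lemma cone_nonneg:
  assumes "p \<in> cone" "2 \<le> u" shows "0 \<le> poly p u"
proof -
  have "poly p u = (\<Sum>d\<in>{1..Suc (degree p)}. chi_coeff p d * poly (chi d) u)"
    using chi_expansion[of p "Suc (degree p)"] by (metis (no_types, lifting) lessI poly_smult poly_sum sum.cong)
  also have "0 \<le> \<dots>"
    using assms chi_mono[OF assms(2)] by (intro sum_nonneg mult_nonneg_nonneg) (auto simp: cone_def)
  finally show ?thesis .
qed

lemma cone_pos: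
  assumes "p \<in> cone" "p \<noteq> 0" "2 \<le> u" shows "0 < poly p u"
proof -
  let ?d = "Suc (degree p)"
  have "0 < chi_coeff p ?d" using assms(1,2) by (simp add: cone_def chi_coeff_top less_le) (metis chi_coeff_top)
  moreover have "0 < poly (chi ?d) u" using chi_mono[OF assms(3), of "degree p"] by linarith
  moreover have "p - Polynomial.smult (chi_coeff p ?d) (chi ?d) \<in> cone"
    using assms(1) by (auto simp: cone_def chi_coeff_diff chi_coeff_smult chi_coeff_chi)
  then have "0 \<le> poly (p - Polynomial.smult (chi_coeff p ?d) (chi ?d)) u" using assms(3) by (rule cone_nonneg)
  then have "chi_coeff p ?d * poly (chi ?d) u \<le> poly p u" by simp
  ultimately show ?thesis by (meson less_le_trans mult_pos_pos)
qed

section \<open>Catalytic and asymptotic embeddings\<close>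

theorem theorem5p1:
  fixes \<rho> \<sigma> :: rep
  assumes "alg_rep \<rho>" and "alg_rep \<sigma>"
  shows
    "((\<forall>\<alpha>\<ge>0. sinh_sum \<rho> \<alpha> < sinh_sum \<sigma> \<alpha>) \<and> max_dim \<rho> < max_dim \<sigma> \<longrightarrow>
        (\<exists>\<eta>. alg_rep \<eta> \<and> rep_dim \<eta> > 0 \<and> embeds (rep_tensor \<rho> \<eta>) (rep_tensor \<sigma> \<eta>)) \<and>
        (generic_rep \<sigma> \<longrightarrow>
          (\<exists>n\<^sub>0. \<forall>n\<ge>n\<^sub>0. embeds (rep_tensor_pow \<rho> n) (rep_tensor_pow \<sigma> n))))
     \<and> ((\<exists>\<eta>. alg_rep \<eta> \<and> rep_dim \<eta> > 0 \<and> embeds (rep_tensor \<rho> \<eta>) (rep_tensor \<sigma> \<eta>)) \<or>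
        (\<exists>n\<ge>1. embeds (rep_tensor_pow \<rho> n) (rep_tensor_pow \<sigma> n)) \<longrightarrow>
          (\<forall>\<alpha>\<ge>0. sinh_sum \<rho> \<alpha> \<le> sinh_sum \<sigma> \<alpha>) \<and> max_dim \<rho> \<le> max_dim \<sigma>)"
proof -
  note \<rho> = assms(1) and \<sigma> = assms(2)
  define R where "R = rep_poly \<rho>"
  define S where "S = rep_poly \<sigma>"
  have Rc: "R \<in> cone" and Sc: "S \<in> cone" unfolding R_def S_def using rep_poly_cone \<rho> \<sigma> by auto
  have lt_iff: "(\<forall>\<alpha>\<ge>0. sinh_sum \<rho> \<alpha> < sinh_sum \<sigma> \<alpha>) \<longleftrightarrow> (\<forall>u\<ge>2. poly R u < poly S u)"
    unfolding all_cosh_iff[symmetric] by (simp add: sinh_sum_eq R_def S_def)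
  have le_iff: "(\<forall>\<alpha>\<ge>0. sinh_sum \<rho> \<alpha> \<le> sinh_sum \<sigma> \<alpha>) \<longleftrightarrow> (\<forall>u\<ge>2. poly R u \<le> poly S u)"
    unfolding all_cosh_iff[symmetric] by (simp add: sinh_sum_eq R_def S_def)
  have tensor_iff: "embeds (rep_tensor \<rho> \<eta>) (rep_tensor \<sigma> \<eta>) \<longleftrightarrow> (S - R) * rep_poly \<eta> \<in> cone" if "alg_rep \<eta>" for \<eta>
    unfolding embeds_iff_cone[OF alg_rep_tensor[OF \<rho> that] alg_rep_tensor[OF \<sigma> that]]
      rep_poly_tensor[OF \<rho> that] rep_poly_tensor[OF \<sigma> that] R_def S_def by (simp add: left_diff_distrib)
  have pow_iff: "embeds (rep_tensor_pow \<rho> n) (rep_tensor_pow \<sigma> n) \<longleftrightarrow> S ^ n - R ^ n \<in> cone" for n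
    unfolding embeds_iff_cone[OF rep_tensor_pow(1)[OF \<rho>] rep_tensor_pow(1)[OF \<sigma>]]
      rep_tensor_pow(2)[OF \<rho>] rep_tensor_pow(2)[OF \<sigma>] R_def S_def ..
  have catalytic: "\<exists>\<eta>. alg_rep \<eta> \<and> rep_dim \<eta> > 0 \<and> embeds (rep_tensor \<rho> \<eta>) (rep_tensor \<sigma> \<eta>)"
    if "\<forall>u\<ge>2. poly R u < poly S u"
  proof -
    have "0 < poly (S - R) u" if "2 \<le> u" for u using \<open>\<forall>u\<ge>2. poly R u < poly S u\<close> that by simp
    then obtain N k where "1 \<le> N" "0 < k 1" "(S - R) * (\<Sum>d\<in>{1..N}. Polynomial.smult (real (k d)) (chi d)) \<in> cone"
      by (rule natural_catalyst)
    then show ?thesis using rep_with_multiplicities[of N k] tensor_iff by metis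
  qed
  have asymptotic: "\<exists>n\<^sub>0. \<forall>n\<ge>n\<^sub>0. embeds (rep_tensor_pow \<rho> n) (rep_tensor_pow \<sigma> n)"
    if RS: "\<forall>u\<ge>2. poly R u < poly S u" and dim: "max_dim \<rho> < max_dim \<sigma>" and gen: "generic_rep \<sigma>"
  proof (cases "R = 0")
    case True
    \<comment> \<open>\<open>\<rho>\<close> is the zero representation, but its zeroth power is the trivial one, so the bound starts at \<open>1\<close>\<close>
    have "S ^ n - R ^ n \<in> cone" if "1 \<le> n" for n
      using that True cone_power[OF Sc, of n] by (simp add: zero_power)
    then show ?thesis unfolding pow_iff by blast
  next
    case False
    have "S \<noteq> 0" using RS cone_pos[OF Rc False, of 2] by force
    then have deg: "degree R < degree S" using dim False unfolding max_dim_eq[OF \<rho>] max_dim_eq[OF \<sigma>] R_def S_def by simp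
    have "S - 1 \<in> cone" "S - [:0, 1:] \<in> cone"
      using gen unfolding generic_rep_def embeds_iff_cone[OF trivial_rep(1) \<sigma>] embeds_iff_cone[OF standard_rep(1) \<sigma>]
        trivial_rep(2) standard_rep(2) S_def by auto
    then have a: "0 \<le> chi_coeff (S - 1) d" "0 \<le> chi_coeff (S - [:0, 1:]) d" for d by (auto simp: cone_def)
    have "S - one_plus_u \<in> cone"
      unfolding cone_def
    proof safe
      fix d
      have e: "one_plus_u = 1 + [:0, 1:]" by (simp add: one_pCons)
      have c: "chi_coeff [:0, 1:] d = (if d = 2 then 1 else 0)" using chi_coeff_X_mult[of 1 d] by (auto simp: chi_coeff_1)
      show "0 \<le> chi_coeff (S - one_plus_u) d"
        using a[of d] Sc unfolding e chi_coeff_diff chi_coeff_add chi_coeff_1 c by (auto simp: cone_def split: if_splits)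
    qed
    then obtain n0 where "\<forall>n\<ge>n0. S ^ n - R ^ n \<in> cone"
      using asymptotic_cone[OF Rc _ cone_pos[OF Rc False] _ deg] RS by blast
    then show ?thesis unfolding pow_iff by blast
  qed
  have converse: "\<forall>u\<ge>2. poly R u \<le> poly S u"
    if "(\<exists>\<eta>. alg_rep \<eta> \<and> rep_dim \<eta> > 0 \<and> embeds (rep_tensor \<rho> \<eta>) (rep_tensor \<sigma> \<eta>)) \<or>
        (\<exists>n\<ge>1. embeds (rep_tensor_pow \<rho> n) (rep_tensor_pow \<sigma> n))"
  proof (intro allI impI)
    fix u :: real assume u: "2 \<le> u"
    show "poly R u \<le> poly S u"
      using that
    proof (elim disjE exE conjE)
      fix \<eta> assume \<eta>: "alg_rep \<eta>" "0 < rep_dim \<eta>" "embeds (rep_tensor \<rho> \<eta>) (rep_tensor \<sigma> \<eta>)"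
      have "rep_poly \<eta> \<noteq> 0" using rep_poly_eq_0[OF \<eta>(1)] \<eta>(2) by auto
      then have "0 < poly (rep_poly \<eta>) u" using rep_poly_cone[OF \<eta>(1)] u by (intro cone_pos)
      moreover have "0 \<le> poly ((S - R) * rep_poly \<eta>) u" using \<eta>(3) u unfolding tensor_iff[OF \<eta>(1)] by (rule cone_nonneg)
      ultimately show ?thesis by (simp add: zero_le_mult_iff)
    next
      fix n :: nat assume n: "1 \<le> n" "embeds (rep_tensor_pow \<rho> n) (rep_tensor_pow \<sigma> n)"
      have "0 \<le> poly (S ^ n - R ^ n) u" using n(2) u unfolding pow_iff by (rule cone_nonneg)
      then have "poly R u ^ n \<le> poly S u ^ n" by simp
      then show ?thesis using n(1) cone_nonneg[OF Sc u] by (metis One_nat_def Suc_le_D power_le_imp_le_base)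
    qed
  qed
  have dims: "max_dim \<rho> \<le> max_dim \<sigma>" if RS: "\<forall>u\<ge>2. poly R u \<le> poly S u"
  proof (cases "R = 0")
    case False
    have "S \<noteq> 0" using RS cone_pos[OF Rc False, of 2] by force
    moreover have "degree R \<le> degree S"
    proof (rule ccontr)
      assume "\<not> degree R \<le> degree S"
      then have SR: "degree S < degree R" by simp
      then have "degree (R - S) = degree R" using degree_add_eq_left[of "- S" R] by simp
      then have "lead_coeff (R - S) = lead_coeff R" using SR by (simp add: coeff_eq_0)
      moreover have "0 < lead_coeff R" using cone_pos[OF Rc False] by (rule lead_coeff_pos)
      ultimately obtain K where K: "\<forall>x\<ge>K. lead_coeff (R - S) \<le> poly (R - S) x" "0 < lead_coeff (R - S)"
        using poly_pinfty_gt_lc[of "R - S"] by auto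
      then have "0 < poly (R - S) (max K 2)" by (meson less_le_trans max.cobounded1)
      then show False using RS by (simp add: not_less[symmetric])
    qed
    ultimately show ?thesis using False unfolding max_dim_eq[OF \<rho>] max_dim_eq[OF \<sigma>] R_def S_def by simp
  qed (simp add: max_dim_eq[OF \<rho>] R_def)
  show ?thesis
    unfolding lt_iff le_iff using catalytic asymptotic converse dims by blast
qed

end
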